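(* Let $1\le q<\infty$. Assume that $|F|\in L^q_{\mathrm{loc}}(\Omega_T)$ and that $u\in L^q_{\mathrm{loc}}(0,T;W^{1,q}_{\mathrm{loc}}(\Omega;\mathbb{R}^N))$ satisfies $$\iint_{\Omega_T}\bigl(-u\cdot\varphi_t+\mathcal{A}(z,\nabla u)\cdot\nabla\varphi\bigr)\,dz=\iint_{\Omega_T}F\cdot\nabla\varphi\,dz$$ for every $\varphi\in C_0^\infty(\Omega_T;\mathbb{R}^N)$. (i) If $1\le q<n+2$, then for $1\le q\le q^*<\frac{q(n+2)}{n+2-q}$ there exists a constant $c=c(n,q,q^*,L)$ such that $$\left(\frac1{|Q|}\iint_{Q}\frac{|u-u_{Q}|^{q^*}}{\rho^{q^*}}\,dz\right)^{\frac1{q^*}}\le c\left(\frac1{|Q|}\iint_{Q}(|\nabla u|+|F|)^q\,dz\right)^{\frac1q}$$ for every parabolic cylinder $Q=Q_\rho\Subset\Omega_T$. (ii) If $q=n+2$, then there exists a constant $c=c(n,L)$ such that $$\frac1{|Q|}\iint_Q\exp\left(\left(\frac{|u-u_{Q}|}{c\rho\left(\frac1{|Q|}\iint_{Q}(|\nabla u|+|F|)^{n+2}\,dz\right)^{\frac1{n+2}}}\right)^{\frac{n+2}{n+1}}\right)dz\le c$$ for every parabolic cylinder $Q=Q_\rho\Subset\Omega_T$. (iii) If $q>n+2$, then there exists a constant $c=c(n,q,L)$ such that $$\operatorname*{ess\,sup}_Q\frac{|u-u_{Q}|}{\rho}\le c\left(\frac1{|Q|}\iint_{Q}(|\nabla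 u|+|F|)^q\,dz\right)^{\frac1q}$$ for every parabolic cylinder $Q=Q_\rho\Subset\Omega_T$.
   Context: $\Omega\subset\mathbb{R}^n$, $n\ge1$, is a bounded open domain, $T>0$, $\Omega_T=\Omega\times(0,T)$, $N\ge1$, $0<\nu<L<\infty$. $\mathcal{A}:\Omega_T\times\mathbb{R}^{Nn}\to\mathbb{R}^{Nn}$ is a Carathéodory vector field ($\mathcal{A}(\cdot,\xi)$ measurable for every $\xi$, $\mathcal{A}(z,\cdot)$ continuous for a.e. $z$) with $\nu|\xi|^2\le\mathcal{A}(z,\xi)\cdot\xi$ and $|\mathcal{A}(z,\xi)|\le L|\xi|$ for a.e. $z\in\Omega_T$ and every $\xi\in\mathbb{R}^{Nn}$. $F:\Omega_T\to\mathbb{R}^{Nn}$ is measurable. We write $z=(x,t)$, $dz=dx\,dt$, and $\nabla$ is the gradient in $x$. $u\in L^q_{\mathrm{loc}}(0,T;W^{1,q}_{\mathrm{loc}}(\Omega;\mathbb{R}^N))$ means that for all $\Omega'\Subset\Omega$ and $0<t_1<t_2<T$ one has $u(\cdot,t)\in W^{1,q}(\Omega';\mathbb{R}^N)$ for a.e. $t\in(t_1,t_2)$ and $\int_{t_1}^{t_2}\int_{\Omega'}(|u|^q+|\nabla u|^q)\,dx\,dt<\infty$. A parabolic cylinder of radius $\rho>0$ centered at $(x_0,t_0)$ is $Q_\rho=B_\rho(x_0)\times(t_0-\rho^2,t_0+\rho^2)$. $u_Q=\frac1{|Q|}\iint_Q u\,dz$ (componentwise). $Q\Subset\Omega_T$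 means that the closure of $Q$ is a compact subset of $\Omega_T$. In (ii), if the denominator vanishes the quotient is read as $0$. *)

theory Defs
  imports "HOL-Analysis.Analysis" "HOL-Probability.Essential_Supremum"
begin

text \<open>
  The domain lives in \<open>real ^ 'n\<close>, but the number \<open>N\<close> of components of the solution is a natural
  number rather than a type: the constants of the estimates do not depend on \<open>N\<close>, and
  a dependence on a type cannot be excluded by the order of quantifiers.  An element of
  \<open>'b\<^sup>N\<close> is a function on \<open>nat\<close> that vanishes from index \<open>N\<close> on; on this set the product topology
  of \<open>nat \<Rightarrow> 'b\<close> is the usual topology of \<open>'b\<^sup>N\<close>.  Elements of \<open>\<real>\<^sup>N\<^sup>n\<close> are \<open>N\<close>-tuples of
  vectors of type \<open>real ^ 'n\<close>.
\<close>

definition tuples :: "nat \<Rightarrow> (nat \<Rightarrow> 'b::zero) set" where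
  "tuples N = {v. \<forall>i\<ge>N. v i = 0}"

definition tnorm :: "nat \<Rightarrow> (nat \<Rightarrow> 'b::real_normed_vector) \<Rightarrow> real" where
  "tnorm N v = L2_set (\<lambda>i. norm (v i)) {..<N}"

definition tinner :: "nat \<Rightarrow> (nat \<Rightarrow> 'b::real_inner) \<Rightarrow> (nat \<Rightarrow> 'b) \<Rightarrow> real" where
  "tinner N v w = (\<Sum>i<N. v i \<bullet> w i)"

definition compactly_inside :: "'a::topological_space set \<Rightarrow> 'a set \<Rightarrow> bool"
    (infix \<open>\<Subset>\<close> 50) where
  "U \<Subset> S \<longleftrightarrow> compact (closure U) \<and> closure U \<subseteq> S"

definition mean :: "'a::euclidean_space set \<Rightarrow> ('a \<Rightarrow> real) \<Rightarrow> real" where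
  "mean Q f = (1 / measure lebesgue Q) * (LINT z|lebesgue_on Q. f z)"


primrec C_k :: "nat \<Rightarrow> ('a::real_normed_vector \<Rightarrow> real) \<Rightarrow> bool" where
  "C_k 0 f \<longleftrightarrow> continuous_on UNIV f"
| "C_k (Suc k) f \<longleftrightarrow>
     (\<forall>z. f differentiable (at z)) \<and> (\<forall>v. C_k k (\<lambda>z. frechet_derivative f (at z) v))"

text \<open>\<open>C\<^sub>0\<^sup>\<infinity>(S)\<close>; its elements are extended by zero to the whole space.\<close>

definition test_function :: "'a::real_normed_vector set \<Rightarrow> ('a \<Rightarrow> real) \<Rightarrow> bool" where
  "test_function S \<phi> \<longleftrightarrow> (\<forall>k. C_k k \<phi>) \<and> {z. \<phi> z \<noteq> 0} \<Subset> S"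

definition partial_x :: "((real ^ 'n) \<Rightarrow> real) \<Rightarrow> 'n::finite \<Rightarrow> real ^ 'n \<Rightarrow> real" where
  "partial_x \<psi> j x = frechet_derivative \<psi> (at x) (axis j 1)"

definition grad_x :: "((real ^ 'n::finite) \<times> real \<Rightarrow> real) \<Rightarrow> (real ^ 'n) \<times> real \<Rightarrow> real ^ 'n" where
  "grad_x \<phi> z = (\<chi> j. frechet_derivative \<phi> (at z) (axis j 1, 0))"

definition deriv_t :: "((real ^ 'n::finite) \<times> real \<Rightarrow> real) \<Rightarrow> (real ^ 'n) \<times> real \<Rightarrow> real" where
  "deriv_t \<phi> z = frechet_derivative \<phi> (at z) (0, 1)"


definition Lq :: "real \<Rightarrow> 'a::euclidean_space set \<Rightarrow> ('a \<Rightarrow> 'b::euclidean_space) \<Rightarrow> bool" where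
  "Lq q S f \<longleftrightarrow> f \<in> borel_measurable (lebesgue_on S) \<and>
     integrable (lebesgue_on S) (\<lambda>x. norm (f x) powr q)"

definition Lq_loc :: "real \<Rightarrow> 'a::euclidean_space set \<Rightarrow> ('a \<Rightarrow> 'b::euclidean_space) \<Rightarrow> bool" where
  "Lq_loc q S f \<longleftrightarrow> (\<forall>K. compact K \<and> K \<subseteq> S \<longrightarrow> Lq q K f)"

text \<open>\<open>v \<in> W\<^sup>1\<^sup>,\<^sup>q(U)\<close>, and \<open>g\<close> is (a version of) its weak gradient.\<close>

definition W1q :: "real \<Rightarrow> (real ^ 'n::finite) set \<Rightarrow> (real ^ 'n \<Rightarrow> real) \<Rightarrow> (real ^ 'n \<Rightarrow> real ^ 'n) \<Rightarrow> bool"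
  where
  "W1q q U v g \<longleftrightarrow> Lq q U v \<and> Lq q U g \<and>
     (\<forall>\<psi> j. test_function U \<psi> \<longrightarrow>
        (LINT x|lebesgue_on U. v x * partial_x \<psi> j x) = - (LINT x|lebesgue_on U. (g x $ j) * \<psi> x))"

definition time_cylinder :: "(real ^ 'n::finite) set \<Rightarrow> real \<Rightarrow> ((real ^ 'n) \<times> real) set" where
  "time_cylinder \<Omega> T = \<Omega> \<times> {0<..<T}"

definition parabolic_cylinder :: "real ^ 'n::finite \<Rightarrow> real \<Rightarrow> real \<Rightarrow> ((real ^ 'n) \<times> real) set" where
  "parabolic_cylinder x0 t0 \<rho> = ball x0 \<rho> \<times> {t0 - \<rho>\<^sup>2 <..< t0 + \<rho>\<^sup>2}"

text \<open>
  \<open>u \<in> L\<^sup>q\<^sub>l\<^sub>o\<^sub>c(0,T; W\<^sup>1\<^sup>,\<^sup>q\<^sub>l\<^sub>o\<^sub>c(\<Omega>; \<real>\<^sup>N))\<close> with spatial weak gradient \<open>Du\<close>.  The space-time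
  integral over \<open>\<Omega>' \<times> (t\<^sub>1,t\<^sub>2)\<close> presupposes a jointly measurable version of the gradient.
\<close>

definition LqW1q_loc ::
  "real \<Rightarrow> nat \<Rightarrow> (real ^ 'n::finite) set \<Rightarrow> real \<Rightarrow> ((real ^ 'n) \<times> real \<Rightarrow> nat \<Rightarrow> real)
     \<Rightarrow> ((real ^ 'n) \<times> real \<Rightarrow> nat \<Rightarrow> real ^ 'n) \<Rightarrow> bool" where
  "LqW1q_loc q N \<Omega> T u Du \<longleftrightarrow>
     (\<forall>z \<in> time_cylinder \<Omega> T. u z \<in> tuples N \<and> Du z \<in> tuples N) \<and>
     (\<forall>i<N. (\<lambda>z. u z i) \<in> borel_measurable (lebesgue_on (time_cylinder \<Omega> T)) \<and>
            (\<lambda>z. Du z i) \<in> borel_measurable (lebesgue_on (time_cylinder \<Omega> T))) \<and>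
     (\<forall>\<Omega>' t1 t2. open \<Omega>' \<and> \<Omega>' \<Subset> \<Omega> \<and> 0 < t1 \<and> t1 < t2 \<and> t2 < T \<longrightarrow>
        (AE t in lebesgue_on {t1<..<t2}. \<forall>i<N. W1q q \<Omega>' (\<lambda>x. u (x, t) i) (\<lambda>x. Du (x, t) i)) \<and>
        integrable (lebesgue_on (\<Omega>' \<times> {t1<..<t2}))
          (\<lambda>z. tnorm N (u z) powr q + tnorm N (Du z) powr q))"


definition caratheodory ::
  "nat \<Rightarrow> 'a::euclidean_space set \<Rightarrow> ('a \<Rightarrow> (nat \<Rightarrow> real ^ 'n::finite) \<Rightarrow> (nat \<Rightarrow> real ^ 'n)) \<Rightarrow> bool"
  where
  "caratheodory N S A \<longleftrightarrow>
     (\<forall>z \<in> S. \<forall>\<xi> \<in> tuples N. A z \<xi> \<in> tuples N) \<and>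
     (\<forall>\<xi> \<in> tuples N. \<forall>i<N. (\<lambda>z. A z \<xi> i) \<in> borel_measurable (lebesgue_on S)) \<and>
     (AE z in lebesgue_on S. continuous_on (tuples N) (A z))"

definition structure_conditions ::
  "real \<Rightarrow> real \<Rightarrow> nat \<Rightarrow> 'a::euclidean_space set
     \<Rightarrow> ('a \<Rightarrow> (nat \<Rightarrow> real ^ 'n::finite) \<Rightarrow> (nat \<Rightarrow> real ^ 'n)) \<Rightarrow> bool" where
  "structure_conditions \<nu> L N S A \<longleftrightarrow>
     (AE z in lebesgue_on S. \<forall>\<xi> \<in> tuples N.
        \<nu> * (tnorm N \<xi>)\<^sup>2 \<le> tinner N (A z \<xi>) \<xi> \<and> tnorm N (A z \<xi>) \<le> L * tnorm N \<xi>)"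

definition satisfies_weak_equation ::
  "nat \<Rightarrow> ((real ^ 'n::finite) \<times> real) set
     \<Rightarrow> ((real ^ 'n) \<times> real \<Rightarrow> (nat \<Rightarrow> real ^ 'n) \<Rightarrow> (nat \<Rightarrow> real ^ 'n))
     \<Rightarrow> ((real ^ 'n) \<times> real \<Rightarrow> nat \<Rightarrow> real ^ 'n) \<Rightarrow> ((real ^ 'n) \<times> real \<Rightarrow> nat \<Rightarrow> real)
     \<Rightarrow> ((real ^ 'n) \<times> real \<Rightarrow> nat \<Rightarrow> real ^ 'n) \<Rightarrow> bool" where
  "satisfies_weak_equation N S A F u Du \<longleftrightarrow>
     (\<forall>\<phi> :: (real ^ 'n) \<times> real \<Rightarrow> nat \<Rightarrow> real.
        (\<forall>z. \<phi> z \<in> tuples N) \<and> (\<forall>i<N. test_function S (\<lambda>z. \<phi> z i)) \<longrightarrow>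
        (LINT z|lebesgue_on S.
           - tinner N (u z) (\<lambda>i. deriv_t (\<lambda>w. \<phi> w i) z)
           + tinner N (A z (Du z)) (\<lambda>i. grad_x (\<lambda>w. \<phi> w i) z))
        = (LINT z|lebesgue_on S. tinner N (F z) (\<lambda>i. grad_x (\<lambda>w. \<phi> w i) z)))"

definition parabolic_system_solution ::
  "real \<Rightarrow> real \<Rightarrow> real \<Rightarrow> nat \<Rightarrow> (real ^ 'n::finite) set \<Rightarrow> real
     \<Rightarrow> ((real ^ 'n) \<times> real \<Rightarrow> (nat \<Rightarrow> real ^ 'n) \<Rightarrow> (nat \<Rightarrow> real ^ 'n))
     \<Rightarrow> ((real ^ 'n) \<times> real \<Rightarrow> nat \<Rightarrow> real ^ 'n) \<Rightarrow> ((real ^ 'n) \<times> real \<Rightarrow> nat \<Rightarrow> real)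
     \<Rightarrow> ((real ^ 'n) \<times> real \<Rightarrow> nat \<Rightarrow> real ^ 'n) \<Rightarrow> bool" where
  "parabolic_system_solution q \<nu> L N \<Omega> T A F u Du \<longleftrightarrow>
     1 \<le> N \<and> 0 < \<nu> \<and> \<nu> < L \<and> 0 < T \<and>
     open \<Omega> \<and> connected \<Omega> \<and> bounded \<Omega> \<and> \<Omega> \<noteq> {} \<and>
     caratheodory N (time_cylinder \<Omega> T) A \<and>
     structure_conditions \<nu> L N (time_cylinder \<Omega> T) A \<and>
     (\<forall>z \<in> time_cylinder \<Omega> T. F z \<in> tuples N) \<and>
     (\<forall>i<N. (\<lambda>z. F z i) \<in> borel_measurable (lebesgue_on (time_cylinder \<Omega> T))) \<and>
     Lq_loc q (time_cylinder \<Omega> T) (\<lambda>z. tnorm N (F z)) \<and>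
     LqW1q_loc q N \<Omega> T u Du \<and>
     satisfies_weak_equation N (time_cylinder \<Omega> T) A F u Du"

text \<open>\<open>|u - u\<^sub>Q|\<close>, with the mean value taken componentwise.\<close>

definition deviation :: "nat \<Rightarrow> 'a::euclidean_space set \<Rightarrow> ('a \<Rightarrow> nat \<Rightarrow> real) \<Rightarrow> 'a \<Rightarrow> real" where
  "deviation N Q u z = tnorm N (\<lambda>i. u z i - mean Q (\<lambda>w. u w i))"

definition data_mean ::
  "real \<Rightarrow> nat \<Rightarrow> 'a::euclidean_space set \<Rightarrow> ('a \<Rightarrow> nat \<Rightarrow> real ^ 'n::finite)
     \<Rightarrow> ('a \<Rightarrow> nat \<Rightarrow> real ^ 'n) \<Rightarrow> real" where
  "data_mean q N Q Du F = mean Q (\<lambda>z. (tnorm N (Du z) + tnorm N (F z)) powr q) powr (1 / q)"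

end

theory Submission
  imports Defs "HOL-Probability.Probability_Measure" "HOL-Computational_Algebra.Polynomial"
begin

text \<open>
  All three estimates follow from one pointwise bound by a Riesz potential.  Let \<open>D = n + 2\<close> be the
  homogeneous dimension of parabolic space and put \<open>G = A(z, \<nabla>u) - F\<close>, so that the system reads
  \<open>u\<^sub>t = div G\<close> with \<open>|G| \<le> L |\<nabla>u| + |F|\<close>.  A parabolic change of variables turns the given cylinder
  into the unit cylinder \<open>Q\<^sub>1\<close>, the product of the unit ball and the interval \<open>(-1,1)\<close>.

  Fix a smooth bump \<open>\<phi>\<close> with support in \<open>Q\<^sub>1\<close> and integral 1.  For \<open>z \<in> Q\<^sub>1\<close> and \<open>0 < s \<le> 1\<close> the parabolic
  dilation with centre \<open>z\<close> and factor \<open>s\<close> maps \<open>Q\<^sub>1\<close> into itself, because the ball and the interval are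
  convex.  Let \<open>\<phi>\<^sub>s\<close> be the image of \<open>\<phi>\<close> under this dilation.  The average of \<open>u\<close> with weight \<open>\<phi>\<^sub>s\<close>
  is a number independent of \<open>z\<close> for \<open>s = 1\<close>, and it tends to \<open>u(z)\<close> as \<open>s\<close> tends to \<open>0\<close>.  The
  derivative of \<open>\<phi>\<^sub>s\<close> in \<open>s\<close> is a sum of spatial and time derivatives of test functions on
  \<open>Q\<^sub>1\<close>: the definition of the weak gradient removes the spatial derivatives from the test functions at the price of
  \<open>\<nabla>u\<close>, and the equation replaces the time derivative by \<open>G\<close>.  The result is at most
  \<open>C s\<^sup>-\<^sup>D\<close> times the integral of \<open>|\<nabla>u| + |G|\<close> over the points at parabolic distance at most \<open>s\<close> from \<open>z\<close>.
  Integration over \<open>s\<close> gives, for almost every \<open>z\<close>,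
  \<open>|u(z) - \<integral> u \<phi>| \<le> C \<integral> d(z,y)\<^sup>1\<^sup>-\<^sup>D (|\<nabla>u| + |G|)(y) dy\<close>
  with the parabolic distance \<open>d\<close> (lemmas \<open>integral_kernel_ds\<close>, \<open>potential_estimate_smoothed\<close>,
  \<open>smoothing_tendsto_AE_subseq\<close>).

  The three cases are mapping properties of the kernel \<open>d\<^sup>1\<^sup>-\<^sup>D\<close>.  Since a parabolic ball of radius \<open>s\<close>
  has volume proportional to \<open>s\<^sup>D\<close>, the power \<open>d\<^sup>-\<^sup>a\<close> is integrable for \<open>a < D\<close>, with an integral
  of order \<open>1 / (D - a)\<close>.  For \<open>q < D\<close>, Young's inequality gives the bound from \<open>L\<^sup>q\<close> to \<open>L\<^sup>p\<close> as long as
  \<open>1/p > 1/q - 1/D\<close>.  For \<open>q = D\<close> it gives all moments of the potential, and the moment of order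
  \<open>p\<close> grows like \<open>(C p)\<close> to the power \<open>p (D-1)/D + 1\<close>; the exponential series with exponent \<open>D/(D-1)\<close> therefore converges.
  For \<open>q > D\<close>, the dual exponent of \<open>q\<close> is small enough for Hoelder's inequality to bound the potential.

  The constants do not depend on the number \<open>N\<close> of components: for every unit vector \<open>w\<close> the scalar
  function \<open>\<Sum>\<^sub>i w\<^sub>i u\<^sub>i\<close> satisfies an equation of the same kind with data bounded by the norms of
  the vector-valued data, and the norm of a vector is attained on such a \<open>w\<close>.
\<close>

section \<open>Smooth functions and a bump function\<close>

lemma C_k_SucI:
  assumes "\<And>z. (f has_derivative f' z) (at z)" and "\<And>v. C_k k (\<lambda>z. f' z v)"
  shows "C_k (Suc k) f"
proof -
  have "frechet_derivative f (at z) = f' z" for z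
    using frechet_derivative_at[OF assms(1)] by simp
  then show ?thesis
    using assms by (auto simp: differentiable_def)
qed

lemma C_k_lower: "C_k (Suc k) f \<Longrightarrow> C_k k f"
proof (induction k arbitrary: f)
  case 0
  then show ?case
    by (auto intro!: continuous_at_imp_continuous_on differentiable_imp_continuous_within)
next
  case (Suc k)
  then have "\<forall>v. C_k (Suc k) (\<lambda>z. frechet_derivative f (at z) v)" "\<forall>z. f differentiable (at z)"
    unfolding C_k.simps(2)[of "Suc k"] by blast+
  with Suc.IH show ?case by auto
qed

lemma C_k_Suc_has_derivative:
  "C_k (Suc k) f \<Longrightarrow> (f has_derivative frechet_derivative f (at z)) (at z)"
  by (simp add: frechet_derivative_works[symmetric])

lemma C_k_const: "C_k k (\<lambda>z::'a::real_normed_vector. c)"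
proof (induction k arbitrary: c)
  case (Suc k)
  show ?case
    by (rule C_k_SucI[where f'="\<lambda>z v. 0"]) (auto intro: Suc)
qed simp

lemma C_k_bounded_linear: "bounded_linear f \<Longrightarrow> C_k k f"
proof (cases k)
  case 0
  then show "bounded_linear f \<Longrightarrow> C_k k f" by (simp add: linear_continuous_on)
next
  case (Suc k)
  assume "bounded_linear f"
  then show ?thesis unfolding Suc
    by (intro C_k_SucI[where f'="\<lambda>z v. f v"] C_k_const bounded_linear_imp_has_derivative)
qed

lemma C_k_add: "C_k k f \<Longrightarrow> C_k k g \<Longrightarrow> C_k k (\<lambda>z. f z + g z)"
proof (induction k arbitrary: f g)
  case (Suc k)
  show ?case
    by (rule C_k_SucI[OF has_derivative_add[OF C_k_Suc_has_derivative[OF Suc.prems(1)]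
          C_k_Suc_has_derivative[OF Suc.prems(2)]]]) (use Suc in auto)
qed (auto intro: continuous_on_add)

lemma C_k_mult: "C_k k f \<Longrightarrow> C_k k g \<Longrightarrow> C_k k (\<lambda>z. f z * g z)"
proof (induction k arbitrary: f g)
  case (Suc k)
  show ?case
  proof (rule C_k_SucI[OF has_derivative_mult[OF C_k_Suc_has_derivative[OF Suc.prems(1)]
          C_k_Suc_has_derivative[OF Suc.prems(2)]]])
    fix v
    show "C_k k (\<lambda>z. f z * frechet_derivative g (at z) v + frechet_derivative f (at z) v * g z)"
      using Suc C_k_lower[OF Suc.prems(1)] C_k_lower[OF Suc.prems(2)]
      by (intro C_k_add Suc.IH) auto
  qed
qed (auto intro: continuous_on_mult)

lemma C_k_uminus: "C_k k f \<Longrightarrow> C_k k (\<lambda>z. - f z)"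
  using C_k_mult[OF C_k_const[of k "-1"], of f] by simp

lemma C_k_diff: "C_k k f \<Longrightarrow> C_k k g \<Longrightarrow> C_k k (\<lambda>z. f z - g z)"
  using C_k_add[OF _ C_k_uminus[of k g], of f] by simp

lemma C_k_sum: "(\<And>i. i \<in> I \<Longrightarrow> C_k k (f i)) \<Longrightarrow> C_k k (\<lambda>z. \<Sum>i\<in>I. f i z)"
  by (induction I rule: infinite_finite_induct) (auto intro: C_k_add C_k_const)

lemma C_k_compose_affine:
  assumes l: "bounded_linear l" and "C_k k f"
  shows "C_k k (\<lambda>z. f (a + l z))"
  using assms(2)
proof (induction k arbitrary: f)
  case 0
  have "continuous_on UNIV (\<lambda>z. a + l z)"
    using l by (intro continuous_intros linear_continuous_on)
  then show ?case using 0
    by (auto intro: continuous_on_compose2[where t=UNIV])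
next
  case (Suc k)
  have "((\<lambda>z. f (a + l z)) has_derivative (\<lambda>v. frechet_derivative f (at (a + l z)) (l v))) (at z)" for z
  proof -
    have "((\<lambda>z. a + l z) has_derivative l) (at z)"
      using l by (auto intro!: derivative_eq_intros bounded_linear_imp_has_derivative)
    from diff_chain_at[OF this C_k_Suc_has_derivative[OF Suc.prems]]
    show ?thesis by (simp add: o_def)
  qed
  then show ?case
    by (rule C_k_SucI) (use Suc in \<open>auto intro!: Suc.IH\<close>)
qed

text \<open>
  Polynomials in \<open>1/x\<close> are included because derivatives of \<open>exp (-1/x)\<close> produce them; with
  them the family is closed under differentiation.
\<close>

definition flat_exp :: "real poly \<Rightarrow> real \<Rightarrow> real" where
  "flat_exp P x = (if x > 0 then poly P (1 / x) * exp (- (1 / x)) else 0)"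

lemma poly_times_exp_minus_tendsto_0:
  "((\<lambda>y. poly P y * exp (- y)) \<longlongrightarrow> (0::real)) at_top"
proof -
  have "((\<lambda>y. \<Sum>i\<le>degree P. coeff P i * (y ^ i / exp y)) \<longlongrightarrow> (\<Sum>i\<le>degree P. coeff P i * 0)) at_top"
    by (intro tendsto_intros tendsto_power_div_exp_0)
  then show ?thesis
    by (simp add: poly_altdef sum_distrib_right exp_minus divide_inverse mult.assoc)
qed

lemma flat_exp_tendsto_0: "(flat_exp P \<longlongrightarrow> 0) (at 0)"
proof -
  have "((\<lambda>x. poly P (inverse x) * exp (- inverse x)) \<longlongrightarrow> 0) (at_right 0)"
    by (rule filterlim_compose[OF poly_times_exp_minus_tendsto_0 filterlim_inverse_at_top_right])
  then have "(flat_exp P \<longlongrightarrow> 0) (at_right 0)"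
    by (rule Lim_transform_eventually)
      (auto simp: flat_exp_def inverse_eq_divide eventually_at_right_less intro!: eventually_at_rightI[of 0 1])
  moreover have "(flat_exp P \<longlongrightarrow> 0) (at_left 0)"
    by (rule tendsto_eventually) (auto simp: flat_exp_def intro!: eventually_at_leftI[of "-1" 0])
  ultimately show ?thesis
    by (simp add: filterlim_at_split)
qed

text \<open>
  The only critical point is \<open>0\<close>, where the difference quotient is again a member of the family
  and so tends to \<open>0\<close>.
\<close>

lemma flat_exp_has_derivative:
  "(flat_exp P has_real_derivative flat_exp (monom 1 2 * (P - pderiv P)) x) (at x)"
proof -
  consider "x > 0" | "x < 0" | "x = 0" by linarith
  then show ?thesis
  proof cases
    case 1
    have "((\<lambda>x. poly P (1 / x) * exp (- (1 / x))) has_real_derivative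
        flat_exp (monom 1 2 * (P - pderiv P)) x) (at x)"
      using 1 by (auto intro!: derivative_eq_intros poly_DERIV[THEN DERIV_chain2]
          simp: flat_exp_def poly_monom field_simps power2_eq_square)
    then show ?thesis
      by (rule DERIV_cong_ev[THEN iffD1, rotated 3])
        (use 1 in \<open>auto simp: flat_exp_def intro!: eventually_mono[OF order_tendstoD(1)[OF tendsto_ident_at]]
          eventually_nhds_in_open[of "{0<..}", THEN eventually_mono]\<close>)
  next
    case 2
    have "((\<lambda>x. 0) has_real_derivative 0) (at x)" by simp
    then have "(flat_exp P has_real_derivative 0) (at x)"
      by (rule DERIV_cong_ev[THEN iffD1, rotated 3])
        (use 2 in \<open>auto simp: flat_exp_def intro!: eventually_nhds_in_open[of "{..<0}", THEN eventually_mono]\<close>)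
    then show ?thesis using 2 by (simp add: flat_exp_def)
  next
    case 3
    have "flat_exp P h / h = flat_exp ([:0, 1:] * P) h" for h
      by (simp add: flat_exp_def)
    moreover have "flat_exp P 0 = 0" for P by (simp add: flat_exp_def)
    ultimately show ?thesis
      using flat_exp_tendsto_0[of "[:0,1:] * P"] 3
      by (simp add: DERIV_def del: mult_pCons_left)
  qed
qed

text \<open>
  The induction on the order \<open>k\<close> has to run over all polynomials at once, since a derivative
  changes the polynomial.
\<close>

lemma C_k_flat_exp_compose:
  assumes "\<And>k. C_k k g"
  shows "C_k k (\<lambda>z. flat_exp P (g z))"
proof (induction k arbitrary: P)
  case 0
  have "continuous_on UNIV (flat_exp P)"
    using flat_exp_has_derivative by (meson DERIV_isCont continuous_at_imp_continuous_on)
  then show ?case using assms[of 0]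
    by (auto intro: continuous_on_compose2[where t=UNIV])
next
  case (Suc k)
  have "((\<lambda>z. flat_exp P (g z)) has_derivative
     (\<lambda>v. flat_exp (monom 1 2 * (P - pderiv P)) (g z) * frechet_derivative g (at z) v)) (at z)" for z
    using diff_chain_at[OF C_k_Suc_has_derivative[OF assms[of "Suc 0"]]
        flat_exp_has_derivative[of P "g z", THEN has_field_derivative_imp_has_derivative]]
    by (simp add: o_def)
  then show ?case
  proof (rule C_k_SucI)
    fix v
    have "C_k k (\<lambda>z. frechet_derivative g (at z) v)"
      using assms[of "Suc k"] by simp
    then show "C_k k (\<lambda>z. flat_exp (monom 1 2 * (P - pderiv P)) (g z) * frechet_derivative g (at z) v)"
      by (rule C_k_mult[OF Suc])
  qed
qed

lemma C_k_norm_square: "C_k k (\<lambda>z::'a::euclidean_space. z \<bullet> z)"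
proof -
  have "C_k k (\<lambda>z::'a. \<Sum>b\<in>Basis. (z \<bullet> b) * (z \<bullet> b))"
    by (rule C_k_sum, rule C_k_mult; rule C_k_bounded_linear, rule bounded_linear_inner_left)
  moreover have "(\<lambda>z::'a. z \<bullet> z) = (\<lambda>z. \<Sum>b\<in>Basis. (z \<bullet> b) * (z \<bullet> b))"
    by (rule ext, rule euclidean_inner)
  ultimately show ?thesis by (simp only:)
qed

text \<open>
  The function \<open>exp (-1 / (1/4 - |z|\<^sup>2))\<close>, continued by zero and normalised.
\<close>

lemma ex_smooth_bump:
  obtains \<phi> :: "'a::euclidean_space \<Rightarrow> real"
  where "\<And>k. C_k k \<phi>" "\<And>z. 0 \<le> \<phi> z" "\<And>z. 1/2 \<le> norm z \<Longrightarrow> \<phi> z = 0"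
    "integrable lborel \<phi>" "integral\<^sup>L lborel \<phi> = 1"
proof -
  define \<psi> :: "'a \<Rightarrow> real" where "\<psi> z = flat_exp 1 (1/4 - z \<bullet> z)" for z
  have smooth: "C_k k \<psi>" for k
    unfolding \<psi>_def
    by (rule C_k_flat_exp_compose, rule C_k_diff, rule C_k_const, rule C_k_norm_square)
  have nonneg: "0 \<le> \<psi> z" for z by (simp add: \<psi>_def flat_exp_def)
  have out: "\<psi> z = 0" if "1/2 \<le> norm z" for z
  proof -
    have "(1/2)\<^sup>2 \<le> (norm z)\<^sup>2" using that by (intro power_mono) auto
    then show ?thesis by (simp add: \<psi>_def flat_exp_def power2_norm_eq_inner power2_eq_square[of "1/2"])
  qed
  have pos: "0 < \<psi> z" if "norm z < 1/2" for z
  proof -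
    have "(norm z)\<^sup>2 < (1/2)\<^sup>2" using that by (intro power_strict_mono) auto
    then show ?thesis by (simp add: \<psi>_def flat_exp_def power2_norm_eq_inner power2_eq_square[of "1/2"])
  qed
  have cont: "continuous_on UNIV \<psi>" using smooth[of 0] by simp
  have eq: "\<psi> = (\<lambda>z. indicator (cball 0 (1/2)) z *\<^sub>R \<psi> z)"
    using out by (auto simp: fun_eq_iff indicator_def)
  have int: "integrable lborel \<psi>"
    by (subst eq, rule borel_integrable_compact) (auto intro: continuous_on_subset[OF cont])
  have "integral\<^sup>L lborel \<psi> \<noteq> 0"
  proof
    assume "integral\<^sup>L lborel \<psi> = 0"
    then have "AE z in lborel. \<psi> z = 0"
      using integral_nonneg_eq_0_iff_AE[OF int] nonneg by auto
    then have "AE z::'a in lborel. z \<notin> ball 0 (1/2)"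
      by eventually_elim (use pos in force)
    then have "ball (0::'a) (1/2) \<in> null_sets lborel"
      using AE_iff_null_sets[of "ball (0::'a) (1/2)" lborel] by simp
    then have "measure lborel (ball (0::'a) (1/2)) = 0" by (simp add: measure_def null_setsD1)
    then show False by simp
  qed
  moreover have "0 \<le> integral\<^sup>L lborel \<psi>" using nonneg by (simp add: integral_nonneg_AE)
  ultimately have I: "0 < integral\<^sup>L lborel \<psi>" by simp
  show ?thesis
  proof
    show "C_k k (\<lambda>z. inverse (integral\<^sup>L lborel \<psi>) * \<psi> z)" for k
      by (rule C_k_mult, rule C_k_const, rule smooth)
  qed (use I nonneg out int in auto)
qed

section \<open>Young's inequality for kernels and exponential moments\<close>

text \<open>
  The tangent of the convex function \<open>exp\<close> at the logarithm of the geometric mean \<open>m\<close> gives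
  \<open>m + m (ln v - ln m) \<le> v\<close>; the weighted sum of these inequalities is the claim.
\<close>

lemma weighted_arith_geo_mean3:
  fixes x y w :: real
  assumes pos: "0 < x" "0 < y" "0 < w" and wt: "0 \<le> a" "0 \<le> b" "0 \<le> c" "a + b + c = 1"
  shows "x powr a * y powr b * w powr c \<le> a * x + b * y + c * w"
proof -
  define m where "m = x powr a * y powr b * w powr c"
  have m: "m > 0" using pos by (simp add: m_def)
  have lnm: "ln m = a * ln x + b * ln y + c * ln w"
    using pos by (simp add: m_def ln_mult ln_powr)
  have tangent: "m + m * (ln v - ln m) \<le> v" if "0 < v" for v
  proof -
    have "ln (v / m) \<le> v / m - 1" using that m by (intro ln_le_minus_one) auto
    then have "m * (ln v - ln m) \<le> m * (v / m - 1)"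
      using that m by (intro mult_left_mono) (auto simp: ln_div)
    then show ?thesis using m by (simp add: algebra_simps)
  qed
  have "a * (m + m * (ln x - ln m)) + b * (m + m * (ln y - ln m)) + c * (m + m * (ln w - ln m))
      \<le> a * x + b * y + c * w"
    using pos wt by (intro add_mono mult_left_mono tangent) auto
  also have "a * (m + m * (ln x - ln m)) + b * (m + m * (ln y - ln m)) + c * (m + m * (ln w - ln m))
     = (a + b + c) * (m - m * ln m) + m * (a * ln x + b * ln y + c * ln w)"
    by (simp add: algebra_simps)
  also have "\<dots> = m" using wt lnm by (simp add: algebra_simps)
  finally show ?thesis by (simp add: m_def)
qed

text \<open>
  The proof factors \<open>k h\<close> as \<open>(k\<^sup>r h\<^sup>q)\<^sup>a (k\<^sup>r)\<^sup>b (h\<^sup>q)\<^sup>c\<close> with \<open>b = 1 - 1/q\<close> and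
  \<open>c = 1/q - a\<close>; the exponents sum to 1, so that Hoelder's inequality for three functions
  applies, here in the form of the weighted inequality of arithmetic and geometric means for the normalised factors.
  Multiplying the first hypothesis on integrals by \<open>a\<close> makes it empty for \<open>a = 0\<close>, the case
  of a bounded potential; the case \<open>a = 1/p\<close> leads to the moment of order \<open>p\<close>.
\<close>

lemma Young_kernel_pointwise:
  fixes k h :: "'a \<Rightarrow> real"
  assumes meas [measurable]: "k \<in> borel_measurable M" "h \<in> borel_measurable M"
    and nonneg: "\<And>y. 0 \<le> k y" "\<And>y. 0 \<le> h y"
    and pos: "0 < A" "0 < B" "0 < H"
    and exps: "1 \<le> q" "0 \<le> a" "a \<le> 1 / q" "r * (1 + a - 1 / q) = 1"
    and mixed: "ennreal a * (\<integral>\<^sup>+y. ennreal (k y powr r * h y powr q) \<partial>M) \<le> ennreal (a * A)"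
    and kernel: "(\<integral>\<^sup>+y. ennreal (k y powr r) \<partial>M) \<le> ennreal B"
    and data: "(\<integral>\<^sup>+y. ennreal (h y powr q) \<partial>M) \<le> ennreal (H powr q)"
  shows "(\<integral>\<^sup>+y. ennreal (k y * h y) \<partial>M) \<le> ennreal (A powr a * B powr (1 - 1 / q) * H powr (1 - a * q))"
proof -
  define b c where "b = 1 - 1 / q" and "c = 1 / q - a"
  have wt: "0 \<le> b" "0 \<le> c" "a + b + c = 1" using exps by (auto simp: b_def c_def field_simps)
  define S where "S = A powr a * B powr b * H powr (1 - a * q)"
  have S: "0 < S" using pos by (simp add: S_def)
  have e1: "r * a + r * b = 1" using exps(4) by (simp add: b_def algebra_simps)
  have e2: "q * a + q * c = 1" using exps(1) by (simp add: c_def field_simps)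
  have e3: "1 - a * q = q * c" using e2 by (simp add: algebra_simps)
  \<comment> \<open>Integrating this inequality gives \<open>S (a + b + c) = S\<close>.\<close>
  have pw: "k y * h y \<le> S * (a / A * (k y powr r * h y powr q) + b / B * k y powr r + c / H powr q * h y powr q)" for y
  proof (cases "k y = 0 \<or> h y = 0")
    case True
    have "0 \<le> S * (a / A * (k y powr r * h y powr q) + b / B * k y powr r + c / H powr q * h y powr q)"
      using S wt exps pos by (intro mult_nonneg_nonneg add_nonneg_nonneg divide_nonneg_nonneg) auto
    then show ?thesis using True by auto
  next
    case False
    then have kh: "0 < k y" "0 < h y" using nonneg[of y] by (auto simp: less_le)
    have "(k y powr r * h y powr q / A) powr a * (k y powr r / B) powr b * (h y powr q / H powr q) powr c
      \<le> a * (k y powr r * h y powr q / A) + b * (k y powr r / B) + c * (h y powr q / H powr q)"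
      using kh pos wt exps by (intro weighted_arith_geo_mean3) auto
    also have "(k y powr r * h y powr q / A) powr a * (k y powr r / B) powr b * (h y powr q / H powr q) powr c
      = (k y powr (r * a + r * b) * h y powr (q * a + q * c)) / S"
      using kh pos by (simp add: powr_divide powr_mult powr_powr powr_add S_def e3)
    also have "\<dots> = k y * h y / S" using kh by (simp add: e1 e2)
    finally show ?thesis using S by (simp add: field_simps)
  qed
  have "(\<integral>\<^sup>+y. ennreal (k y * h y) \<partial>M)
     \<le> (\<integral>\<^sup>+y. ennreal S * (ennreal (1 / A) * (ennreal a * ennreal (k y powr r * h y powr q)) + ennreal (b / B) * ennreal (k y powr r)
          + ennreal (c / H powr q) * ennreal (h y powr q)) \<partial>M)"
    using pw S pos wt exps
    by (intro nn_integral_mono)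
      (auto simp flip: ennreal_mult ennreal_plus simp: intro!: ennreal_leI)
  also have "\<dots> = ennreal S * (ennreal (1 / A) * (ennreal a * (\<integral>\<^sup>+y. ennreal (k y powr r * h y powr q) \<partial>M))
     + ennreal (b / B) * (\<integral>\<^sup>+y. ennreal (k y powr r) \<partial>M) + ennreal (c / H powr q) * (\<integral>\<^sup>+y. ennreal (h y powr q) \<partial>M))"
    by (simp add: nn_integral_cmult nn_integral_add)
  also have "\<dots> \<le> ennreal S * (ennreal (1 / A) * ennreal (a * A) + ennreal (b / B) * ennreal B + ennreal (c / H powr q) * ennreal (H powr q))"
    by (intro mult_left_mono add_mono mixed kernel data) auto
  also have "\<dots> = ennreal (S * (1 / A * (a * A) + b / B * B + c / H powr q * H powr q))"
    using S wt exps pos by (simp flip: ennreal_mult ennreal_plus)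
  also have "\<dots> = ennreal S"
    using pos wt by simp
  finally show ?thesis by (simp add: S_def b_def)
qed

text \<open>
  The pointwise bound for \<open>a = 1/p\<close> has the mixed integral \<open>A(z) = \<integral> K(z,y)\<^sup>r h(y)\<^sup>q dy\<close> to the first power
  after raising to the power \<open>p\<close>, and Tonelli's theorem bounds the integral of \<open>A\<close> by
  \<open>B H\<^sup>q\<close>.
\<close>

lemma Young_kernel_inequality:
  fixes K :: "'a \<Rightarrow> 'a \<Rightarrow> real" and h :: "'a \<Rightarrow> real"
  assumes "sigma_finite_measure M"
    and meas [measurable]: "(\<lambda>(z, y). K z y) \<in> borel_measurable (M \<Otimes>\<^sub>M M)" "h \<in> borel_measurable M"
    and nonneg: "\<And>z y. 0 \<le> K z y" "\<And>y. 0 \<le> h y"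
    and pos: "0 < B" "0 < H"
    and exps: "1 \<le> q" "q \<le> p" "r * (1 + 1 / p - 1 / q) = 1"
    and kernel: "\<And>z. z \<in> space M \<Longrightarrow> (\<integral>\<^sup>+y. ennreal (K z y powr r) \<partial>M) \<le> ennreal B"
      "\<And>y. y \<in> space M \<Longrightarrow> (\<integral>\<^sup>+z. ennreal (K z y powr r) \<partial>M) \<le> ennreal B"
    and data: "(\<integral>\<^sup>+y. ennreal (h y powr q) \<partial>M) \<le> ennreal (H powr q)"
  shows "AE z in M. (\<integral>\<^sup>+y. ennreal (K z y * h y) \<partial>M) < \<infinity>"
    and "(\<integral>\<^sup>+z. ennreal (enn2real (\<integral>\<^sup>+y. ennreal (K z y * h y) \<partial>M) powr p) \<partial>M)
       \<le> ennreal (B powr (p / r) * H powr p)"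
proof -
  interpret M: sigma_finite_measure M by fact
  interpret MM: pair_sigma_finite M M by standard
  define A where "A z = (\<integral>\<^sup>+y. ennreal (K z y powr r * h y powr q) \<partial>M)" for z
  define V where "V z = (\<integral>\<^sup>+y. ennreal (K z y * h y) \<partial>M)" for z
  define S where "S = B powr (p - p / q) * H powr (p - q)"
  have p: "0 < p" "1 \<le> p" using exps by auto
  have S: "0 < S" using pos by (simp add: S_def)
  have [measurable]: "A \<in> borel_measurable M" "V \<in> borel_measurable M"
    unfolding A_def V_def by measurable
  have "(\<integral>\<^sup>+z. A z \<partial>M) = (\<integral>\<^sup>+y. (\<integral>\<^sup>+z. ennreal (K z y powr r * h y powr q) \<partial>M) \<partial>M)"
    unfolding A_def by (subst MM.Fubini') auto
  also have "\<dots> = (\<integral>\<^sup>+y. ennreal (h y powr q) * (\<integral>\<^sup>+z. ennreal (K z y powr r) \<partial>M) \<partial>M)"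
    by (intro nn_integral_cong, subst nn_integral_cmult[symmetric])
      (auto simp: ennreal_mult' mult.commute)
  also have "\<dots> \<le> (\<integral>\<^sup>+y. ennreal (h y powr q) * ennreal B \<partial>M)"
    by (intro nn_integral_mono mult_left_mono kernel) auto
  also have "\<dots> = (\<integral>\<^sup>+y. ennreal (h y powr q) \<partial>M) * ennreal B"
    by (simp add: nn_integral_multc)
  also have "\<dots> \<le> ennreal (H powr q) * ennreal B"
    by (intro mult_right_mono data) auto
  finally have intA: "(\<integral>\<^sup>+z. A z \<partial>M) \<le> ennreal (H powr q * B)"
    using pos by (simp add: ennreal_mult)
  then have "(\<integral>\<^sup>+z. A z \<partial>M) \<noteq> \<infinity>"
    by (auto simp: top_unique)
  then have finA: "AE z in M. A z \<noteq> \<infinity>"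
    by (intro nn_integral_PInf_AE) auto
  have pt: "V z < \<infinity> \<and> ennreal (enn2real (V z) powr p) \<le> ennreal S * A z" if z: "z \<in> space M" and fin: "A z \<noteq> \<infinity>" for z
  proof -
    have mz [measurable]: "(\<lambda>y. K z y) \<in> borel_measurable M"
      using measurable_compose[OF measurable_Pair1'[OF z] meas(1)] by simp
    show ?thesis
    proof (cases "A z = 0")
      case True
      then have "AE y in M. ennreal (K z y powr r * h y powr q) = 0"
        unfolding A_def by (subst (asm) nn_integral_0_iff_AE) auto
      then have "AE y in M. ennreal (K z y * h y) = 0"
        by eventually_elim (auto simp: ennreal_eq_0_iff mult_le_0_iff order_antisym_conv nonneg)
      then have "V z = 0" unfolding V_def
        by (subst nn_integral_0_iff_AE) auto
      then show ?thesis by simp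
    next
      case False
      then obtain A' where A': "A z = ennreal A'" "0 < A'"
        using fin by (cases "A z") (auto simp: less_le)
      have "V z \<le> ennreal (A' powr (1 / p) * B powr (1 - 1 / q) * H powr (1 - 1 / p * q))"
        unfolding V_def
      proof (rule Young_kernel_pointwise[where r=r])
        show "ennreal (1 / p) * (\<integral>\<^sup>+y. ennreal (K z y powr r * h y powr q) \<partial>M) \<le> ennreal (1 / p * A')"
          using A' p unfolding A_def by (simp flip: ennreal_mult)
      qed (use nonneg pos A' exps p kernel(1)[OF z] data in \<open>auto simp: field_simps\<close>)
      then obtain v where v: "V z = ennreal v" "0 \<le> v" 
        and le: "v \<le> A' powr (1 / p) * B powr (1 - 1 / q) * H powr (1 - 1 / p * q)"
        by (cases "V z") (auto simp: top_unique)
      have "v powr p \<le> (A' powr (1 / p) * B powr (1 - 1 / q) * H powr (1 - 1 / p * q)) powr p"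
        using le v p by (intro powr_mono2) auto
      also have "\<dots> = A' powr (1 / p * p) * B powr ((1 - 1 / q) * p) * H powr ((1 - 1 / p * q) * p)"
        using A' pos by (simp add: powr_mult powr_powr)
      also have "\<dots> = S * A'"
        using A' p by (simp add: S_def algebra_simps)
      finally show ?thesis using v A' S by (simp flip: ennreal_mult)
    qed
  qed
  show "AE z in M. V z < \<infinity>"
    using finA AE_space by eventually_elim (use pt in auto)
  have "(\<integral>\<^sup>+z. ennreal (enn2real (V z) powr p) \<partial>M) \<le> (\<integral>\<^sup>+z. ennreal S * A z \<partial>M)"
    by (intro nn_integral_mono_AE) (use finA AE_space in eventually_elim, use pt in auto)
  also have "\<dots> = ennreal S * (\<integral>\<^sup>+z. A z \<partial>M)" by (simp add: nn_integral_cmult)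
  also have "\<dots> \<le> ennreal S * ennreal (H powr q * B)" by (intro mult_left_mono intA) auto
  also have "\<dots> = ennreal (S * (H powr q * B))" using S pos by (simp add: ennreal_mult)
  also have "S * (H powr q * B) = B powr (p - p / q + 1) * H powr p"
    using pos by (simp add: S_def powr_add powr_diff)
  also have "p - p / q + 1 = p / r"
  proof -
    have "r \<noteq> 0" using exps(3) by auto
    then have "1 / r = 1 + 1 / p - 1 / q" using exps(3) by (simp add: field_simps)
    then have "p * (1 / r) = p * (1 + 1 / p - 1 / q)" by simp
    then show ?thesis using p by (simp add: algebra_simps)
  qed
  finally show "(\<integral>\<^sup>+z. ennreal (enn2real (V z) powr p) \<partial>M) \<le> ennreal (B powr (p / r) * H powr p)" .
qed

lemma power_le_exp_mult_fact: "real k ^ k \<le> exp (real k) * fact k"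
proof -
  have "real k ^ k / fact k \<le> exp (real k)"
    using sum_le_suminf[OF summable_exp_generic, of "{k}" "real k"]
    by (simp add: exp_def scaleR_conv_of_real divide_inverse mult.commute)
  then show ?thesis by (simp add: field_simps)
qed

text \<open>
  Expanding the exponential reduces the claim to the moments of order \<open>k D/(D-1)\<close>.  For these the exponent
  in the hypothesis is exactly \<open>k + 1\<close>, and \<open>k\<^sup>k \<le> e\<^sup>k k!\<close> makes the terms geometric
  for the chosen \<open>\<eta>\<close>.  The finitely many orders below \<open>D\<close> are controlled by the moment of order \<open>D\<close>.
\<close>

lemma exponential_moment:
  fixes X :: "'a \<Rightarrow> real" and D C :: real
  assumes "prob_space M" and [measurable]: "X \<in> borel_measurable M"
    and nonneg: "\<And>z. 0 \<le> X z" and D: "2 \<le> D" and C: "1 \<le> C"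
    and moments: "\<And>p. D \<le> p \<Longrightarrow> (\<integral>\<^sup>+z. ennreal (X z powr p) \<partial>M) \<le> ennreal ((C * p) powr (p * (D - 1) / D + 1))"
    and \<eta>: "\<eta> = 1 / (8 * exp 1 * C)"
  shows "(\<integral>\<^sup>+z. ennreal (exp (\<eta> * X z powr (D / (D - 1)))) \<partial>M) \<le> ennreal (exp 1 * (1 + (C * D) powr D) + 4 * C)"
proof -
  interpret prob_space M by fact
  define g where "g = D / (D - 1)"
  have g: "0 < g" "g \<le> 2" using D by (auto simp: g_def field_simps)
  have "1 * 1 \<le> (8 * exp 1) * C"
    using C exp_ge_add_one_self[of 1] by (intro mult_mono) auto
  then have \<eta>01: "0 < \<eta>" "\<eta> \<le> 1"
    using C by (auto simp: \<eta>)
  define E where "E = 1 + (C * D) powr D"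
  have E: "0 \<le> E" by (simp add: E_def)
  have "D \<noteq> 0" using D by auto
  have XD: "(\<integral>\<^sup>+z. ennreal (X z powr D) \<partial>M) \<le> ennreal ((C * D) powr D)"
    using moments[of D] \<open>D \<noteq> 0\<close> by simp
  have summand: "(\<integral>\<^sup>+z. ennreal ((\<eta> * X z powr g) ^ k / fact k) \<partial>M) \<le> ennreal (\<eta> ^ k / fact k * E + 2 * C * (1/2) ^ k)" for k
  proof -
    have "(\<integral>\<^sup>+z. ennreal ((\<eta> * X z powr g) ^ k / fact k) \<partial>M) = (\<integral>\<^sup>+z. ennreal (\<eta> ^ k / fact k) * ennreal ((X z powr g) ^ k) \<partial>M)"
      using \<eta>01 by (simp flip: ennreal_mult add: power_mult_distrib)
    also have "\<dots> = ennreal (\<eta> ^ k / fact k) * (\<integral>\<^sup>+z. ennreal ((X z powr g) ^ k) \<partial>M)"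
      by (simp add: nn_integral_cmult)
    also have "\<dots> \<le> ennreal (\<eta> ^ k / fact k * E + 2 * C * (1/2) ^ k)"
    proof (cases "D \<le> k * g")
      case True
      then have k: "k \<noteq> 0" using D by (intro notI) simp
      have pk: "(X z powr g) ^ k = X z powr (k * g)" for z
        using k nonneg[of z]
        by (cases "X z = 0") (auto simp: powr_powr mult.commute simp flip: powr_realpow)
      have kg: "k * g * (D - 1) / D + 1 = real (k + 1)"
        using D by (simp add: g_def)
      have "(\<integral>\<^sup>+z. ennreal ((X z powr g) ^ k) \<partial>M) \<le> ennreal ((C * (k * g)) powr real (k + 1))"
        unfolding pk using moments[OF True] unfolding kg .
      also have "(C * (k * g)) powr real (k + 1) = (C * (k * g)) ^ (k + 1)"
        using C g k by (intro powr_realpow) auto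
      also have "\<dots> \<le> (2 * C * k) ^ (k + 1)"
        using C g mult_left_mono[of g 2 "real k"]
          by (intro power_mono) (auto simp: mult.assoc mult.commute intro!: mult_left_mono)
      finally have 1: "(\<integral>\<^sup>+z. ennreal ((X z powr g) ^ k) \<partial>M) \<le> ennreal ((2 * C * k) ^ (k + 1))"
        by (simp add: ennreal_leI)
      have "(2 * C * k) ^ (k + 1) = (2 * C) ^ (k + 1) * (k * real k ^ k)"
        by (simp add: power_mult_distrib)
      also have "\<dots> \<le> (2 * C) ^ (k + 1) * (2 ^ k * (exp (real k) * fact k))"
        using C by (intro mult_left_mono mult_mono power_le_exp_mult_fact) (auto intro: less_imp_le)
      finally have "\<eta> ^ k / fact k * (2 * C * k) ^ (k + 1) \<le> \<eta> ^ k / fact k * ((2 * C) ^ (k + 1) * (2 ^ k * (exp (real k) * fact k)))"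
        using \<eta>01 by (intro mult_left_mono) auto
      also have "\<dots> = 2 * C * (\<eta> * (2 * C) * 2 * exp 1) ^ k"
        by (simp add: power_mult_distrib exp_of_nat_mult[symmetric] field_simps)
            (simp flip: power_mult_distrib)
      also have "\<eta> * (2 * C) * 2 * exp 1 = 1/2" using C by (simp add: \<eta> field_simps)
      finally have 2: "\<eta> ^ k / fact k * (2 * C * k) ^ (k + 1) \<le> 2 * C * (1/2) ^ k" .
      have "ennreal (\<eta> ^ k / fact k) * (\<integral>\<^sup>+z. ennreal ((X z powr g) ^ k) \<partial>M) \<le> ennreal (\<eta> ^ k / fact k) * ennreal ((2 * C * k) ^ (k + 1))"
        by (intro mult_left_mono 1) auto
      also have "\<dots> = ennreal (\<eta> ^ k / fact k * (2 * C * k) ^ (k + 1))"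
        using \<eta>01 C by (subst ennreal_mult) auto
      also have "\<dots> \<le> ennreal (\<eta> ^ k / fact k * E + 2 * C * (1/2) ^ k)"
        using 2 E \<eta>01 by (intro ennreal_leI) (auto intro: add_increasing)
      finally show ?thesis .
    next
      case False
      have "(X z powr g) ^ k \<le> 1 + X z powr D" for z
      proof (cases "X z \<le> 1")
        case True
        then have "(X z powr g) ^ k \<le> 1" using nonneg[of z] g
          by (intro power_le_one powr_le1) auto
        then show ?thesis by (smt (verit) powr_ge_zero)
      next
        case False
        then have "(X z powr g) ^ k = X z powr (k * g)"
          by (subst powr_realpow[symmetric]) (auto simp: powr_powr mult.commute)
        also have "\<dots> \<le> X z powr D" using False \<open>\<not> D \<le> k * g\<close> by (intro powr_mono) auto
        finally show ?thesis by simp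
      qed
      then have "(\<integral>\<^sup>+z. ennreal ((X z powr g) ^ k) \<partial>M) \<le> (\<integral>\<^sup>+z. 1 + ennreal (X z powr D) \<partial>M)"
        by (intro nn_integral_mono) (simp flip: ennreal_1 ennreal_plus add: ennreal_leI)
      also have "\<dots> = 1 + (\<integral>\<^sup>+z. ennreal (X z powr D) \<partial>M)"
        by (subst nn_integral_add) (auto simp: emeasure_space_1)
      also have "\<dots> \<le> 1 + ennreal ((C * D) powr D)" by (intro add_left_mono XD)
      also have "\<dots> = ennreal E" by (simp add: E_def flip: ennreal_1 ennreal_plus)
      finally have "ennreal (\<eta> ^ k / fact k) * (\<integral>\<^sup>+z. ennreal ((X z powr g) ^ k) \<partial>M) \<le> ennreal (\<eta> ^ k / fact k) * ennreal E"
        by (intro mult_left_mono) auto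
      also have "\<dots> = ennreal (\<eta> ^ k / fact k * E)" using \<eta>01 E by (subst ennreal_mult) auto
      also have "\<dots> \<le> ennreal (\<eta> ^ k / fact k * E + 2 * C * (1/2) ^ k)"
        using C by (intro ennreal_leI) auto
      finally show ?thesis .
    qed
    finally show ?thesis .
  qed
  have sums: "(\<lambda>k. \<eta> ^ k / fact k * E + 2 * C * (1/2) ^ k) sums (exp \<eta> * E + 2 * C * 2)"
  proof (intro sums_add sums_mult sums_mult2)
    show "(\<lambda>k. \<eta> ^ k / fact k) sums exp \<eta>"
      using exp_converges[of \<eta>] by (simp add: scaleR_conv_of_real divide_inverse mult.commute)
    show "(\<lambda>k. (1/2::real) ^ k) sums 2"
      using geometric_sums[of "1/2::real"] by simp
  qed
  have "(\<integral>\<^sup>+z. ennreal (exp (\<eta> * X z powr g)) \<partial>M) = (\<integral>\<^sup>+z. (\<Sum>k. ennreal ((\<eta> * X z powr g) ^ k / fact k)) \<partial>M)"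
  proof (intro nn_integral_cong)
    fix z
    have "(\<lambda>k. (\<eta> * X z powr g) ^ k / fact k) sums exp (\<eta> * X z powr g)"
      using exp_converges[of "\<eta> * X z powr g"] by (simp add: scaleR_conv_of_real divide_inverse mult.commute)
    then show "ennreal (exp (\<eta> * X z powr g)) = (\<Sum>k. ennreal ((\<eta> * X z powr g) ^ k / fact k))"
      using \<eta>01 by (subst suminf_ennreal_eq) auto
  qed
  also have "\<dots> = (\<Sum>k. \<integral>\<^sup>+z. ennreal ((\<eta> * X z powr g) ^ k / fact k) \<partial>M)"
    by (intro nn_integral_suminf) auto
  also have "\<dots> \<le> (\<Sum>k. ennreal (\<eta> ^ k / fact k * E + 2 * C * (1/2) ^ k))"
    by (intro suminf_le summand) auto
  also have "\<dots> = ennreal (exp \<eta> * E + 2 * C * 2)"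
    using \<eta>01 E C by (intro suminf_ennreal_eq sums) auto
  also have "\<dots> \<le> ennreal (exp 1 * E + 4 * C)"
    using E \<eta>01 by (intro ennreal_leI add_mono mult_right_mono) auto
  finally show ?thesis by (simp add: g_def E_def)
qed

section \<open>Parabolic distance and parabolic dilations\<close>

lemma nn_integral_powr_decreasing:
  fixes d a :: real
  assumes "0 < d" "d \<le> 1" "0 < a"
  shows "(\<integral>\<^sup>+s. ennreal (a * s powr (- a - 1)) * indicator {d..1} s \<partial>lborel) = ennreal (d powr (- a) - 1)"
proof -
  have "(\<integral>\<^sup>+s. ennreal (a * s powr (- a - 1)) * indicator {d..1} s \<partial>lborel) = ennreal (- (1 powr (- a)) - (- (d powr (- a))))"
  proof (rule nn_integral_FTC_Icc)
    fix s assume s: "s \<in> {d..1}"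
    have "((\<lambda>s. - (s powr (- a))) has_real_derivative - (- a * s powr (- a - 1))) (at s)"
      using assms s by (intro DERIV_minus has_real_derivative_powr) auto
    then show "((\<lambda>s. - (s powr (- a))) has_real_derivative a * s powr (- a - 1)) (at s)"
      by simp
  qed (use assms in auto)
  then show ?thesis by simp
qed

lemma nn_integral_powr_unit_interval:
  fixes b :: real
  assumes "-1 < b"
  shows "(\<integral>\<^sup>+s. ennreal (s powr b) * indicator {0<..1} s \<partial>lborel) = ennreal (1 / (b + 1))"
proof -
  have "(\<integral>\<^sup>+s. ennreal (s powr b) * indicator {0..1} s \<partial>lborel) = ennreal (1 powr (b + 1) / (b + 1))"
    by (rule nn_integral_has_integral_lebesgue') (use assms has_integral_powr_from_0[of b 1] in auto)
  moreover have "(\<integral>\<^sup>+s. ennreal (s powr b) * indicator {0<..1} s \<partial>lborel) = (\<integral>\<^sup>+s. ennreal (s powr b) * indicator {0..1} s \<partial>lborel)"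
    by (intro nn_integral_cong) (auto simp: indicator_def)
  ultimately show ?thesis by simp
qed

lemma measurable_fst_borel [measurable]: "(fst :: 'a::euclidean_space \<times> 'b::euclidean_space \<Rightarrow> 'a) \<in> borel_measurable borel"
  and measurable_snd_borel [measurable]: "(snd :: 'a::euclidean_space \<times> 'b::euclidean_space \<Rightarrow> 'b) \<in> borel_measurable borel"
  by (intro borel_measurable_continuous_onI continuous_intros)+

abbreviation Q\<^sub>1 :: "((real ^ 'n::finite) \<times> real) set" where
  "Q\<^sub>1 \<equiv> parabolic_cylinder 0 0 1"

lemma Q1_eq: "Q\<^sub>1 = ball 0 1 \<times> {-1<..<1}"
  by (simp add: parabolic_cylinder_def)

lemma Q1_measurable [measurable]: "Q\<^sub>1 \<in> sets borel"
  unfolding Q1_eq by (intro borel_open open_Times) auto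

lemma emeasure_Q1: "emeasure lborel (Q\<^sub>1 :: ((real ^ 'n::finite) \<times> real) set) = ennreal (2 * unit_ball_vol CARD('n))"
  unfolding Q1_eq lborel_prod[symmetric]
  by (subst lborel.emeasure_pair_measure_Times) (auto simp: emeasure_ball ennreal_mult mult.commute)

text \<open>
  The factors 2 make the parabolic ball of radius \<open>s\<close> contain the image of the unit cylinder under the
  dilation with factor \<open>s\<close> about any of its points.
\<close>

definition pdist :: "((real ^ 'n::finite) \<times> real) \<Rightarrow> ((real ^ 'n) \<times> real) \<Rightarrow> real" where
  "pdist z y = max (norm (fst y - fst z) / 2) (sqrt (\<bar>snd y - snd z\<bar> / 2))"

lemma pdist_commute: "pdist z y = pdist y z"
  by (simp add: pdist_def norm_minus_commute abs_minus_commute)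

lemma pdist_pos: "z \<noteq> y \<Longrightarrow> 0 < pdist z y"
  by (auto simp: pdist_def less_max_iff_disj prod_eq_iff)

lemma pdist_measurable [measurable]:
  "(\<lambda>(z, y). pdist z y) \<in> borel_measurable (borel \<Otimes>\<^sub>M borel)"
  "(\<lambda>y. pdist z y) \<in> borel_measurable borel" 
  "(\<lambda>z. pdist z y) \<in> borel_measurable borel" 
  unfolding pdist_def by measurable

lemma pdist_le_iff: "0 \<le> s \<Longrightarrow> pdist z y \<le> s \<longleftrightarrow> norm (fst y - fst z) \<le> 2 * s \<and> \<bar>snd y - snd z\<bar> \<le> 2 * s\<^sup>2"
  by (auto simp: pdist_def real_sqrt_le_iff' sqrt_le_D real_le_lsqrt)

lemma pdist_less_1: "z \<in> Q\<^sub>1 \<Longrightarrow> y \<in> Q\<^sub>1 \<Longrightarrow> pdist z y < 1"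
  using norm_triangle_ineq4[of "fst y" "fst z"]
  by (auto simp: pdist_def Q1_eq mem_Times_iff dist_norm)

lemma emeasure_pdist_ball:
  fixes z :: "(real ^ 'n::finite) \<times> real"
  assumes "0 \<le> s"
  shows "emeasure lborel {y. pdist z y \<le> s} = ennreal (2 ^ (CARD('n) + 2) * unit_ball_vol CARD('n) * s ^ (CARD('n) + 2))"
proof -
  have "{y. pdist z y \<le> s} = cball (fst z) (2 * s) \<times> cball (snd z) (2 * s\<^sup>2)"
    using assms by (auto simp: pdist_le_iff dist_norm norm_minus_commute abs_minus_commute)
  then have "emeasure lborel {y. pdist z y \<le> s} = emeasure lborel (cball (fst z) (2 * s)) * emeasure lborel (cball (snd z) (2 * s\<^sup>2))"
    by (simp add: lborel_prod[symmetric] lborel.emeasure_pair_measure_Times)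
  also have "\<dots> = ennreal (unit_ball_vol CARD('n) * (2 * s) ^ CARD('n)) * ennreal (unit_ball_vol 1 * (2 * s\<^sup>2))"
    using assms emeasure_cball[of "2 * s\<^sup>2" "snd z"] by (simp add: emeasure_cball)
  also have "\<dots> = ennreal (2 ^ (CARD('n) + 2) * unit_ball_vol CARD('n) * s ^ (CARD('n) + 2))"
    using assms by (subst ennreal_mult[symmetric])
      (auto simp: power_mult_distrib power_add mult_ac power2_eq_square)
  finally show ?thesis .
qed

text \<open>
  The layer cake formula in the form \<open>d\<^sup>-\<^sup>a = 1 + \<integral> a s\<^sup>-\<^sup>a\<^sup>-\<^sup>1 ds\<close> over \<open>d \<le> s \<le> 1\<close>: after an exchange of
  the integrals only the volumes of parabolic balls remain.
\<close>

lemma nn_integral_pdist_powr: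
  fixes z :: "(real ^ 'n::finite) \<times> real"
  assumes z: "z \<in> Q\<^sub>1" and a: "0 < a" "a < real CARD('n) + 2"
  shows "(\<integral>\<^sup>+y. ennreal (pdist z y powr (- a)) * indicator Q\<^sub>1 y \<partial>lborel)
     \<le> ennreal (unit_ball_vol CARD('n) * (2 + a * 2 ^ (CARD('n) + 2) / (real CARD('n) + 2 - a)))"
proof -
  define D where "D = real CARD('n) + 2"
  define \<omega> where "\<omega> = unit_ball_vol CARD('n)"
  have \<omega>: "0 \<le> \<omega>" by (simp add: \<omega>_def)
  define k where "k s = ennreal (a * s powr (- a - 1)) * indicator {0<..1} s" for s :: real
  have [measurable]: "k \<in> borel_measurable borel" unfolding k_def by measurable
  \<comment> \<open>At \<open>y = z\<close> the power on the left is \<open>0 powr (- a) = 0\<close>.\<close>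
  have split: "ennreal (pdist z y powr (- a)) * indicator Q\<^sub>1 y
     \<le> indicator Q\<^sub>1 y + (\<integral>\<^sup>+s. k s * indicator {s. pdist z y \<le> s} s \<partial>lborel)" for y
  proof (cases "y \<in> Q\<^sub>1 \<and> y \<noteq> z")
    case True
    then have d: "0 < pdist z y" "pdist z y \<le> 1" using pdist_pos[of z y] pdist_less_1[OF z, of y] by (auto intro: less_imp_le)
    have "ennreal (pdist z y powr (- a)) = ennreal (1 + (pdist z y powr (- a) - 1))" by simp
    also have "\<dots> = 1 + ennreal (pdist z y powr (- a) - 1)"
      using d a powr_mono2'[of "-a" "pdist z y" 1] by (subst ennreal_plus) auto
    also have "\<dots> = 1 + (\<integral>\<^sup>+s. ennreal (a * s powr (- a - 1)) * indicator {pdist z y..1} s \<partial>lborel)"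
      using nn_integral_powr_decreasing[OF d a(1)] by simp
    also have "(\<integral>\<^sup>+s. ennreal (a * s powr (- a - 1)) * indicator {pdist z y..1} s \<partial>lborel) = (\<integral>\<^sup>+s. k s * indicator {s. pdist z y \<le> s} s \<partial>lborel)"
      using d by (intro nn_integral_cong) (auto simp: k_def indicator_def)
    finally show ?thesis using True by simp
  next
    case False
    moreover have "pdist z z = 0" by (simp add: pdist_def)
    ultimately show ?thesis by (auto simp: indicator_def)
  qed
  have "(\<integral>\<^sup>+y. ennreal (pdist z y powr (- a)) * indicator Q\<^sub>1 y \<partial>lborel)
    \<le> (\<integral>\<^sup>+y. indicator Q\<^sub>1 y + (\<integral>\<^sup>+s. k s * indicator {s. pdist z y \<le> s} s \<partial>lborel) \<partial>lborel)"
    by (intro nn_integral_mono split)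
  also have "\<dots> = emeasure lborel (Q\<^sub>1 :: ((real ^ 'n) \<times> real) set) + (\<integral>\<^sup>+y. (\<integral>\<^sup>+s. k s * indicator {s. pdist z y \<le> s} s \<partial>lborel) \<partial>lborel)"
    by (subst nn_integral_add) auto
  also have "(\<integral>\<^sup>+y. (\<integral>\<^sup>+s. k s * indicator {s. pdist z y \<le> s} s \<partial>lborel) \<partial>lborel)
     = (\<integral>\<^sup>+s. (\<integral>\<^sup>+y. k s * indicator {s. pdist z y \<le> s} s \<partial>lborel) \<partial>lborel)"
    by (rule lborel_pair.Fubini') measurable
  also have "\<dots> = (\<integral>\<^sup>+s. k s * emeasure lborel {y. pdist z y \<le> s} \<partial>lborel)"
  proof (intro nn_integral_cong)
    fix s
    have "(\<integral>\<^sup>+y. k s * indicator {s. pdist z y \<le> s} s \<partial>lborel) = (\<integral>\<^sup>+y. k s * indicator {y. pdist z y \<le> s} y \<partial>lborel)"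
      by (intro nn_integral_cong) (simp add: indicator_def)
    also have "\<dots> = k s * emeasure lborel {y. pdist z y \<le> s}"
      by (subst nn_integral_cmult_indicator) auto
    finally show "(\<integral>\<^sup>+y. k s * indicator {s. pdist z y \<le> s} s \<partial>lborel) = k s * emeasure lborel {y. pdist z y \<le> s}" .
  qed
  also have "\<dots> = (\<integral>\<^sup>+s. ennreal (a * 2 ^ (CARD('n) + 2) * \<omega>) * (ennreal (s powr (D - a - 1)) * indicator {0<..1} s) \<partial>lborel)"
  proof (intro nn_integral_cong)
    fix s :: real
    show "k s * emeasure lborel {y. pdist z y \<le> s} = ennreal (a * 2 ^ (CARD('n) + 2) * \<omega>) * (ennreal (s powr (D - a - 1)) * indicator {0<..1} s)"
    proof (cases "s \<in> {0<..1}")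
      case True
      have "s ^ (CARD('n) + 2) = s powr D"
        using True by (subst powr_realpow[symmetric]) (auto simp: D_def add.commute)
      then have "s powr (- a - 1) * s ^ (CARD('n) + 2) = s powr (D - a - 1)"
        by (simp add: algebra_simps flip: powr_add)
      moreover have "a * s powr (- a - 1) * (2 ^ (CARD('n) + 2) * \<omega> * s ^ (CARD('n) + 2)) = a * 2 ^ (CARD('n) + 2) * \<omega> * (s powr (- a - 1) * s ^ (CARD('n) + 2))"
        by (simp only: mult_ac)
      ultimately have "a * s powr (- a - 1) * (2 ^ (CARD('n) + 2) * \<omega> * s ^ (CARD('n) + 2)) = a * 2 ^ (CARD('n) + 2) * \<omega> * s powr (D - a - 1)"
        by simp
      then show ?thesis using True a \<omega>
        by (simp add: k_def emeasure_pdist_ball \<omega>_def[symmetric] flip: ennreal_mult)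
    qed (simp add: k_def)
  qed
  also have "\<dots> = ennreal (a * 2 ^ (CARD('n) + 2) * \<omega>) * ennreal (1 / (D - a - 1 + 1))"
    using a by (subst nn_integral_cmult) (auto simp: nn_integral_powr_unit_interval D_def)
  also have "emeasure lborel (Q\<^sub>1 :: ((real ^ 'n) \<times> real) set) + \<dots> = ennreal (2 * \<omega> + a * 2 ^ (CARD('n) + 2) * \<omega> / (D - a))"
    using a \<omega> by (simp add: emeasure_Q1 \<omega>_def[symmetric] D_def flip: ennreal_mult ennreal_plus)
  also have "2 * \<omega> + a * 2 ^ (CARD('n) + 2) * \<omega> / (D - a) = \<omega> * (2 + a * 2 ^ (CARD('n) + 2) / (D - a))"
    by (simp add: algebra_simps)
  finally show ?thesis by (simp add: \<omega>_def D_def)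
qed

text \<open>
  The inverse of the parabolic dilation with centre \<open>z\<close> and factor \<open>s\<close>.
\<close>

definition zoom :: "((real ^ 'n::finite) \<times> real) \<Rightarrow> real \<Rightarrow> ((real ^ 'n) \<times> real) \<Rightarrow> ((real ^ 'n) \<times> real)" where
  "zoom z s y = (fst z + (1 / s) *\<^sub>R (fst y - fst z), snd z + (1 / s\<^sup>2) * (snd y - snd z))"

lemma zoom_1 [simp]: "zoom z 1 y = y"
  by (simp add: zoom_def)

lemma zoom_inverse: "0 < s \<Longrightarrow> zoom z (1 / s) (zoom z s y) = y"
  by (simp add: zoom_def prod_eq_iff power_divide)

lemma zoom_measurable [measurable]:
  "(\<lambda>p. zoom z (fst p) (snd p)) \<in> borel_measurable (borel \<Otimes>\<^sub>M borel)"
  "(\<lambda>p. zoom (fst p) s (snd p)) \<in> borel_measurable (borel \<Otimes>\<^sub>M borel)"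
  "zoom z s \<in> borel_measurable borel"
  unfolding zoom_def by measurable

text \<open>Here the convexity of the ball and of the interval enters.\<close>

lemma zoom_shrinks_into_Q1:
  assumes z: "z \<in> Q\<^sub>1" and w: "w \<in> Q\<^sub>1" and s: "0 < s" "s \<le> 1"
  shows "zoom z (1 / s) w \<in> Q\<^sub>1"
proof -
  have "(1 - s) *\<^sub>R fst z + s *\<^sub>R fst w \<in> ball 0 1"
    using z w s by (intro convexD) (auto simp: Q1_eq)
  moreover have "(1 - s\<^sup>2) *\<^sub>R snd z + s\<^sup>2 *\<^sub>R snd w \<in> {-1<..<1::real}"
    using z w s by (intro convexD) (auto simp: Q1_eq power_le_one)
  ultimately show ?thesis
    by (simp add: zoom_def Q1_eq power_divide algebra_simps)
qed

lemma zoom_support_bounds: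
  assumes z: "z \<in> Q\<^sub>1" and w: "zoom z s y \<in> Q\<^sub>1" and s: "0 < s"
  shows "norm (fst y - fst z) \<le> 2 * s" "\<bar>snd y - snd z\<bar> \<le> 2 * s\<^sup>2" "pdist z y \<le> s"
proof -
  have "fst y - fst z = s *\<^sub>R (fst (zoom z s y) - fst z)" using s by (simp add: zoom_def)
  moreover have "norm (fst (zoom z s y) - fst z) \<le> 2"
    using norm_triangle_ineq4[of "fst (zoom z s y)" "fst z"] z w by (auto simp: Q1_eq mem_Times_iff)
  ultimately show 1: "norm (fst y - fst z) \<le> 2 * s" using s by simp
  have "snd y - snd z = s\<^sup>2 * (snd (zoom z s y) - snd z)" using s by (simp add: zoom_def)
  moreover have "\<bar>snd (zoom z s y) - snd z\<bar> \<le> 2"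
    using z w by (auto simp: Q1_eq mem_Times_iff)
  ultimately show 2: "\<bar>snd y - snd z\<bar> \<le> 2 * s\<^sup>2" using s by (simp add: abs_mult)
  show "pdist z y \<le> s" using 1 2 s by (simp add: pdist_le_iff)
qed

lemma nn_integral_lborel_affine:
  fixes g :: "'a::euclidean_space \<Rightarrow> ennreal"
  assumes [measurable]: "g \<in> borel_measurable borel" and c: "0 < c"
  shows "(\<integral>\<^sup>+x. g (a + c *\<^sub>R x) \<partial>lborel) = ennreal ((1 / c) ^ DIM('a)) * (\<integral>\<^sup>+x. g x \<partial>lborel)"
proof -
  have "(\<integral>\<^sup>+x. g x \<partial>lborel) = ennreal (c ^ DIM('a)) * (\<integral>\<^sup>+x. g (a + c *\<^sub>R x) \<partial>lborel)"
    using c by (subst lborel_affine[of c a]) (auto simp: nn_integral_density nn_integral_distr nn_integral_cmult)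
  then have "ennreal ((1 / c) ^ DIM('a)) * (\<integral>\<^sup>+x. g x \<partial>lborel)
      = ennreal ((1 / c) ^ DIM('a) * c ^ DIM('a)) * (\<integral>\<^sup>+x. g (a + c *\<^sub>R x) \<partial>lborel)"
    using c by (simp add: ennreal_mult mult.assoc)
  also have "(1 / c) ^ DIM('a) * c ^ DIM('a) = 1"
    using c by (simp flip: power_mult_distrib)
  finally show ?thesis by simp
qed

lemma nn_integral_zoom:
  fixes f :: "(real ^ 'n::finite) \<times> real \<Rightarrow> ennreal"
  assumes [measurable]: "f \<in> borel_measurable borel" and s: "0 < s"
  shows "(\<integral>\<^sup>+y. f (zoom z s y) \<partial>lborel) = ennreal (s ^ (CARD('n) + 2)) * (\<integral>\<^sup>+y. f y \<partial>lborel)"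
proof -
  have x: "(\<integral>\<^sup>+x. g (a + (1 / s) *\<^sub>R x) \<partial>lborel) = ennreal (s ^ CARD('n)) * (\<integral>\<^sup>+x. g x \<partial>lborel)"
    if [measurable]: "g \<in> borel_measurable borel" for g :: "real ^ 'n \<Rightarrow> ennreal" and a
    using nn_integral_lborel_affine[OF that, of "1 / s" a] s by simp
  have t: "(\<integral>\<^sup>+x. g (a + (1 / s\<^sup>2) * x) \<partial>lborel) = ennreal (s\<^sup>2) * (\<integral>\<^sup>+x. g x \<partial>lborel)"
    if [measurable]: "g \<in> borel_measurable borel" for g :: "real \<Rightarrow> ennreal" and a
    using nn_integral_lborel_affine[OF that, of "1 / s\<^sup>2" a] s by simp
  have m1: "(\<lambda>y. f (zoom z s y)) \<in> borel_measurable (lborel \<Otimes>\<^sub>M lborel)"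
    and m2: "f \<in> borel_measurable (lborel \<Otimes>\<^sub>M lborel)"
    by (simp_all add: lborel_prod)
  have "(\<integral>\<^sup>+y. f (zoom z s y) \<partial>lborel) = (\<integral>\<^sup>+\<tau>. \<integral>\<^sup>+x. f (zoom z s (x, \<tau>)) \<partial>lborel \<partial>lborel)"
    using lborel_pair.nn_integral_snd[OF m1] by (simp add: lborel_prod)
  also have "\<dots> = (\<integral>\<^sup>+\<tau>. \<integral>\<^sup>+x. f ((fst z - (1 / s) *\<^sub>R fst z) + (1 / s) *\<^sub>R x, (snd z - (1 / s\<^sup>2) * snd z) + (1 / s\<^sup>2) * \<tau>) \<partial>lborel \<partial>lborel)"
    by (simp add: zoom_def algebra_simps diff_divide_distrib)
  also have "\<dots> = (\<integral>\<^sup>+\<tau>. ennreal (s ^ CARD('n)) * (\<integral>\<^sup>+x. f (x, (snd z - (1 / s\<^sup>2) * snd z) + (1 / s\<^sup>2) * \<tau>) \<partial>lborel) \<partial>lborel)"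
    by (intro nn_integral_cong x) measurable
  also have "\<dots> = ennreal (s ^ CARD('n)) * (\<integral>\<^sup>+\<tau>. (\<integral>\<^sup>+x. f (x, (snd z - (1 / s\<^sup>2) * snd z) + (1 / s\<^sup>2) * \<tau>) \<partial>lborel) \<partial>lborel)"
    by (subst nn_integral_cmult) auto
  also have "\<dots> = ennreal (s ^ CARD('n)) * (ennreal (s\<^sup>2) * (\<integral>\<^sup>+\<tau>. (\<integral>\<^sup>+x. f (x, \<tau>) \<partial>lborel) \<partial>lborel))"
    by (subst t) auto
  also have "(\<integral>\<^sup>+\<tau>. (\<integral>\<^sup>+x. f (x, \<tau>) \<partial>lborel) \<partial>lborel) = (\<integral>\<^sup>+y. f y \<partial>lborel)"
    using lborel_pair.nn_integral_snd[OF m2] by (simp add: lborel_prod)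
  moreover have "ennreal (s ^ (CARD('n) + 2)) = ennreal (s ^ CARD('n)) * ennreal (s\<^sup>2)"
    using s by (subst ennreal_mult[symmetric]) (auto simp: power_add power2_eq_square)
  ultimately show ?thesis by (simp only: mult.assoc)
qed

section \<open>Dilated bump functions\<close>

definition zoom_linear :: "real \<Rightarrow> ((real ^ 'n::finite) \<times> real) \<Rightarrow> ((real ^ 'n) \<times> real)" where
  "zoom_linear s v = ((1 / s) *\<^sub>R fst v, (1 / s\<^sup>2) * snd v)"

lemma bounded_linear_zoom_linear: "bounded_linear (zoom_linear s)"
  unfolding zoom_linear_def
  by (intro bounded_linear_Pair bounded_linear_const_mult bounded_linear_snd
      bounded_linear_scaleR_right[THEN bounded_linear_compose] bounded_linear_fst)

lemma zoom_eq_affine: "zoom z s y = (z - zoom_linear s z) + zoom_linear s y"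
  by (simp add: zoom_def zoom_linear_def prod_eq_iff algebra_simps diff_divide_distrib)

lemma zoom_has_derivative: "(zoom z s has_derivative zoom_linear s) (at y)"
proof -
  have "((\<lambda>y. (z - zoom_linear s z) + zoom_linear s y) has_derivative zoom_linear s) (at y)"
    by (auto intro!: derivative_eq_intros bounded_linear_imp_has_derivative bounded_linear_zoom_linear)
  then show ?thesis by (simp add: zoom_eq_affine[abs_def])
qed

text \<open>
  The bump function of the averages, together with a common bound \<open>M\<close> for its values and its
  derivative.  All constants of the final estimates descend from \<open>M\<close> and \<open>D\<close>.
\<close>

locale unit_bump =
  fixes \<phi> :: "(real ^ 'n::finite) \<times> real \<Rightarrow> real" and M :: real and D :: nat
  defines "D \<equiv> CARD('n) + 2"
  assumes smooth: "\<And>k. C_k k \<phi>"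
    and nonneg: "\<And>w. 0 \<le> \<phi> w"
    and support: "\<And>w. 1/2 \<le> norm w \<Longrightarrow> \<phi> w = 0"
    and integrable: "integrable lborel \<phi>"
    and integral: "integral\<^sup>L lborel \<phi> = 1"
    and bound: "\<And>w. \<phi> w \<le> M" "\<And>w v. \<bar>frechet_derivative \<phi> (at w) v\<bar> \<le> M * norm v"
begin

abbreviation d\<phi> :: "(real ^ 'n) \<times> real \<Rightarrow> (real ^ 'n) \<times> real \<Rightarrow> real" where
  "d\<phi> w \<equiv> frechet_derivative \<phi> (at w)"

lemma M_nonneg: "0 \<le> M"
  using bound(1)[of 0] nonneg[of 0] by linarith

lemma has_derivative: "(\<phi> has_derivative d\<phi> w) (at w)"
  using C_k_Suc_has_derivative[OF smooth[of "Suc 0"]] .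

lemma d\<phi>_linear: "linear (d\<phi> w)"
  using has_derivative[of w] has_derivative_linear by blast

lemma continuous: "continuous_on UNIV \<phi>"
  using smooth[of 0] by simp

lemma continuous_d\<phi>: "continuous_on UNIV (\<lambda>w. d\<phi> w v)"
  using smooth[of "Suc 0"] unfolding C_k.simps by blast

lemma measurable [measurable]: "\<phi> \<in> borel_measurable borel" "(\<lambda>w. d\<phi> w v) \<in> borel_measurable borel"
  by (intro borel_measurable_continuous_onI continuous continuous_d\<phi>)+

lemma support_Q1: "w \<notin> Q\<^sub>1 \<Longrightarrow> \<phi> w = 0"
proof (rule support)
  assume "w \<notin> Q\<^sub>1"
  then have "1 \<le> norm (fst w) \<or> 1 \<le> \<bar>snd w\<bar>" by (auto simp: Q1_eq mem_Times_iff)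
  moreover have "norm (fst w) \<le> norm w" "\<bar>snd w\<bar> \<le> norm w"
    using norm_fst_le[of "fst w" "snd w"] norm_snd_le[of "snd w" "fst w"] by auto
  ultimately show "1 / 2 \<le> norm w" by linarith
qed

lemma d\<phi>_support_Q1: "w \<notin> Q\<^sub>1 \<Longrightarrow> d\<phi> w v = 0"
proof -
  assume "w \<notin> Q\<^sub>1"
  then have "\<phi> w = 0" by (rule support_Q1)
  then have "\<And>y. \<phi> w \<le> \<phi> y" using nonneg by simp
  then have "d\<phi> w = (\<lambda>v. 0)"
    by (intro differential_zero_maxmin[of w UNIV \<phi>] has_derivative) auto
  then show ?thesis by simp
qed

lemma cball_subset_Q1: "cball 0 (1/2) \<subseteq> (Q\<^sub>1 :: ((real ^ 'n) \<times> real) set)"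
proof
  fix w :: "(real ^ 'n) \<times> real" assume "w \<in> cball 0 (1/2)"
  then have "norm w \<le> 1/2" by simp
  moreover have "norm (fst w) \<le> norm w" "\<bar>snd w\<bar> \<le> norm w"
    using norm_fst_le[of "fst w" "snd w"] norm_snd_le[of "snd w" "fst w"] by auto
  ultimately have "norm (fst w) < 1" "\<bar>snd w\<bar> < 1" by linarith+
  then show "w \<in> Q\<^sub>1" by (auto simp: Q1_eq mem_Times_iff)
qed

text \<open>
  The factor \<open>p\<close> is needed for the vector field that generates the dilations: its components are
  affine functions.
\<close>

lemma test_function_scaled:
  assumes z: "z \<in> Q\<^sub>1" and s: "0 < s" "s \<le> 1" and p: "\<And>k. C_k k p"
  shows "test_function Q\<^sub>1 (\<lambda>y. p y * \<phi> (zoom z s y))"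
  unfolding test_function_def compactly_inside_def
proof (intro conjI allI)
  show "C_k k (\<lambda>y. p y * \<phi> (zoom z s y))" for k
    unfolding zoom_eq_affine
    by (intro C_k_mult p C_k_compose_affine bounded_linear_zoom_linear smooth)
  \<comment> \<open>The support lies in the image of the support of \<open>\<phi>\<close>, a compact set inside the unit cylinder.\<close>
  define K where "K = zoom z (1 / s) ` cball 0 (1/2)"
  have "compact K"
    unfolding K_def zoom_eq_affine using bounded_linear_zoom_linear
    by (intro compact_continuous_image continuous_intros linear_continuous_on) auto
  have "{y. p y * \<phi> (zoom z s y) \<noteq> 0} \<subseteq> K"
  proof
    fix y assume "y \<in> {y. p y * \<phi> (zoom z s y) \<noteq> 0}"
    then have "zoom z s y \<in> cball 0 (1/2)" using support[of "zoom z s y"] by force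
    then have "zoom z (1 / s) (zoom z s y) \<in> K" unfolding K_def by blast
    then show "y \<in> K" using s by (simp add: zoom_inverse)
  qed
  then have sub: "closure {y. p y * \<phi> (zoom z s y) \<noteq> 0} \<subseteq> K"
    using \<open>compact K\<close> by (intro closure_minimal compact_imp_closed)
  then show "compact (closure {y. p y * \<phi> (zoom z s y) \<noteq> 0})"
    using \<open>compact K\<close> by (meson bounded_closure bounded_subset closed_closure compact_eq_bounded_closed)
  have "K \<subseteq> Q\<^sub>1"
    unfolding K_def using zoom_shrinks_into_Q1[OF z _ s] cball_subset_Q1 by blast
  then show "closure {y. p y * \<phi> (zoom z s y) \<noteq> 0} \<subseteq> Q\<^sub>1" using sub by blast
qed

lemma scaled_has_derivative:
  assumes "(p has_derivative p') (at y)"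
  shows "((\<lambda>y. p y * \<phi> (zoom z s y)) has_derivative
     (\<lambda>v. p y * d\<phi> (zoom z s y) (zoom_linear s v) + p' v * \<phi> (zoom z s y))) (at y)"
proof -
  have "((\<lambda>y. \<phi> (zoom z s y)) has_derivative (\<lambda>v. d\<phi> (zoom z s y) (zoom_linear s v))) (at y)"
    using diff_chain_at[OF zoom_has_derivative has_derivative, of z s y] by (simp add: o_def)
  from has_derivative_mult[OF assms this] show ?thesis .
qed

lemma scaled_frechet_derivative:
  assumes "(p has_derivative p') (at y)"
  shows "frechet_derivative (\<lambda>y. p y * \<phi> (zoom z s y)) (at y) v =
     p y * d\<phi> (zoom z s y) (zoom_linear s v) + p' v * \<phi> (zoom z s y)"
  using frechet_derivative_at[OF scaled_has_derivative[OF assms, of z s]] by (rule fun_cong[OF sym])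

text \<open>
  The density of the image of the measure with density \<open>\<phi>\<close> under the dilation.
\<close>

definition kernel :: "(real ^ 'n) \<times> real \<Rightarrow> real \<Rightarrow> (real ^ 'n) \<times> real \<Rightarrow> real" where
  "kernel z s y = \<phi> (zoom z s y) / s ^ D"

definition kernel_ds :: "(real ^ 'n) \<times> real \<Rightarrow> real \<Rightarrow> (real ^ 'n) \<times> real \<Rightarrow> real" where
  "kernel_ds z s y = - (D * \<phi> (zoom z s y) / s ^ (D + 1)
      + d\<phi> (zoom z s y) (fst y - fst z, 0) / s ^ (D + 2)
      + 2 * d\<phi> (zoom z s y) (0, snd y - snd z) / s ^ (D + 3))"

lemma kernel_1: "kernel z 1 = \<phi>"
  by (simp add: kernel_def fun_eq_iff)

lemma kernel_nonneg: "0 < s \<Longrightarrow> 0 \<le> kernel z s y"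
  by (simp add: kernel_def nonneg)

lemma kernel_has_derivative:
  assumes s: "0 < s"
  shows "((\<lambda>s. kernel z s y) has_real_derivative kernel_ds z s y) (at s)"
proof -
  define X where "X = fst y - fst z"
  define T where "T = snd y - snd z"
  have pair: "((\<lambda>s. zoom z s y) has_vector_derivative (- (1 / s\<^sup>2) *\<^sub>R X, - (2 / s ^ 3) * T)) (at s)"
    unfolding zoom_def X_def[symmetric] T_def[symmetric]
  proof (rule has_vector_derivative_Pair)
    have "((\<lambda>s. 1 / s) has_real_derivative - (1 / s\<^sup>2)) (at s)"
      using s by (auto intro!: derivative_eq_intros simp: power2_eq_square)
    then have "((\<lambda>s. (1 / s) *\<^sub>R X) has_vector_derivative (- (1 / s\<^sup>2)) *\<^sub>R X) (at s)"
      by (rule has_vector_derivative_scaleR[OF _ has_vector_derivative_const, simplified])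
    then show "((\<lambda>s. fst z + (1 / s) *\<^sub>R X) has_vector_derivative (- (1 / s\<^sup>2)) *\<^sub>R X) (at s)"
      using has_vector_derivative_add[OF has_vector_derivative_const[of "fst z"]] by simp
    have "((\<lambda>s. snd z + 1 / s\<^sup>2 * T) has_real_derivative - (2 / s ^ 3) * T) (at s)"
      using s by (auto intro!: derivative_eq_intros simp: power2_eq_square power3_eq_cube field_simps)
    then show "((\<lambda>s. snd z + 1 / s\<^sup>2 * T) has_vector_derivative - (2 / s ^ 3) * T) (at s)"
      by (simp add: has_real_derivative_iff_has_vector_derivative)
  qed
  have lin: "d\<phi> (zoom z s y) (- (1 / s\<^sup>2) *\<^sub>R X, - (2 / s ^ 3) * T)
     = - (1 / s\<^sup>2) * d\<phi> (zoom z s y) (X, 0) - (2 / s ^ 3) * d\<phi> (zoom z s y) (0, T)"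
  proof -
    have "(- (1 / s\<^sup>2) *\<^sub>R X, - (2 / s ^ 3) * T) = (- (1 / s\<^sup>2)) *\<^sub>R (X, 0::real) + (- (2 / s ^ 3)) *\<^sub>R (0, T)"
      by simp
    then show ?thesis
      by (simp only: linear_add[OF d\<phi>_linear] linear_scale[OF d\<phi>_linear]) simp
  qed
  have "((\<lambda>s. \<phi> (zoom z s y)) has_real_derivative
     - (1 / s\<^sup>2) * d\<phi> (zoom z s y) (X, 0) - (2 / s ^ 3) * d\<phi> (zoom z s y) (0, T)) (at s)"
    using vector_derivative_diff_chain_within[OF pair has_derivative_at_withinI[OF has_derivative]]
    unfolding lin by (simp add: o_def has_real_derivative_iff_has_vector_derivative)
  moreover have "((\<lambda>s. 1 / s ^ D) has_real_derivative - (real D / s ^ (D + 1))) (at s)"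
  proof -
    have "s * s ^ (D - Suc 0) = s ^ D" by (simp add: D_def)
    then show ?thesis
      using s by (auto intro!: derivative_eq_intros simp: field_simps power2_eq_square)
  qed
  ultimately have "((\<lambda>s. \<phi> (zoom z s y) * (1 / s ^ D)) has_real_derivative
     (- (1 / s\<^sup>2) * d\<phi> (zoom z s y) (X, 0) - (2 / s ^ 3) * d\<phi> (zoom z s y) (0, T)) * (1 / s ^ D)
       + - (real D / s ^ (D + 1)) * \<phi> (zoom z s y)) (at s)"
    by (rule DERIV_mult)
  moreover have "(- (1 / s\<^sup>2) * d\<phi> (zoom z s y) (X, 0) - (2 / s ^ 3) * d\<phi> (zoom z s y) (0, T)) * (1 / s ^ D)
       + - (real D / s ^ (D + 1)) * \<phi> (zoom z s y) = kernel_ds z s y"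
    using s by (simp add: kernel_ds_def X_def T_def power_add field_simps eval_nat_numeral)
  ultimately show ?thesis by (simp add: kernel_def)
qed

lemma kernel_bound:
  assumes z: "z \<in> Q\<^sub>1" and s: "0 < s"
  shows "kernel z s y \<le> M / s ^ D * indicator {y. pdist z y \<le> s} y"
proof (cases "zoom z s y \<in> Q\<^sub>1")
  case True
  then show ?thesis using zoom_support_bounds[OF z True s] bound(1)[of "zoom z s y"] s
    by (simp add: kernel_def divide_right_mono)
next
  case False
  then show ?thesis using s M_nonneg by (simp add: kernel_def support_Q1)
qed

lemma kernel_measurable [measurable]:
  "(\<lambda>(z, y). kernel z s y) \<in> borel_measurable (borel \<Otimes>\<^sub>M borel)"
  "kernel z s \<in> borel_measurable borel"
  unfolding kernel_def by measurable

lemma nn_integral_kernel: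
  assumes s: "0 < s"
  shows "(\<integral>\<^sup>+y. ennreal (kernel z s y) \<partial>lborel) = 1"
proof -
  have "(\<integral>\<^sup>+y. ennreal (kernel z s y) \<partial>lborel) = (\<integral>\<^sup>+y. ennreal (1 / s ^ D) * ennreal (\<phi> (zoom z s y)) \<partial>lborel)"
    using s nonneg by (simp add: kernel_def flip: ennreal_mult)
  also have "\<dots> = ennreal (1 / s ^ D) * (ennreal (s ^ D) * (\<integral>\<^sup>+y. ennreal (\<phi> y) \<partial>lborel))"
    by (subst nn_integral_cmult, simp, subst nn_integral_zoom[OF _ s]) (auto simp: D_def)
  also have "(\<integral>\<^sup>+y. ennreal (\<phi> y) \<partial>lborel) = 1"
    using nn_integral_eq_integral[OF integrable] nonneg integral by simp
  also have "ennreal (1 / s ^ D) * (ennreal (s ^ D) * 1) = 1"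
    using s by (simp flip: ennreal_mult)
  finally show ?thesis .
qed

lemma kernel_support: "z \<in> Q\<^sub>1 \<Longrightarrow> 0 < s \<Longrightarrow> s \<le> 1 \<Longrightarrow> y \<notin> Q\<^sub>1 \<Longrightarrow> kernel z s y = 0"
proof -
  assume *: "z \<in> Q\<^sub>1" "0 < s" "s \<le> 1" "y \<notin> Q\<^sub>1"
  have "zoom z s y \<notin> Q\<^sub>1"
    using zoom_shrinks_into_Q1[OF *(1) _ *(2,3), of "zoom z s y"] * by (auto simp: zoom_inverse)
  then show ?thesis by (simp add: kernel_def support_Q1)
qed

end

lemma ex_unit_bump: "\<exists>(\<phi> :: (real ^ 'n::finite) \<times> real \<Rightarrow> real) M. unit_bump \<phi> M"
proof -
  obtain \<phi> :: "(real ^ 'n) \<times> real \<Rightarrow> real" where \<phi>: "\<And>k. C_k k \<phi>" "\<And>z. 0 \<le> \<phi> z" "\<And>z. 1/2 \<le> norm z \<Longrightarrow> \<phi> z = 0"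
    "integrable lborel \<phi>" "integral\<^sup>L lborel \<phi> = 1"
    using ex_smooth_bump by blast
  have bounded_cont: "\<exists>C\<ge>0. \<forall>w. \<bar>f w\<bar> \<le> C"
    if "continuous_on UNIV f" and out: "\<And>w. 1/2 \<le> norm w \<Longrightarrow> f w = 0" for f :: "(real ^ 'n) \<times> real \<Rightarrow> real"
  proof -
    have "compact (f ` cball 0 (1/2))"
      by (intro compact_continuous_image continuous_on_subset[OF that(1)]) auto
    then have "bounded (f ` cball 0 (1/2))" by (rule compact_imp_bounded)
    then obtain C where "\<forall>r \<in> f ` cball 0 (1/2). norm r \<le> C"
      unfolding bounded_iff by blast
    then have C: "\<bar>f w\<bar> \<le> C" if "w \<in> cball 0 (1/2)" for w
      using that by auto
    have "0 \<le> C" using C[of 0] by auto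
    have "\<bar>f w\<bar> \<le> C" for w
      using C[of w] out[of w] \<open>0 \<le> C\<close> by (cases "1/2 \<le> norm w") auto
    then show ?thesis using \<open>0 \<le> C\<close> by blast
  qed
  have der: "(\<phi> has_derivative frechet_derivative \<phi> (at w)) (at w)" for w
    using C_k_Suc_has_derivative[OF \<phi>(1)[of "Suc 0"]] .
  have "frechet_derivative \<phi> (at w) v = 0" if "1/2 \<le> norm w" for w v
  proof -
    have "\<phi> w = 0" using \<phi>(3) that .
    then have "\<And>y. \<phi> w \<le> \<phi> y" using \<phi>(2) by simp
    then have "frechet_derivative \<phi> (at w) = (\<lambda>v. 0)"
      by (intro differential_zero_maxmin[of w UNIV \<phi>] der) auto
    then show ?thesis by simp
  qed
  moreover have "continuous_on UNIV (\<lambda>w. frechet_derivative \<phi> (at w) b)" for b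
    using \<phi>(1)[of "Suc 0"] unfolding C_k.simps by blast
  ultimately have "\<exists>C\<ge>0. \<forall>w. \<bar>frechet_derivative \<phi> (at w) b\<bar> \<le> C" for b
    by (intro bounded_cont) auto
  then obtain C where C: "\<And>b. 0 \<le> C b" "\<And>b w. \<bar>frechet_derivative \<phi> (at w) b\<bar> \<le> C b" by metis
  obtain C0 where C0: "0 \<le> C0" "\<And>w. \<bar>\<phi> w\<bar> \<le> C0"
    using bounded_cont[of \<phi>] \<phi>(1)[of 0] \<phi>(3) by auto
  define M where "M = C0 + sum C Basis"
  have "\<bar>frechet_derivative \<phi> (at w) v\<bar> \<le> M * norm v" for w v
  proof -
    have lin: "linear (frechet_derivative \<phi> (at w))" using der has_derivative_linear by blast
    have "frechet_derivative \<phi> (at w) v = frechet_derivative \<phi> (at w) (\<Sum>b\<in>Basis. (v \<bullet> b) *\<^sub>R b)"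
      by (simp only: euclidean_representation)
    also have "\<dots> = (\<Sum>b\<in>Basis. (v \<bullet> b) * frechet_derivative \<phi> (at w) b)"
      by (simp only: linear_sum[OF lin] linear_scale[OF lin] real_scaleR_def)
    finally have "\<bar>frechet_derivative \<phi> (at w) v\<bar> \<le> (\<Sum>b\<in>Basis. \<bar>(v \<bullet> b) * frechet_derivative \<phi> (at w) b\<bar>)"
      by (simp only: sum_abs)
    also have "\<dots> \<le> (\<Sum>b\<in>Basis. norm v * C b)"
      unfolding abs_mult by (intro sum_mono mult_mono Basis_le_norm C) auto
    also have "\<dots> = norm v * sum C Basis" by (simp add: sum_distrib_left)
    also have "\<dots> \<le> M * norm v" using C0 by (simp add: M_def algebra_simps)
    finally show ?thesis .
  qed
  moreover have "\<phi> w \<le> M" for w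
    using C0(2)[of w] sum_nonneg[of Basis C] C(1) by (auto simp: M_def)
  ultimately have "unit_bump \<phi> M" using \<phi> by unfold_locales auto
  then show ?thesis by blast
qed

section \<open>Averages of weak solutions\<close>

lemma test_function_has_derivative:
  "test_function S \<psi> \<Longrightarrow> (\<psi> has_derivative frechet_derivative \<psi> (at z)) (at z)"
  using C_k_Suc_has_derivative[of 0 \<psi>] unfolding test_function_def by blast

lemma test_function_continuous:
  assumes "test_function S \<psi>"
  shows "continuous_on UNIV \<psi>" "continuous_on UNIV (\<lambda>z. frechet_derivative \<psi> (at z) v)"
proof -
  have "C_k 0 \<psi>" "C_k (Suc 0) \<psi>" using assms unfolding test_function_def by blast+
  then show "continuous_on UNIV \<psi>" "continuous_on UNIV (\<lambda>z. frechet_derivative \<psi> (at z) v)"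
    unfolding C_k.simps by blast+
qed

lemma test_function_support:
  assumes "test_function S \<psi>" and z: "z \<notin> S"
  shows "\<psi> z = 0" "frechet_derivative \<psi> (at z) v = 0"
proof -
  define K where "K = closure {z. \<psi> z \<noteq> 0}"
  have K: "K \<subseteq> S" using assms(1) by (simp add: test_function_def compactly_inside_def K_def)
  then have "z \<notin> K" using z by blast
  then show "\<psi> z = 0" using closure_subset[of "{z. \<psi> z \<noteq> 0}"] by (auto simp: K_def)
  have "(\<psi> has_derivative (\<lambda>v. 0)) (at z)"
    by (rule has_derivative_transform_within_open[where f="\<lambda>z. 0" and s="- K"])
      (use \<open>z \<notin> K\<close> closure_subset[of "{z. \<psi> z \<noteq> 0}"] in \<open>auto simp: K_def\<close>)
  then have "(\<lambda>v. 0) = frechet_derivative \<psi> (at z)" by (rule frechet_derivative_at)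
  then show "frechet_derivative \<psi> (at z) v = 0" by (metis)
qed

lemma continuous_compact_support_bounded:
  fixes f :: "'a::topological_space \<Rightarrow> real"
  assumes "continuous_on UNIV f" "compact K" "\<And>z. z \<notin> K \<Longrightarrow> f z = 0"
  shows "\<exists>C\<ge>0. \<forall>z. \<bar>f z\<bar> \<le> C"
proof -
  have "compact (f ` K)"
    by (intro compact_continuous_image continuous_on_subset[OF assms(1)] assms) auto
  then have "bounded (f ` K)" by (rule compact_imp_bounded)
  then obtain C where "\<forall>r \<in> f ` K. norm r \<le> C" unfolding bounded_iff by blast
  then have "\<bar>f z\<bar> \<le> max C 0" for z using assms(3)[of z] by (cases "z \<in> K") (auto simp: le_max_iff_disj)
  then show ?thesis by (intro exI[of _ "max C 0"]) auto
qed

lemma test_function_bounded: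
  assumes "test_function S \<psi>"
  shows "\<exists>C\<ge>0. \<forall>z. \<bar>\<psi> z\<bar> \<le> C" "\<exists>C\<ge>0. \<forall>z. \<bar>frechet_derivative \<psi> (at z) v\<bar> \<le> C"
proof -
  define K where "K = closure {z. \<psi> z \<noteq> 0}"
  have K: "compact K" using assms(1) by (simp add: test_function_def compactly_inside_def K_def)
  have "test_function K \<psi>" using assms by (simp add: test_function_def compactly_inside_def K_def)
  note * = test_function_support[OF this]
  show "\<exists>C\<ge>0. \<forall>z. \<bar>\<psi> z\<bar> \<le> C"
    by (rule continuous_compact_support_bounded[OF test_function_continuous(1)[OF assms] K *(1)])
  show "\<exists>C\<ge>0. \<forall>z. \<bar>frechet_derivative \<psi> (at z) v\<bar> \<le> C"
    by (rule continuous_compact_support_bounded[OF test_function_continuous(2)[OF assms] K *(2)])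
qed

lemma ennreal_abs_integral_le: "ennreal \<bar>LINT x|M. f x\<bar> \<le> (\<integral>\<^sup>+x. ennreal \<bar>f x :: real\<bar> \<partial>M)"
  using integral_norm_bound_ennreal[of M f] not_integrable_integral_eq[of M f]
  by (cases "integrable M f") auto

lemma integrable_mult_bounded:
  fixes f u :: "'a \<Rightarrow> real"
  assumes "integrable M u" "f \<in> borel_measurable M" "\<And>y. \<bar>f y\<bar> \<le> C"
  shows "integrable M (\<lambda>y. u y * f y)"
proof (rule Bochner_Integration.integrable_bound)
  show "integrable M (\<lambda>y. C * u y)" using assms(1) by simp
  have "\<bar>u y\<bar> * \<bar>f y\<bar> \<le> C * \<bar>u y\<bar>" for y
    using assms(3)[of y] by (subst mult.commute, intro mult_right_mono) auto
  moreover have "0 \<le> C" using assms(3)[of undefined] by simp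
  ultimately show "AE y in M. norm (u y * f y) \<le> norm (C * u y)" by (auto simp: abs_mult)
qed (use assms in auto)

lemma integrable_mult_test_function:
  assumes "test_function S \<psi>" "integrable lborel u"
  shows "integrable lborel (\<lambda>y. u y * \<psi> y)" "integrable lborel (\<lambda>y. u y * frechet_derivative \<psi> (at y) v)"
proof -
  obtain C C' where C: "\<And>z. \<bar>\<psi> z\<bar> \<le> C" "\<And>z. \<bar>frechet_derivative \<psi> (at z) v\<bar> \<le> C'"
    using test_function_bounded[OF assms(1)] by metis
  show "integrable lborel (\<lambda>y. u y * \<psi> y)" "integrable lborel (\<lambda>y. u y * frechet_derivative \<psi> (at y) v)"
    using test_function_continuous[OF assms(1)] 
    by (auto intro!: integrable_mult_bounded assms C borel_measurable_continuous_onI simp: measurable_lborel1)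
qed

text \<open>
  The weak form of \<open>\<nabla>u = g\<close> and \<open>u\<^sub>t = div G\<close> for one component.  The integrals run over the
  whole space, and all functions are Borel measurable, so that Tonelli's theorem and changes of variables apply
  directly.
\<close>

definition weak_flux :: "((real ^ 'n::finite) \<times> real) set \<Rightarrow> ((real ^ 'n) \<times> real \<Rightarrow> real)
    \<Rightarrow> ((real ^ 'n) \<times> real \<Rightarrow> real ^ 'n) \<Rightarrow> ((real ^ 'n) \<times> real \<Rightarrow> real ^ 'n) \<Rightarrow> bool" where
  "weak_flux Q u g G \<longleftrightarrow> integrable lborel u \<and> integrable lborel g \<and> integrable lborel G \<and>
    (\<forall>\<psi>. test_function Q \<psi> \<longrightarrow>
       (\<forall>j. (LINT y|lborel. u y * grad_x \<psi> y $ j) = - (LINT y|lborel. g y $ j * \<psi> y)) \<and>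
       (LINT y|lborel. u y * deriv_t \<psi> y) = (LINT y|lborel. G y \<bullet> grad_x \<psi> y))"

lemma integrable_vec_nth: "integrable M f \<Longrightarrow> integrable M (\<lambda>x. f x $ j)"
  by (rule integrable_bounded_linear[OF bounded_linear_vec_nth])

context unit_bump
begin

definition \<phi>_grad :: "(real ^ 'n) \<times> real \<Rightarrow> real ^ 'n" where
  "\<phi>_grad w = (\<chi> j. d\<phi> w (axis j 1, 0))"

lemma d\<phi>_space: "d\<phi> w (x, 0) = x \<bullet> \<phi>_grad w"
proof -
  have "(x, 0::real) = (\<Sum>j\<in>UNIV. (x $ j) *\<^sub>R (axis j 1, 0))"
    using basis_expansion[of x]
    by (simp add: prod_eq_iff fst_sum snd_sum vector_scalar_mult_def axis_def)
      (simp add: vec_eq_iff)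
  then have "d\<phi> w (x, 0) = (\<Sum>j\<in>UNIV. (x $ j) * d\<phi> w (axis j 1, 0))"
    by (simp only: linear_sum[OF d\<phi>_linear] linear_scale[OF d\<phi>_linear] real_scaleR_def)
  then show ?thesis by (simp add: inner_vec_def \<phi>_grad_def)
qed

lemma d\<phi>_time: "d\<phi> w (0, \<tau>) = \<tau> * d\<phi> w (0, 1)"
  using linear_scale[OF d\<phi>_linear, of w \<tau> "(0, 1)"] by simp

lemma norm_\<phi>_grad: "norm (\<phi>_grad w) \<le> M"
proof -
  have "(norm (\<phi>_grad w))\<^sup>2 = d\<phi> w (\<phi>_grad w, 0)" by (simp add: d\<phi>_space power2_norm_eq_inner)
  also have "\<dots> \<le> M * norm (\<phi>_grad w)" using bound(2)[of w "(\<phi>_grad w, 0)"] by (simp add: norm_Pair)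
  finally show ?thesis
    using M_nonneg by (cases "\<phi>_grad w = 0") (auto simp: power2_eq_square)
qed

lemma \<phi>_grad_measurable [measurable]: "\<phi>_grad \<in> borel_measurable borel"
  unfolding \<phi>_grad_def
  by (intro borel_measurable_continuous_onI continuous_on_vec_lambda continuous_d\<phi>)

lemma \<phi>_grad_support: "w \<notin> Q\<^sub>1 \<Longrightarrow> \<phi>_grad w = 0"
  by (simp add: \<phi>_grad_def d\<phi>_support_Q1 vec_eq_iff)

lemma kernel_ds_eq: "kernel_ds z s y = - (D * \<phi> (zoom z s y) / s ^ (D + 1)
      + (fst y - fst z) \<bullet> \<phi>_grad (zoom z s y) / s ^ (D + 2)
      + 2 * (snd y - snd z) * d\<phi> (zoom z s y) (0, 1) / s ^ (D + 3))"
  by (subst kernel_ds_def, subst d\<phi>_space, subst d\<phi>_time) simp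

lemma kernel_ds_measurable [measurable]:
  "(\<lambda>(s, y). kernel_ds z s y) \<in> borel_measurable (borel \<Otimes>\<^sub>M borel)"
  "kernel_ds z s \<in> borel_measurable borel"
  unfolding kernel_ds_eq by measurable

lemma kernel_ds_bound:
  assumes z: "z \<in> Q\<^sub>1" and s: "0 < s"
  shows "\<bar>kernel_ds z s y\<bar> \<le> (D + 6) * M / s ^ (D + 1)"
proof (cases "zoom z s y \<in> Q\<^sub>1")
  case True
  note b = zoom_support_bounds[OF z True s]
  have 1: "\<bar>d\<phi> (zoom z s y) (fst y - fst z, 0)\<bar> \<le> 2 * M * s"
    using bound(2)[of "zoom z s y" "(fst y - fst z, 0)"] mult_left_mono[OF b(1) M_nonneg] by (simp add: norm_Pair mult_ac)
  have 2: "\<bar>d\<phi> (zoom z s y) (0, snd y - snd z)\<bar> \<le> 2 * M * s\<^sup>2"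
    using bound(2)[of "zoom z s y" "(0, snd y - snd z)"] mult_left_mono[OF b(2) M_nonneg] by (simp add: norm_Pair mult_ac)
  have "\<bar>kernel_ds z s y\<bar> \<le> D * M / s ^ (D + 1) + (2 * M * s) / s ^ (D + 2) + 2 * (2 * M * s\<^sup>2) / s ^ (D + 3)"
  proof -
    have "\<bar>D * \<phi> (zoom z s y) / s ^ (D + 1)\<bar> \<le> D * M / s ^ (D + 1)"
      using bound(1)[of "zoom z s y"] nonneg[of "zoom z s y"] s
      by (simp add: abs_mult divide_right_mono mult_left_mono)
    moreover have "\<bar>d\<phi> (zoom z s y) (fst y - fst z, 0) / s ^ (D + 2)\<bar> \<le> (2 * M * s) / s ^ (D + 2)"
      unfolding abs_divide using s 1 by (simp only: abs_of_pos zero_less_power divide_right_mono less_imp_le)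
    moreover have "\<bar>2 * d\<phi> (zoom z s y) (0, snd y - snd z) / s ^ (D + 3)\<bar> \<le> 2 * (2 * M * s\<^sup>2) / s ^ (D + 3)"
      unfolding abs_divide abs_mult using s mult_left_mono[OF 2, of 2]
      by (simp only: abs_of_pos zero_less_power divide_right_mono less_imp_le abs_numeral)
    ultimately show ?thesis unfolding kernel_ds_def abs_minus_cancel by linarith
  qed
  also have "\<dots> = (D + 6) * M / s ^ (D + 1)"
    using s by (simp add: power_add field_simps eval_nat_numeral)
  finally show ?thesis .
next
  case False
  then show ?thesis using s M_nonneg by (simp add: kernel_ds_def support_Q1 d\<phi>_support_Q1)
qed

lemma \<phi>_abs_le: "\<bar>\<phi> w\<bar> \<le> M"
  using nonneg[of w] bound(1)[of w] by simp

lemma kernel_abs_le: "0 < s \<Longrightarrow> \<bar>kernel z s y\<bar> \<le> M / s ^ D"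
  using \<phi>_abs_le[of "zoom z s y"] by (simp add: kernel_def abs_divide divide_right_mono)

lemma C_k_affine: "bounded_linear l \<Longrightarrow> C_k k (\<lambda>y. l y + c)"
  by (intro C_k_add C_k_bounded_linear C_k_const)

text \<open>
  The heart of the matter.  The kernel is transported along the dilations, hence its derivative in \<open>s\<close> is minus
  the divergence of kernel times velocity, where the velocity at \<open>y\<close> is \<open>((y - z)\<^sub>x / s, 2 (y - z)\<^sub>t / s)\<close>.
  The spatial part of this divergence consists of the derivatives of the test functions \<open>\<psi> j\<close>, the time part is
  the time derivative of the test function \<open>\<theta>\<close>.
\<close>

lemma integral_kernel_ds:
  assumes wf: "weak_flux Q\<^sub>1 u g G" and z: "z \<in> Q\<^sub>1" and s: "0 < s" "s \<le> 1"
  shows "(LINT y|lborel. u y * kernel_ds z s y) =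
     (LINT y|lborel. (g y \<bullet> (fst y - fst z)) * (\<phi> (zoom z s y) / s ^ (D + 1))
        - (G y \<bullet> \<phi>_grad (zoom z s y)) * (2 * (snd y - snd z) / s ^ (D + 2)))"
proof -
  have u: "integrable lborel u" and g: "integrable lborel g" and G: "integrable lborel G"
    using wf by (auto simp: weak_flux_def)
  define p where "p j y = (fst y $ j) / s ^ (D + 1) + (- (fst z $ j) / s ^ (D + 1))" for j and y :: "(real ^ 'n) \<times> real"
  define r where "r y = snd y * (2 / s ^ (D + 1)) + (- (snd z * (2 / s ^ (D + 1))))" for y :: "(real ^ 'n) \<times> real"
  have bl_p: "bounded_linear (\<lambda>y :: (real ^ 'n) \<times> real. (fst y $ j) / s ^ (D + 1))" for j
    by (intro bounded_linear_divide[THEN bounded_linear_compose] bounded_linear_vec_nth[THEN bounded_linear_compose] bounded_linear_fst)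
  have bl_r: "bounded_linear (\<lambda>y :: (real ^ 'n) \<times> real. snd y * (2 / s ^ (D + 1)))"
    by (intro bounded_linear_mult_left[THEN bounded_linear_compose] bounded_linear_snd)
  define \<psi> where "\<psi> j y = p j y * \<phi> (zoom z s y)" for j y
  define \<theta> where "\<theta> y = r y * \<phi> (zoom z s y)" for y
  have test: "test_function Q\<^sub>1 (\<psi> j)" "test_function Q\<^sub>1 \<theta>" for j
    unfolding \<psi>_def \<theta>_def p_def r_def
    by (intro test_function_scaled z s C_k_affine bl_p bl_r)+
  have dp: "(p j has_derivative (\<lambda>v. (fst v $ j) / s ^ (D + 1))) (at y)" for j y
    unfolding p_def
    by (rule has_derivative_eq_rhs, rule has_derivative_add[OF bounded_linear_imp_has_derivative[OF bl_p] has_derivative_const]) simp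
  have dr: "(r has_derivative (\<lambda>v. snd v * (2 / s ^ (D + 1)))) (at y)" for y
    unfolding r_def
    by (rule has_derivative_eq_rhs, rule has_derivative_add[OF bounded_linear_imp_has_derivative[OF bl_r] has_derivative_const]) simp
  have grad_\<psi>: "grad_x (\<psi> j) y $ j = (fst y - fst z) $ j * (\<phi>_grad (zoom z s y) $ j) / s ^ (D + 2) + \<phi> (zoom z s y) / s ^ (D + 1)" for j y
  proof -
    have "d\<phi> (zoom z s y) (zoom_linear s (axis j 1, 0)) = \<phi>_grad (zoom z s y) $ j / s"
      using linear_scale[OF d\<phi>_linear, of "zoom z s y" "1 / s" "(axis j 1, 0)"]
      by (simp add: zoom_linear_def \<phi>_grad_def)
    then show ?thesis
      using s unfolding grad_x_def \<psi>_def
      by (simp add: scaled_frechet_derivative[OF dp] axis_def) (simp add: p_def diff_divide_distrib algebra_simps power_add)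
  qed
  have dt_\<theta>: "deriv_t \<theta> y = 2 * (snd y - snd z) * d\<phi> (zoom z s y) (0, 1) / s ^ (D + 3) + 2 * \<phi> (zoom z s y) / s ^ (D + 1)" for y
  proof -
    have "d\<phi> (zoom z s y) (zoom_linear s (0, 1)) = d\<phi> (zoom z s y) (0, 1) / s\<^sup>2"
      using d\<phi>_time[of "zoom z s y" "1 / s\<^sup>2"] by (simp add: zoom_linear_def)
    then show ?thesis
      using s unfolding deriv_t_def \<theta>_def
      by (simp add: scaled_frechet_derivative[OF dr]) (simp add: r_def field_simps power_add eval_nat_numeral)
  qed
  have grad_\<theta>: "grad_x \<theta> y = (2 * (snd y - snd z) / s ^ (D + 2)) *\<^sub>R \<phi>_grad (zoom z s y)" for y
  proof -
    have "d\<phi> (zoom z s y) (zoom_linear s (axis j 1, 0)) = \<phi>_grad (zoom z s y) $ j / s" for j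
      using linear_scale[OF d\<phi>_linear, of "zoom z s y" "1 / s" "(axis j 1, 0)"]
      by (simp add: zoom_linear_def \<phi>_grad_def)
    then show ?thesis
      using s unfolding grad_x_def \<theta>_def vec_eq_iff
      by (simp add: scaled_frechet_derivative[OF dr]) (simp add: r_def field_simps power_add eval_nat_numeral)
  qed
  \<comment> \<open>The \<open>n\<close> space directions and the factor 2 of the time direction add up to \<open>D\<close>.\<close>
  have div: "kernel_ds z s y = - ((\<Sum>j\<in>UNIV. grad_x (\<psi> j) y $ j) + deriv_t \<theta> y)" for y
  proof -
    have "(\<Sum>j\<in>UNIV. grad_x (\<psi> j) y $ j) = (fst y - fst z) \<bullet> \<phi>_grad (zoom z s y) / s ^ (D + 2) + CARD('n) * (\<phi> (zoom z s y) / s ^ (D + 1))"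
      by (simp add: grad_\<psi> sum.distrib inner_vec_def sum_divide_distrib)
    then show ?thesis
      by (simp add: kernel_ds_eq dt_\<theta> D_def add_divide_distrib algebra_simps)
  qed
  have int_u: "integrable lborel (\<lambda>y. u y * grad_x (\<psi> j) y $ j)" "integrable lborel (\<lambda>y. u y * deriv_t \<theta> y)" for j
    using integrable_mult_test_function(2)[OF test(1) u] integrable_mult_test_function(2)[OF test(2) u]
    by (simp_all add: grad_x_def deriv_t_def)
  have int_g: "integrable lborel (\<lambda>y. g y $ j * \<psi> j y)" for j
    by (rule integrable_mult_test_function(1)[OF test(1) integrable_vec_nth[OF g]])
  have int_G: "integrable lborel (\<lambda>y. G y \<bullet> grad_x \<theta> y)"
    unfolding inner_vec_def grad_x_def
    using integrable_mult_test_function(2)[OF test(2) integrable_vec_nth[OF G]] by simp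
  have "(LINT y|lborel. u y * kernel_ds z s y) = (LINT y|lborel. - ((\<Sum>j\<in>UNIV. u y * grad_x (\<psi> j) y $ j) + u y * deriv_t \<theta> y))"
    by (intro Bochner_Integration.integral_cong) (auto simp: div algebra_simps sum_distrib_left)
  also have "\<dots> = - ((\<Sum>j\<in>UNIV. LINT y|lborel. u y * grad_x (\<psi> j) y $ j) + (LINT y|lborel. u y * deriv_t \<theta> y))"
    using int_u by simp
  also have "\<dots> = - ((\<Sum>j\<in>UNIV. - (LINT y|lborel. g y $ j * \<psi> j y)) + (LINT y|lborel. G y \<bullet> grad_x \<theta> y))"
    using wf test by (simp add: weak_flux_def)
  also have "\<dots> = (LINT y|lborel. (\<Sum>j\<in>UNIV. g y $ j * \<psi> j y) - G y \<bullet> grad_x \<theta> y)"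
    using int_g int_G by (simp add: sum_negf)
  also have "\<dots> = (LINT y|lborel. (g y \<bullet> (fst y - fst z)) * (\<phi> (zoom z s y) / s ^ (D + 1))
        - (G y \<bullet> \<phi>_grad (zoom z s y)) * (2 * (snd y - snd z) / s ^ (D + 2)))"
  proof (intro Bochner_Integration.integral_cong refl)
    fix y
    have "(\<Sum>j\<in>UNIV. g y $ j * \<psi> j y) = (g y \<bullet> (fst y - fst z)) * (\<phi> (zoom z s y) / s ^ (D + 1))"
      unfolding inner_vec_def sum_distrib_right
      by (intro sum.cong) (simp_all add: \<psi>_def p_def diff_divide_distrib algebra_simps)
    then show "(\<Sum>j\<in>UNIV. g y $ j * \<psi> j y) - G y \<bullet> grad_x \<theta> y = (g y \<bullet> (fst y - fst z)) * (\<phi> (zoom z s y) / s ^ (D + 1))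
        - (G y \<bullet> \<phi>_grad (zoom z s y)) * (2 * (snd y - snd z) / s ^ (D + 2))"
      by (simp add: grad_\<theta>)
  qed
  finally show ?thesis .
qed

text \<open>
  On the support of the kernel \<open>|(y - z)\<^sub>x| \<le> 2 s\<close> and \<open>|(y - z)\<^sub>t| \<le> 2 s\<^sup>2\<close>, which pays for
  the additional negative powers of \<open>s\<close> in the derivatives.
\<close>

lemma integral_kernel_ds_bound:
  assumes wf: "weak_flux Q\<^sub>1 u g G" and z: "z \<in> Q\<^sub>1" and s: "0 < s" "s \<le> 1"
  shows "ennreal \<bar>LINT y|lborel. u y * kernel_ds z s y\<bar>
     \<le> (\<integral>\<^sup>+y. ennreal (4 * M * (norm (g y) + norm (G y))) * (ennreal (1 / s ^ D) * indicator {y. pdist z y \<le> s} y) \<partial>lborel)"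
proof -
  define f where "f y = (g y \<bullet> (fst y - fst z)) * (\<phi> (zoom z s y) / s ^ (D + 1))
        - (G y \<bullet> \<phi>_grad (zoom z s y)) * (2 * (snd y - snd z) / s ^ (D + 2))" for y
  have pw: "\<bar>f y\<bar> \<le> 4 * M * (norm (g y) + norm (G y)) * (1 / s ^ D * indicator {y. pdist z y \<le> s} y)" for y
  proof (cases "zoom z s y \<in> Q\<^sub>1")
    case True
    note b = zoom_support_bounds[OF z True s(1)]
    have "\<bar>g y \<bullet> (fst y - fst z)\<bar> \<le> norm (g y) * (2 * s)"
      using Cauchy_Schwarz_ineq2[of "g y" "fst y - fst z"] mult_left_mono[OF b(1), of "norm (g y)"] by simp
    then have "\<bar>g y \<bullet> (fst y - fst z)\<bar> * (\<phi> (zoom z s y) / s ^ (D + 1)) \<le> (norm (g y) * (2 * s)) * (M / s ^ (D + 1))"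
      using nonneg bound(1) M_nonneg s by (intro mult_mono divide_right_mono) auto
    also have "\<dots> = 2 * M * norm (g y) / s ^ D" using s by simp
    also have "\<dots> \<le> 4 * M * norm (g y) / s ^ D" using s M_nonneg by (intro divide_right_mono mult_right_mono) auto
    finally have 1: "\<bar>(g y \<bullet> (fst y - fst z)) * (\<phi> (zoom z s y) / s ^ (D + 1))\<bar> \<le> 4 * M * norm (g y) / s ^ D"
      using nonneg s by (simp add: abs_mult)
    have "\<bar>G y \<bullet> \<phi>_grad (zoom z s y)\<bar> \<le> norm (G y) * M"
      using Cauchy_Schwarz_ineq2[of "G y" "\<phi>_grad (zoom z s y)"] mult_left_mono[OF norm_\<phi>_grad[of "zoom z s y"], of "norm (G y)"] by simp
    then have "\<bar>G y \<bullet> \<phi>_grad (zoom z s y)\<bar> * (2 * \<bar>snd y - snd z\<bar> / s ^ (D + 2)) \<le> (norm (G y) * M) * (2 * (2 * s\<^sup>2) / s ^ (D + 2))"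
      using b(2) M_nonneg s by (intro mult_mono divide_right_mono) auto
    also have "\<dots> = 4 * M * norm (G y) / s ^ D" using s by (simp add: power_add field_simps power2_eq_square)
    finally have 2: "\<bar>(G y \<bullet> \<phi>_grad (zoom z s y)) * (2 * (snd y - snd z) / s ^ (D + 2))\<bar> \<le> 4 * M * norm (G y) / s ^ D"
      using s by (simp only: abs_mult abs_divide abs_of_pos zero_less_power abs_numeral)
    have "\<bar>f y\<bar> \<le> 4 * M * norm (g y) / s ^ D + 4 * M * norm (G y) / s ^ D"
      unfolding f_def using 1 2 by (intro order_trans[OF abs_triangle_ineq4] add_mono)
    then show ?thesis using b(3) by (simp add: add_divide_distrib algebra_simps)
  next
    case False
    then show ?thesis using M_nonneg s by (simp add: f_def support_Q1 \<phi>_grad_support)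
  qed
  have "ennreal \<bar>LINT y|lborel. f y\<bar> \<le> (\<integral>\<^sup>+y. ennreal \<bar>f y\<bar> \<partial>lborel)"
    by (rule ennreal_abs_integral_le)
  also have "\<dots> \<le> (\<integral>\<^sup>+y. ennreal (4 * M * (norm (g y) + norm (G y))) * (ennreal (1 / s ^ D) * indicator {y. pdist z y \<le> s} y) \<partial>lborel)"
    using pw s M_nonneg by (intro nn_integral_mono)
      (auto simp: ennreal_indicator[symmetric] simp flip: ennreal_mult intro!: ennreal_leI)
  finally show ?thesis
    using integral_kernel_ds[OF wf z s] by (simp add: f_def)
qed

text \<open>
  The sum over all scales of the bounds \<open>s\<^sup>-\<^sup>D\<close> produces the Riesz kernel.
\<close>

lemma nn_integral_shell:
  assumes "y \<noteq> z"
  shows "(\<integral>\<^sup>+s. indicator {\<epsilon>..1} s * (ennreal (1 / s ^ D) * indicator {s. pdist z y \<le> s} s) \<partial>lborel) \<le> ennreal (pdist z y powr (- (real D - 1)))"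
proof (cases "pdist z y \<le> 1")
  case True
  define d where "d = pdist z y"
  have d: "0 < d" "d \<le> 1" using pdist_pos[of z y] assms True by (auto simp: d_def)
  have D1: "1 \<le> real D - 1" by (simp add: D_def)
  have "indicator {\<epsilon>..1} s * (ennreal (1 / s ^ D) * indicator {s. d \<le> s} s)
     \<le> ennreal ((real D - 1) * s powr (- (real D - 1) - 1)) * indicator {d..1} s" for s
  proof (cases "s \<in> {d..1}")
    case True
    then have "s powr (- (real D - 1) - 1) = 1 / s ^ D"
      using d by (simp add: powr_minus powr_realpow divide_inverse)
    moreover have "1 / s ^ D \<le> (real D - 1) * (1 / s ^ D)"
      using D1 True d mult_right_mono[of 1 "real D - 1" "1 / s ^ D"] by simp
    ultimately show ?thesis using True
      by (auto simp: indicator_def intro!: ennreal_leI)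
  qed (auto simp: indicator_def)
  then have "(\<integral>\<^sup>+s. indicator {\<epsilon>..1} s * (ennreal (1 / s ^ D) * indicator {s. d \<le> s} s) \<partial>lborel)
     \<le> (\<integral>\<^sup>+s. ennreal ((real D - 1) * s powr (- (real D - 1) - 1)) * indicator {d..1} s \<partial>lborel)"
    by (rule nn_integral_mono)
  also have "\<dots> = ennreal (d powr (- (real D - 1)) - 1)"
    using D1 d by (intro nn_integral_powr_decreasing) auto
  also have "\<dots> \<le> ennreal (d powr (- (real D - 1)))" by (intro ennreal_leI) simp
  finally show ?thesis by (simp add: d_def)
next
  case False
  have "(\<integral>\<^sup>+s. indicator {\<epsilon>..1} s * (ennreal (1 / s ^ D) * indicator {s. pdist z y \<le> s} s) \<partial>lborel) = (\<integral>\<^sup>+(s::real). 0 \<partial>lborel)"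
    using False by (intro nn_integral_cong) (auto simp: indicator_def)
  then show ?thesis by (simp only: nn_integral_const mult_zero_left zero_le)
qed

text \<open>
  The fundamental theorem of calculus in \<open>s\<close> under the integral sign.  The bound on the derivative of the kernel is
  uniform for \<open>\<epsilon> \<le> s \<le> 1\<close>, which justifies the exchange of the integrals.
\<close>

lemma potential_estimate_smoothed:
  assumes wf: "weak_flux Q\<^sub>1 u g G" and z: "z \<in> Q\<^sub>1" and \<epsilon>: "0 < \<epsilon>" "\<epsilon> \<le> 1"
  shows "ennreal \<bar>(LINT y|lborel. u y * kernel z \<epsilon> y) - (LINT y|lborel. u y * \<phi> y)\<bar>
     \<le> ennreal (4 * M) * (\<integral>\<^sup>+y. ennreal (pdist z y powr (- (real D - 1)) * (norm (g y) + norm (G y))) \<partial>lborel)"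
proof -
  have u: "integrable lborel u" and g: "integrable lborel g" and G: "integrable lborel G"
    using wf by (auto simp: weak_flux_def)
  have [measurable]: "u \<in> borel_measurable borel" "g \<in> borel_measurable borel" "G \<in> borel_measurable borel"
    using u g G by (auto dest!: borel_measurable_integrable simp: measurable_lborel1)
  define C where "C = (D + 6) * M / \<epsilon> ^ (D + 1)"
  have C: "0 \<le> C" using \<epsilon> M_nonneg by (simp add: C_def)
  have ds_le: "\<bar>kernel_ds z s y\<bar> \<le> C" if "\<epsilon> \<le> s" for s y
  proof -
    have "\<bar>kernel_ds z s y\<bar> \<le> (D + 6) * M / s ^ (D + 1)" using kernel_ds_bound[OF z] that \<epsilon> by simp
    also have "\<dots> \<le> C" unfolding C_def using that \<epsilon> M_nonneg by (intro divide_left_mono power_mono) auto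
    finally show ?thesis .
  qed
  define f where "f s y = u y * (kernel_ds z s y * indicator {\<epsilon>..1} s)" for s y
  have f_meas [measurable]: "(\<lambda>(s, y). f s y) \<in> borel_measurable (lborel \<Otimes>\<^sub>M lborel)"
    unfolding f_def by measurable
  have int_f: "integrable (lborel \<Otimes>\<^sub>M lborel) (\<lambda>(s, y). f s y)"
  proof (rule integrableI_bounded)
    have "(\<integral>\<^sup>+p. ennreal (norm (case p of (s, y) \<Rightarrow> f s y)) \<partial>(lborel \<Otimes>\<^sub>M lborel))
       = (\<integral>\<^sup>+s. \<integral>\<^sup>+y. ennreal \<bar>f s y\<bar> \<partial>lborel \<partial>lborel)"
      using lborel.nn_integral_fst[of "\<lambda>p. ennreal (norm (case p of (s, y) \<Rightarrow> f s y))" lborel] by simp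
    also have "\<dots> \<le> (\<integral>\<^sup>+s. \<integral>\<^sup>+y. (ennreal C * indicator {\<epsilon>..1} s) * ennreal \<bar>u y\<bar> \<partial>lborel \<partial>lborel)"
    proof (intro nn_integral_mono)
      fix s y
      show "ennreal \<bar>f s y\<bar> \<le> (ennreal C * indicator {\<epsilon>..1} s) * ennreal \<bar>u y\<bar>"
      proof (cases "s \<in> {\<epsilon>..1}")
        case True
        then have "\<bar>f s y\<bar> \<le> C * \<bar>u y\<bar>"
          using mult_right_mono[OF ds_le[of s y], of "\<bar>u y\<bar>"] by (simp add: f_def abs_mult mult.commute)
        then show ?thesis using True C by (simp flip: ennreal_mult add: ennreal_leI)
      qed (simp add: f_def)
    qed
    also have "\<dots> = (\<integral>\<^sup>+s. (ennreal C * (\<integral>\<^sup>+y. ennreal \<bar>u y\<bar> \<partial>lborel)) * indicator {\<epsilon>..1} s \<partial>lborel)"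
      by (intro nn_integral_cong, subst nn_integral_cmult) (auto simp: mult_ac)
    also have "\<dots> = (ennreal C * (\<integral>\<^sup>+y. ennreal \<bar>u y\<bar> \<partial>lborel)) * ennreal (1 - \<epsilon>)"
      using \<epsilon> by (subst nn_integral_cmult_indicator) auto
    also have "\<dots> < \<infinity>"
      using u by (simp add: integrable_iff_bounded ennreal_mult_less_top)
    finally show "(\<integral>\<^sup>+p. ennreal (norm (case p of (s, y) \<Rightarrow> f s y)) \<partial>(lborel \<Otimes>\<^sub>M lborel)) < \<infinity>" .
  qed measurable
  have FTC: "(LINT s|lborel. f s y) = u y * \<phi> y - u y * kernel z \<epsilon> y" for y
  proof -
    have "(LINT s|lborel. kernel_ds z s y * indicator {\<epsilon>..1} s) = kernel z 1 y - kernel z \<epsilon> y"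
    proof (rule integral_FTC_Icc_real)
      fix s assume s: "\<epsilon> \<le> s" "s \<le> 1"
      then have "0 < s" using \<epsilon> by simp
      then show "((\<lambda>s. kernel z s y) has_real_derivative kernel_ds z s y) (at s)"
        by (rule kernel_has_derivative)
      have zoom: "isCont (\<lambda>s. zoom z s y) s"
        unfolding zoom_def using \<open>0 < s\<close> by (intro continuous_intros) auto
      have "isCont (\<lambda>s. \<phi> (zoom z s y)) s" "isCont (\<lambda>s. d\<phi> (zoom z s y) v) s" for v
        using continuous continuous_d\<phi>[of v]
        by (auto intro!: isCont_o2[OF zoom] simp: continuous_on_eq_continuous_at simp del: split_paired_All)
      then show "isCont (\<lambda>s. kernel_ds z s y) s"
        unfolding kernel_ds_def using \<open>0 < s\<close> by (intro continuous_intros) auto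
    qed (use \<epsilon> in auto)
    moreover have "(LINT s|lborel. f s y) = u y * (LINT s|lborel. kernel_ds z s y * indicator {\<epsilon>..1} s)"
      unfolding f_def by (rule Bochner_Integration.integral_mult_right_zero)
    ultimately show ?thesis by (simp only: kernel_1 right_diff_distrib)
  qed
  have int_k: "integrable lborel (\<lambda>y. u y * kernel z \<epsilon> y)"
    by (rule integrable_mult_bounded[OF u _ kernel_abs_le[OF \<epsilon>(1)]]) simp
  have int_\<phi>: "integrable lborel (\<lambda>y. u y * \<phi> y)"
    by (rule integrable_mult_bounded[OF u _ \<phi>_abs_le]) simp
  have "(LINT y|lborel. u y * \<phi> y) - (LINT y|lborel. u y * kernel z \<epsilon> y) = (LINT y|lborel. (LINT s|lborel. f s y))"
    unfolding FTC using int_k int_\<phi> by simp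
  also have "\<dots> = (LINT s|lborel. (LINT y|lborel. f s y))"
    using lborel_pair.Fubini_integral[OF int_f] by simp
  also have "\<dots> = (LINT s|lborel. indicator {\<epsilon>..1} s * (LINT y|lborel. u y * kernel_ds z s y))"
    by (intro Bochner_Integration.integral_cong refl) (simp add: f_def mult.assoc[symmetric])
  finally have "ennreal \<bar>(LINT y|lborel. u y * kernel z \<epsilon> y) - (LINT y|lborel. u y * \<phi> y)\<bar>
     = ennreal (norm (LINT s|lborel. indicator {\<epsilon>..1} s * (LINT y|lborel. u y * kernel_ds z s y)))"
    by (simp add: abs_minus_commute)
  also have "\<dots> \<le> (\<integral>\<^sup>+s. ennreal (norm (indicator {\<epsilon>..1} s * (LINT y|lborel. u y * kernel_ds z s y))) \<partial>lborel)"
    unfolding real_norm_def by (rule ennreal_abs_integral_le)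
  also have "\<dots> \<le> (\<integral>\<^sup>+s. (\<integral>\<^sup>+y. ennreal (4 * M * (norm (g y) + norm (G y))) * (indicator {\<epsilon>..1} s * (ennreal (1 / s ^ D) * indicator {s. pdist z y \<le> s} s)) \<partial>lborel) \<partial>lborel)"
  proof (rule nn_integral_mono)
    fix s
    show "ennreal (norm (indicator {\<epsilon>..1} s * (LINT y|lborel. u y * kernel_ds z s y)))
       \<le> (\<integral>\<^sup>+y. ennreal (4 * M * (norm (g y) + norm (G y))) * (indicator {\<epsilon>..1} s * (ennreal (1 / s ^ D) * indicator {s. pdist z y \<le> s} s)) \<partial>lborel)"
    proof (cases "s \<in> {\<epsilon>..1}")
      case True
      have "(indicator {s. pdist z y \<le> s} s :: ennreal) = indicator {y. pdist z y \<le> s} y" for y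
        by (simp add: indicator_def)
      then show ?thesis using integral_kernel_ds_bound[OF wf z, of s] True \<epsilon> by simp
    qed simp
  qed
  also have "\<dots> = (\<integral>\<^sup>+y. (\<integral>\<^sup>+s. ennreal (4 * M * (norm (g y) + norm (G y))) * (indicator {\<epsilon>..1} s * (ennreal (1 / s ^ D) * indicator {s. pdist z y \<le> s} s)) \<partial>lborel) \<partial>lborel)"
    by (rule lborel_pair.Fubini'[symmetric]) measurable
  also have "\<dots> = (\<integral>\<^sup>+y. ennreal (4 * M * (norm (g y) + norm (G y))) * (\<integral>\<^sup>+s. indicator {\<epsilon>..1} s * (ennreal (1 / s ^ D) * indicator {s. pdist z y \<le> s} s) \<partial>lborel) \<partial>lborel)"
    by (intro nn_integral_cong nn_integral_cmult) measurable
  also have "\<dots> \<le> (\<integral>\<^sup>+y. ennreal (4 * M) * ennreal (pdist z y powr (- (real D - 1)) * (norm (g y) + norm (G y))) \<partial>lborel)"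
  proof (rule nn_integral_mono_AE)
    \<comment> \<open>At \<open>y = z\<close> the power is \<open>0\<close> by convention and the bound by the kernel fails.\<close>
    have "AE y in lborel. y \<noteq> z" by (rule AE_lborel_singleton)
    then show "AE y in lborel. ennreal (4 * M * (norm (g y) + norm (G y))) * (\<integral>\<^sup>+s. indicator {\<epsilon>..1} s * (ennreal (1 / s ^ D) * indicator {s. pdist z y \<le> s} s) \<partial>lborel)
        \<le> ennreal (4 * M) * ennreal (pdist z y powr (- (real D - 1)) * (norm (g y) + norm (G y)))"
    proof eventually_elim
      case (elim y)
      have "ennreal (4 * M * (norm (g y) + norm (G y))) * (\<integral>\<^sup>+s. indicator {\<epsilon>..1} s * (ennreal (1 / s ^ D) * indicator {s. pdist z y \<le> s} s) \<partial>lborel)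
         \<le> ennreal (4 * M * (norm (g y) + norm (G y))) * ennreal (pdist z y powr (- (real D - 1)))"
        by (intro mult_left_mono nn_integral_shell elim) auto
      also have "\<dots> = ennreal (4 * M) * ennreal (pdist z y powr (- (real D - 1)) * (norm (g y) + norm (G y)))"
        using M_nonneg by (simp add: mult_ac flip: ennreal_mult)
      finally show ?case .
    qed
  qed
  also have "\<dots> = ennreal (4 * M) * (\<integral>\<^sup>+y. ennreal (pdist z y powr (- (real D - 1)) * (norm (g y) + norm (G y))) \<partial>lborel)"
    by (intro nn_integral_cmult) measurable
  finally show ?thesis .
qed

end

section \<open>Convergence of the averages\<close>

text \<open>
  A truncation makes \<open>u\<close> bounded; a measurable function is an almost everywhere limit of continuous
  functions, and the same truncation of these converges in the mean on a set of finite measure.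
\<close>

lemma bounded_continuous_approximation_L1:
  fixes u :: "'a::euclidean_space \<Rightarrow> real"
  assumes u: "integrable lborel u" and S: "S \<in> sets borel" "emeasure lborel S < \<infinity>" and \<eta>: "0 < \<eta>"
  shows "\<exists>v B. continuous_on UNIV v \<and> (\<forall>y. \<bar>v y\<bar> \<le> B) \<and>
     (\<integral>\<^sup>+y. ennreal \<bar>u y - v y\<bar> * indicator S y \<partial>lborel) \<le> ennreal \<eta>"
proof -
  have [measurable]: "u \<in> borel_measurable borel" "S \<in> sets borel" using u S by (auto dest!: borel_measurable_integrable)
  define clamp where "clamp m r = max (- real m) (min (real m) r)" for m r
  have "(\<lambda>m. \<integral>\<^sup>+y. ennreal \<bar>u y - clamp m (u y)\<bar> \<partial>lborel) \<longlonglongrightarrow> (\<integral>\<^sup>+(y::'a). 0 \<partial>lborel)"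
  proof (rule nn_integral_dominated_convergence[where w="\<lambda>y. ennreal \<bar>u y\<bar>"])
    show "AE y in lborel. ennreal \<bar>u y - clamp m (u y)\<bar> \<le> ennreal \<bar>u y\<bar>" for m
      by (auto simp: clamp_def intro!: ennreal_leI)
    show "(\<integral>\<^sup>+y. ennreal \<bar>u y\<bar> \<partial>lborel) < \<infinity>" using u by (simp add: integrable_iff_bounded)
    show "AE y in lborel. (\<lambda>m. ennreal \<bar>u y - clamp m (u y)\<bar>) \<longlonglongrightarrow> 0"
    proof (rule AE_I2)
      fix y
      obtain m0 where "\<bar>u y\<bar> \<le> real m0" using real_arch_simple by blast
      then have "\<forall>m\<ge>m0. ennreal \<bar>u y - clamp m (u y)\<bar> = 0" by (auto simp: clamp_def)
      then show "(\<lambda>m. ennreal \<bar>u y - clamp m (u y)\<bar>) \<longlonglongrightarrow> 0"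
        by (intro tendsto_eventually) (auto simp: eventually_sequentially)
    qed
  qed (auto simp: clamp_def)
  then have "\<forall>\<^sub>F m in sequentially. (\<integral>\<^sup>+y. ennreal \<bar>u y - clamp m (u y)\<bar> \<partial>lborel) < ennreal (\<eta> / 2)"
    by (rule order_tendstoD) (use \<eta> in auto)
  then obtain m where m: "(\<integral>\<^sup>+y. ennreal \<bar>u y - clamp m (u y)\<bar> \<partial>lborel) < ennreal (\<eta> / 2)"
    by (auto simp: eventually_sequentially)
  have "u \<in> borel_measurable lebesgue" by (simp add: measurable_completion)
  then have "u measurable_on UNIV" by (intro lebesgue_measurable_imp_measurable_on) auto
  then obtain N g where N: "negligible N" and g: "\<And>n. continuous_on UNIV (g n)"
      and lim: "\<And>x. x \<notin> N \<Longrightarrow> (\<lambda>n. g n x) \<longlonglongrightarrow> u x"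
    unfolding measurable_on_def by auto
  have [measurable]: "g n \<in> borel_measurable borel" for n by (intro borel_measurable_continuous_onI g)
  have AEN: "AE x in lborel. x \<notin> N"
    using N by (metis AE_completion_iff AE_not_in negligible_iff_null_sets)
  have "(\<lambda>n. \<integral>\<^sup>+y. ennreal \<bar>clamp m (u y) - clamp m (g n y)\<bar> * indicator S y \<partial>lborel) \<longlonglongrightarrow> (\<integral>\<^sup>+(y::'a). 0 \<partial>lborel)"
  proof (rule nn_integral_dominated_convergence[where w="\<lambda>y. ennreal (2 * real m) * indicator S y"])
    show "AE y in lborel. ennreal \<bar>clamp m (u y) - clamp m (g n y)\<bar> * indicator S y \<le> ennreal (2 * real m) * indicator S y" for n
      by (intro AE_I2 mult_right_mono ennreal_leI) (auto simp: clamp_def)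
    show "(\<integral>\<^sup>+y. ennreal (2 * real m) * indicator S y \<partial>lborel) < \<infinity>"
      using S by (subst nn_integral_cmult_indicator) (auto simp: ennreal_mult_less_top)
    show "AE y in lborel. (\<lambda>n. ennreal \<bar>clamp m (u y) - clamp m (g n y)\<bar> * indicator S y) \<longlonglongrightarrow> 0"
      using AEN
    proof eventually_elim
      case (elim y)
      have "(\<lambda>n. \<bar>clamp m (u y) - clamp m (g n y)\<bar>) \<longlonglongrightarrow> \<bar>clamp m (u y) - clamp m (u y)\<bar>"
        unfolding clamp_def by (intro tendsto_intros lim elim)
      then have "(\<lambda>n. ennreal \<bar>clamp m (u y) - clamp m (g n y)\<bar>) \<longlonglongrightarrow> ennreal 0"
        by (intro tendsto_ennrealI) simp
      then show ?case by (cases "y \<in> S") auto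
    qed
  qed (auto simp: clamp_def)
  then have "\<forall>\<^sub>F n in sequentially. (\<integral>\<^sup>+y. ennreal \<bar>clamp m (u y) - clamp m (g n y)\<bar> * indicator S y \<partial>lborel) < ennreal (\<eta> / 2)"
    by (rule order_tendstoD) (use \<eta> in auto)
  then obtain n where n: "(\<integral>\<^sup>+y. ennreal \<bar>clamp m (u y) - clamp m (g n y)\<bar> * indicator S y \<partial>lborel) < ennreal (\<eta> / 2)"
    by (auto simp: eventually_sequentially)
  define v where "v y = clamp m (g n y)" for y
  have "(\<integral>\<^sup>+y. ennreal \<bar>u y - v y\<bar> * indicator S y \<partial>lborel)
     \<le> (\<integral>\<^sup>+y. ennreal \<bar>u y - clamp m (u y)\<bar> + ennreal \<bar>clamp m (u y) - clamp m (g n y)\<bar> * indicator S y \<partial>lborel)"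
    by (intro nn_integral_mono) (auto simp: v_def indicator_def simp flip: ennreal_plus intro!: ennreal_leI)
  also have "\<dots> = (\<integral>\<^sup>+y. ennreal \<bar>u y - clamp m (u y)\<bar> \<partial>lborel) + (\<integral>\<^sup>+y. ennreal \<bar>clamp m (u y) - clamp m (g n y)\<bar> * indicator S y \<partial>lborel)"
    by (rule nn_integral_add) (auto simp: clamp_def)
  also have "\<dots> \<le> ennreal (\<eta> / 2) + ennreal (\<eta> / 2)" using m n by (intro add_mono less_imp_le)
  also have "\<dots> = ennreal \<eta>" using \<eta> by (simp flip: ennreal_plus)
  finally have "(\<integral>\<^sup>+y. ennreal \<bar>u y - v y\<bar> * indicator S y \<partial>lborel) \<le> ennreal \<eta>" .
  moreover have "continuous_on UNIV v"
    unfolding v_def clamp_def by (intro continuous_intros g)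
  moreover have "\<bar>v y\<bar> \<le> real m" for y by (auto simp: v_def clamp_def)
  ultimately show ?thesis by blast
qed

context unit_bump
begin

definition smoothing :: "real \<Rightarrow> ((real ^ 'n) \<times> real \<Rightarrow> real) \<Rightarrow> (real ^ 'n) \<times> real \<Rightarrow> real" where
  "smoothing \<epsilon> u z = (LINT y|lborel. u y * kernel z \<epsilon> y)"

lemma kernel_measurable_compose [measurable (raw)]:
  assumes [measurable]: "f \<in> borel_measurable N" "g \<in> borel_measurable N"
  shows "(\<lambda>x. kernel (f x) s (g x)) \<in> borel_measurable N"
  unfolding kernel_def zoom_def by measurable

lemma smoothing_measurable [measurable]:
  assumes [measurable]: "u \<in> borel_measurable borel"
  shows "smoothing \<epsilon> u \<in> borel_measurable borel"
  unfolding smoothing_def by measurable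

lemma integrable_kernel: "0 < s \<Longrightarrow> integrable lborel (kernel z s)"
  using nn_integral_kernel[of s z] kernel_nonneg[of s z] by (intro integrableI_nonneg) auto

lemma integral_kernel: "0 < s \<Longrightarrow> (LINT y|lborel. kernel z s y) = 1"
  using nn_integral_kernel[of s z] kernel_nonneg[of s z]
  by (subst integral_eq_nn_integral) auto

lemma integrable_mult_kernel: "integrable lborel u \<Longrightarrow> 0 < s \<Longrightarrow> integrable lborel (\<lambda>y. u y * kernel z s y)"
  by (rule integrable_mult_bounded[OF _ _ kernel_abs_le]) auto

lemma integrable_bounded_mult_kernel:
  assumes "v \<in> borel_measurable borel" "\<And>y. \<bar>v y\<bar> \<le> B" "0 < s"
  shows "integrable lborel (\<lambda>y. v y * kernel z s y)"
  using integrable_mult_bounded[OF integrable_kernel[OF assms(3)] _ assms(2)] assms(1) by (simp add: mult.commute)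

text \<open>
  The kernel is bounded by \<open>M / \<epsilon>\<^sup>D\<close> on the parabolic ball of radius \<open>\<epsilon>\<close>.  This bound is symmetric in
  the two points, so Tonelli's theorem allows integration over the centres first.
\<close>

lemma smoothing_L1_contraction:
  assumes [measurable]: "u \<in> borel_measurable borel" and \<epsilon>: "0 < \<epsilon>" "\<epsilon> \<le> 1"
  shows "(\<integral>\<^sup>+z. ennreal \<bar>smoothing \<epsilon> u z\<bar> * indicator Q\<^sub>1 z \<partial>lborel)
     \<le> ennreal (M * (2 ^ D * unit_ball_vol CARD('n))) * (\<integral>\<^sup>+y. ennreal \<bar>u y\<bar> * indicator Q\<^sub>1 y \<partial>lborel)"
proof -
  define c where "c = 2 ^ D * unit_ball_vol CARD('n)"
  have c: "0 \<le> c" by (simp add: c_def)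
  define k :: "(real ^ 'n) \<times> real \<Rightarrow> (real ^ 'n) \<times> real \<Rightarrow> ennreal"
    where "k z y = ennreal (M / \<epsilon> ^ D) * indicator {y. pdist z y \<le> \<epsilon>} y" for z y
  have k_sym: "k z y = ennreal (M / \<epsilon> ^ D) * indicator {z. pdist y z \<le> \<epsilon>} z" for z y
    by (simp add: k_def indicator_def pdist_commute)
  have [measurable]: "(\<lambda>(z, y). k z y) \<in> borel_measurable (borel \<Otimes>\<^sub>M borel)"
  proof -
    have "(\<lambda>(z, y). k z y) = (\<lambda>(z, y). if pdist z y \<le> \<epsilon> then ennreal (M / \<epsilon> ^ D) else 0)"
      by (auto simp: k_def indicator_def fun_eq_iff)
    then show ?thesis by simp
  qed
  have int_k: "(\<integral>\<^sup>+z. k z y \<partial>lborel) = ennreal (M * c)" for y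
  proof -
    have "(\<integral>\<^sup>+z. k z y \<partial>lborel) = ennreal (M / \<epsilon> ^ D) * emeasure lborel {z. pdist y z \<le> \<epsilon>}"
      unfolding k_sym by (subst nn_integral_cmult_indicator) auto
    also have "\<dots> = ennreal (M * c)"
      using \<epsilon> M_nonneg c by (subst emeasure_pdist_ball) (auto simp: c_def D_def simp flip: ennreal_mult)
    finally show ?thesis .
  qed
  have "ennreal \<bar>smoothing \<epsilon> u z\<bar> * indicator Q\<^sub>1 z \<le> (\<integral>\<^sup>+y. (ennreal \<bar>u y\<bar> * indicator Q\<^sub>1 y) * k z y \<partial>lborel)" for z
  proof (cases "z \<in> Q\<^sub>1")
    case True
    have "ennreal \<bar>smoothing \<epsilon> u z\<bar> \<le> (\<integral>\<^sup>+y. ennreal \<bar>u y * kernel z \<epsilon> y\<bar> \<partial>lborel)"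
      unfolding smoothing_def by (rule ennreal_abs_integral_le)
    also have "\<dots> \<le> (\<integral>\<^sup>+y. (ennreal \<bar>u y\<bar> * indicator Q\<^sub>1 y) * k z y \<partial>lborel)"
    proof (rule nn_integral_mono)
      fix y
      show "ennreal \<bar>u y * kernel z \<epsilon> y\<bar> \<le> (ennreal \<bar>u y\<bar> * indicator Q\<^sub>1 y) * k z y"
      proof (cases "y \<in> Q\<^sub>1 \<and> pdist z y \<le> \<epsilon>")
        case True
        have "\<bar>u y\<bar> * \<bar>kernel z \<epsilon> y\<bar> \<le> \<bar>u y\<bar> * (M / \<epsilon> ^ D)"
          by (intro mult_left_mono kernel_abs_le \<epsilon>) auto
        then show ?thesis using True M_nonneg \<epsilon>
          by (simp add: k_def abs_mult flip: ennreal_mult)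
      next
        case False
        then have "kernel z \<epsilon> y = 0"
          using kernel_support[OF \<open>z \<in> Q\<^sub>1\<close> \<epsilon>, of y] kernel_bound[OF \<open>z \<in> Q\<^sub>1\<close> \<epsilon>(1), of y] kernel_nonneg[OF \<epsilon>(1), of z y]
          by (auto simp: indicator_def)
        then show ?thesis by simp
      qed
    qed
    finally show ?thesis using True by simp
  qed simp
  then have "(\<integral>\<^sup>+z. ennreal \<bar>smoothing \<epsilon> u z\<bar> * indicator Q\<^sub>1 z \<partial>lborel) \<le> (\<integral>\<^sup>+z. \<integral>\<^sup>+y. (ennreal \<bar>u y\<bar> * indicator Q\<^sub>1 y) * k z y \<partial>lborel \<partial>lborel)"
    by (rule nn_integral_mono)
  also have "\<dots> = (\<integral>\<^sup>+y. \<integral>\<^sup>+z. (ennreal \<bar>u y\<bar> * indicator Q\<^sub>1 y) * k z y \<partial>lborel \<partial>lborel)"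
    by (rule lborel_pair.Fubini'[symmetric]) measurable
  also have "\<dots> = (\<integral>\<^sup>+y. (ennreal \<bar>u y\<bar> * indicator Q\<^sub>1 y) * ennreal (M * c) \<partial>lborel)"
    by (intro nn_integral_cong, subst nn_integral_cmult) (auto simp: int_k)
  also have "\<dots> = ennreal (M * c) * (\<integral>\<^sup>+y. ennreal \<bar>u y\<bar> * indicator Q\<^sub>1 y \<partial>lborel)"
    by (subst nn_integral_multc) (auto simp: mult.commute)
  finally show ?thesis by (simp add: c_def)
qed

lemma smoothing_bounded_le:
  assumes "v \<in> borel_measurable borel" "\<And>y. \<bar>v y\<bar> \<le> B" "0 < \<epsilon>"
  shows "\<bar>smoothing \<epsilon> v z\<bar> \<le> B"
proof -
  have "norm (smoothing \<epsilon> v z) \<le> (LINT y|lborel. B * kernel z \<epsilon> y)"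
    unfolding smoothing_def
  proof (rule Bochner_Integration.integral_norm_bound_integral)
    show "norm (v y * kernel z \<epsilon> y) \<le> B * kernel z \<epsilon> y" for y
      using assms(2)[of y] kernel_nonneg[OF assms(3), of z y] by (simp add: abs_mult mult_right_mono)
  qed (use integrable_bounded_mult_kernel[OF assms] integrable_kernel[OF assms(3)] in auto)
  then show ?thesis using assms(3) by (simp add: integral_kernel)
qed

lemma smoothing_tendsto_continuous:
  assumes v: "continuous_on UNIV v" "\<And>y. \<bar>v y\<bar> \<le> B" and z: "z \<in> Q\<^sub>1"
    and \<epsilon>: "\<And>k. 0 < \<epsilon> k" "\<epsilon> \<longlonglongrightarrow> 0"
  shows "(\<lambda>k. smoothing (\<epsilon> k) v z) \<longlonglongrightarrow> v z"
proof (rule LIMSEQ_I)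
  fix e :: real assume e: "0 < e"
  have [measurable]: "v \<in> borel_measurable borel" by (intro borel_measurable_continuous_onI v)
  obtain \<delta> where \<delta>: "0 < \<delta>" "\<And>y. dist y z < \<delta> \<Longrightarrow> dist (v y) (v z) < e / 2"
    using v(1) e by (metis UNIV_I continuous_on_iff half_gt_zero)
  have "\<forall>\<^sub>F k in sequentially. \<epsilon> k < min 1 (\<delta> / 4)"
    by (rule order_tendstoD(2)[OF \<epsilon>(2)]) (use \<delta> in auto)
  then obtain k0 where k0: "\<And>k. k \<ge> k0 \<Longrightarrow> \<epsilon> k < min 1 (\<delta> / 4)"
    by (auto simp: eventually_sequentially)
  have "norm (smoothing (\<epsilon> k) v z - v z) < e" if "k \<ge> k0" for k
  proof -
    have s: "0 < \<epsilon> k" "\<epsilon> k < 1" "4 * \<epsilon> k < \<delta>" using \<epsilon>(1) k0[OF that] by auto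
    have int_v: "integrable lborel (\<lambda>y. v y * kernel z (\<epsilon> k) y)"
      by (rule integrable_bounded_mult_kernel[OF _ v(2) s(1)]) simp
    have int_1: "integrable lborel (\<lambda>y. v z * kernel z (\<epsilon> k) y)" using integrable_kernel[OF s(1)] by simp
    have "smoothing (\<epsilon> k) v z - v z = (LINT y|lborel. v y * kernel z (\<epsilon> k) y - v z * kernel z (\<epsilon> k) y)"
      unfolding smoothing_def using int_v int_1 by (simp add: integral_kernel[OF s(1)])
    also have "norm \<dots> \<le> (LINT y|lborel. e / 2 * kernel z (\<epsilon> k) y)"
    proof (rule Bochner_Integration.integral_norm_bound_integral)
      fix y
      show "norm (v y * kernel z (\<epsilon> k) y - v z * kernel z (\<epsilon> k) y) \<le> e / 2 * kernel z (\<epsilon> k) y"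
      proof (cases "pdist z y \<le> \<epsilon> k")
        case True
        then have "norm (fst y - fst z) \<le> 2 * \<epsilon> k" "\<bar>snd y - snd z\<bar> \<le> 2 * (\<epsilon> k)\<^sup>2"
          using s by (auto simp: pdist_le_iff)
        moreover have "(\<epsilon> k)\<^sup>2 \<le> \<epsilon> k" using s by (simp add: power2_eq_square mult_left_le)
        moreover have "norm (y - z) \<le> norm (fst y - fst z) + \<bar>snd y - snd z\<bar>"
          using norm_Pair_le[of "fst y - fst z" "snd y - snd z"] by (simp add: minus_prod_def)
        ultimately have "dist y z < \<delta>" using s by (simp add: dist_norm)
        then have "\<bar>v y - v z\<bar> \<le> e / 2" using \<delta>(2)[of y] by (simp add: dist_real_def)
        then have "\<bar>v y - v z\<bar> * kernel z (\<epsilon> k) y \<le> e / 2 * kernel z (\<epsilon> k) y"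
          using kernel_nonneg[OF s(1)] by (intro mult_right_mono) auto
        then show ?thesis using kernel_nonneg[OF s(1), of z y] by (simp add: abs_mult flip: left_diff_distrib)
      next
        case False
        then have "kernel z (\<epsilon> k) y = 0"
          using kernel_bound[OF z s(1), of y] kernel_nonneg[OF s(1), of z y] by (auto simp: indicator_def)
        then show ?thesis by simp
      qed
    qed (use int_v int_1 integrable_kernel[OF s(1)] in auto)
    also have "\<dots> = e / 2" by (simp add: integral_kernel[OF s(1)])
    finally show ?thesis using e by simp
  qed
  then show "\<exists>no. \<forall>n\<ge>no. norm (smoothing (\<epsilon> n) v z - v z) < e" by blast
qed

text \<open>
  The usual density argument: convergence for bounded continuous functions and a bound in the mean that is
  uniform in \<open>\<epsilon>\<close>.
\<close>

lemma smoothing_tendsto_L1: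
  assumes u: "integrable lborel u" and \<epsilon>: "\<And>k. 0 < \<epsilon> k" "\<And>k. \<epsilon> k \<le> 1" "\<epsilon> \<longlonglongrightarrow> 0"
  shows "(\<lambda>k. \<integral>\<^sup>+z. ennreal \<bar>smoothing (\<epsilon> k) u z - u z\<bar> * indicator Q\<^sub>1 z \<partial>lborel) \<longlonglongrightarrow> 0"
proof (rule order_tendstoI)
  fix a :: ennreal assume "0 < a"
  have [measurable]: "u \<in> borel_measurable borel" using u by (auto dest!: borel_measurable_integrable)
  define c where "c = M * (2 ^ D * unit_ball_vol CARD('n))"
  have c: "0 \<le> c" using M_nonneg by (simp add: c_def)
  obtain r where r: "0 < r" "ennreal r < a"
  proof (cases a)
    case (real x)
    then show ?thesis using \<open>0 < a\<close> that[of "x / 2"] by (auto simp: ennreal_less_iff)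
  qed (use that[of 1] in auto)
  define \<eta> where "\<eta> = r / (c + 2)"
  have \<eta>: "0 < \<eta>" "(c + 2) * \<eta> = r" using r c by (auto simp: \<eta>_def)
  have Q1_fin: "emeasure lborel (Q\<^sub>1 :: ((real ^ 'n) \<times> real) set) < \<infinity>" by (simp add: emeasure_Q1)
  obtain v B where v: "continuous_on UNIV v" "\<And>y. \<bar>v y\<bar> \<le> B"
    and uv: "(\<integral>\<^sup>+y. ennreal \<bar>u y - v y\<bar> * indicator Q\<^sub>1 y \<partial>lborel) \<le> ennreal \<eta>"
    using bounded_continuous_approximation_L1[OF u Q1_measurable Q1_fin \<eta>(1)] by blast
  have [measurable]: "v \<in> borel_measurable borel" by (intro borel_measurable_continuous_onI v)
  have "(\<lambda>k. \<integral>\<^sup>+z. ennreal \<bar>smoothing (\<epsilon> k) v z - v z\<bar> * indicator Q\<^sub>1 z \<partial>lborel) \<longlonglongrightarrow> (\<integral>\<^sup>+(z :: (real ^ 'n) \<times> real). 0 \<partial>lborel)"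
  proof (rule nn_integral_dominated_convergence[where w="\<lambda>z. ennreal (2 * B) * indicator Q\<^sub>1 z"])
    show "AE z in lborel. ennreal \<bar>smoothing (\<epsilon> k) v z - v z\<bar> * indicator Q\<^sub>1 z \<le> ennreal (2 * B) * indicator Q\<^sub>1 z" for k
    proof (intro AE_I2 mult_right_mono ennreal_leI)
      fix z
      show "\<bar>smoothing (\<epsilon> k) v z - v z\<bar> \<le> 2 * B"
        using smoothing_bounded_le[where v=v and z=z, OF _ v(2) \<epsilon>(1)[of k]] v(2)[of z] by simp
    qed simp
    show "(\<integral>\<^sup>+z. ennreal (2 * B) * indicator Q\<^sub>1 z \<partial>lborel) < \<infinity>"
      by (subst nn_integral_cmult_indicator) (auto simp: ennreal_mult_less_top emeasure_Q1)
    show "AE z in lborel. (\<lambda>k. ennreal \<bar>smoothing (\<epsilon> k) v z - v z\<bar> * indicator Q\<^sub>1 z) \<longlonglongrightarrow> 0"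
    proof (rule AE_I2)
      fix z
      show "(\<lambda>k. ennreal \<bar>smoothing (\<epsilon> k) v z - v z\<bar> * indicator Q\<^sub>1 z) \<longlonglongrightarrow> 0"
      proof (cases "z \<in> Q\<^sub>1")
        case True
        have "(\<lambda>k. \<bar>smoothing (\<epsilon> k) v z - v z\<bar>) \<longlonglongrightarrow> \<bar>v z - v z\<bar>"
          by (intro tendsto_intros smoothing_tendsto_continuous[OF v True \<epsilon>(1,3)])
        then have "(\<lambda>k. ennreal \<bar>smoothing (\<epsilon> k) v z - v z\<bar>) \<longlonglongrightarrow> ennreal 0"
          by (intro tendsto_ennrealI) simp
        then show ?thesis using True by simp
      qed simp
    qed
  qed auto
  then have "\<forall>\<^sub>F k in sequentially. (\<integral>\<^sup>+z. ennreal \<bar>smoothing (\<epsilon> k) v z - v z\<bar> * indicator Q\<^sub>1 z \<partial>lborel) < ennreal \<eta>"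
    by (rule order_tendstoD) (use \<eta> in auto)
  then show "\<forall>\<^sub>F k in sequentially. (\<integral>\<^sup>+z. ennreal \<bar>smoothing (\<epsilon> k) u z - u z\<bar> * indicator Q\<^sub>1 z \<partial>lborel) < a"
  proof eventually_elim
    case (elim k)
    have lin: "smoothing (\<epsilon> k) (\<lambda>y. u y - v y) z = smoothing (\<epsilon> k) u z - smoothing (\<epsilon> k) v z" for z
      unfolding smoothing_def left_diff_distrib
      by (rule Bochner_Integration.integral_diff[OF integrable_mult_kernel[OF u \<epsilon>(1)] integrable_bounded_mult_kernel[OF _ v(2) \<epsilon>(1)]]) simp
    have "ennreal \<bar>smoothing (\<epsilon> k) u z - u z\<bar> * indicator Q\<^sub>1 z
       \<le> ennreal \<bar>smoothing (\<epsilon> k) (\<lambda>y. u y - v y) z\<bar> * indicator Q\<^sub>1 z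
         + (ennreal \<bar>smoothing (\<epsilon> k) v z - v z\<bar> * indicator Q\<^sub>1 z + ennreal \<bar>u z - v z\<bar> * indicator Q\<^sub>1 z)" for z
      by (auto simp: lin indicator_def simp flip: ennreal_plus intro!: ennreal_leI)
    then have "(\<integral>\<^sup>+z. ennreal \<bar>smoothing (\<epsilon> k) u z - u z\<bar> * indicator Q\<^sub>1 z \<partial>lborel)
       \<le> (\<integral>\<^sup>+z. ennreal \<bar>smoothing (\<epsilon> k) (\<lambda>y. u y - v y) z\<bar> * indicator Q\<^sub>1 z
         + (ennreal \<bar>smoothing (\<epsilon> k) v z - v z\<bar> * indicator Q\<^sub>1 z + ennreal \<bar>u z - v z\<bar> * indicator Q\<^sub>1 z) \<partial>lborel)"
      by (rule nn_integral_mono)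
    also have "\<dots> = (\<integral>\<^sup>+z. ennreal \<bar>smoothing (\<epsilon> k) (\<lambda>y. u y - v y) z\<bar> * indicator Q\<^sub>1 z \<partial>lborel)
         + ((\<integral>\<^sup>+z. ennreal \<bar>smoothing (\<epsilon> k) v z - v z\<bar> * indicator Q\<^sub>1 z \<partial>lborel) + (\<integral>\<^sup>+z. ennreal \<bar>u z - v z\<bar> * indicator Q\<^sub>1 z \<partial>lborel))"
      by (subst nn_integral_add, simp, simp, subst nn_integral_add) auto
    also have "\<dots> \<le> ennreal c * ennreal \<eta> + (ennreal \<eta> + ennreal \<eta>)"
    proof (intro add_mono uv less_imp_le[OF elim])
      have "(\<integral>\<^sup>+z. ennreal \<bar>smoothing (\<epsilon> k) (\<lambda>y. u y - v y) z\<bar> * indicator Q\<^sub>1 z \<partial>lborel)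
         \<le> ennreal c * (\<integral>\<^sup>+y. ennreal \<bar>u y - v y\<bar> * indicator Q\<^sub>1 y \<partial>lborel)"
        unfolding c_def by (rule smoothing_L1_contraction[OF _ \<epsilon>(1,2)]) simp
      also have "\<dots> \<le> ennreal c * ennreal \<eta>" by (intro mult_left_mono uv) auto
      finally show "(\<integral>\<^sup>+z. ennreal \<bar>smoothing (\<epsilon> k) (\<lambda>y. u y - v y) z\<bar> * indicator Q\<^sub>1 z \<partial>lborel) \<le> ennreal c * ennreal \<eta>" .
    qed
    also have "\<dots> = ennreal ((c + 2) * \<eta>)"
      using c \<eta>(1) by (simp add: algebra_simps flip: ennreal_mult ennreal_plus)
    finally show ?case using r(2) by (simp add: \<eta>(2))
  qed
qed simp

text \<open>One subsequence has to serve all components, so the sum of their errors is used.\<close>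

lemma smoothing_tendsto_AE_subseq:
  fixes N :: nat
  assumes u: "\<And>i. i < N \<Longrightarrow> integrable lborel (u i)"
    and \<epsilon>: "\<And>k. 0 < \<epsilon> k" "\<And>k. \<epsilon> k \<le> 1" "\<epsilon> \<longlonglongrightarrow> 0"
  shows "\<exists>r :: nat \<Rightarrow> nat. AE z in lborel. z \<in> Q\<^sub>1 \<longrightarrow> (\<forall>i<N. (\<lambda>k. smoothing (\<epsilon> (r k)) (u i) z) \<longlonglongrightarrow> u i z)"
proof -
  define d where "d i k z = \<bar>smoothing (\<epsilon> k) (u i) z - u i z\<bar> * indicator Q\<^sub>1 z" for i k z
  have um [measurable]: "u i \<in> borel_measurable borel" if "i < N" for i using u[OF that] by (auto dest!: borel_measurable_integrable)
  have dm [measurable]: "d i k \<in> borel_measurable borel" if "i < N" for i k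
    unfolding d_def using um[OF that] by measurable
  have nn: "(\<integral>\<^sup>+z. ennreal (d i k z) \<partial>lborel) = (\<integral>\<^sup>+z. ennreal \<bar>smoothing (\<epsilon> k) (u i) z - u i z\<bar> * indicator Q\<^sub>1 z \<partial>lborel)" for i k
    by (intro nn_integral_cong) (auto simp: d_def indicator_def)
  have d_int: "integrable lborel (d i k)" if "i < N" for i k
  proof (rule integrableI_nonneg)
    have "ennreal (d i k z) \<le> ennreal \<bar>smoothing (\<epsilon> k) (u i) z\<bar> * indicator Q\<^sub>1 z + ennreal \<bar>u i z\<bar> * indicator Q\<^sub>1 z" for z
      by (auto simp: d_def indicator_def simp flip: ennreal_plus intro!: ennreal_leI)
    then have "(\<integral>\<^sup>+z. ennreal (d i k z) \<partial>lborel) \<le> (\<integral>\<^sup>+z. ennreal \<bar>smoothing (\<epsilon> k) (u i) z\<bar> * indicator Q\<^sub>1 z + ennreal \<bar>u i z\<bar> * indicator Q\<^sub>1 z \<partial>lborel)"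
      by (rule nn_integral_mono)
    also have "\<dots> = (\<integral>\<^sup>+z. ennreal \<bar>smoothing (\<epsilon> k) (u i) z\<bar> * indicator Q\<^sub>1 z \<partial>lborel) + (\<integral>\<^sup>+z. ennreal \<bar>u i z\<bar> * indicator Q\<^sub>1 z \<partial>lborel)"
      using um[OF that] by (intro nn_integral_add) auto
    also have "\<dots> < \<infinity>"
    proof -
      have "(\<integral>\<^sup>+z. ennreal \<bar>u i z\<bar> * indicator Q\<^sub>1 z \<partial>lborel) \<le> (\<integral>\<^sup>+z. ennreal \<bar>u i z\<bar> \<partial>lborel)"
        by (intro nn_integral_mono) (auto simp: indicator_def)
      also have "\<dots> < \<infinity>" using u[OF that] by (simp add: integrable_iff_bounded)
      finally have fin: "(\<integral>\<^sup>+z. ennreal \<bar>u i z\<bar> * indicator Q\<^sub>1 z \<partial>lborel) < \<infinity>" .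
      moreover have "(\<integral>\<^sup>+z. ennreal \<bar>smoothing (\<epsilon> k) (u i) z\<bar> * indicator Q\<^sub>1 z \<partial>lborel) < \<infinity>"
        by (rule le_less_trans[OF smoothing_L1_contraction[OF um[OF that] \<epsilon>(1,2)]])
          (use fin in \<open>simp add: ennreal_mult_less_top\<close>)
      ultimately show ?thesis by simp
    qed
    finally show "(\<integral>\<^sup>+z. ennreal (d i k z) \<partial>lborel) < \<infinity>" .
  qed (use dm[OF that] in \<open>auto simp: d_def\<close>)
  define U where "U k z = (\<Sum>i<N. d i k z)" for k z
  have U_int: "integrable lborel (U k)" for k
    unfolding U_def using d_int by auto
  have "(\<lambda>k. LINT z|lborel. d i k z) \<longlonglongrightarrow> 0" if "i < N" for i
  proof -
    have "(\<lambda>k. enn2real (\<integral>\<^sup>+z. ennreal (d i k z) \<partial>lborel)) \<longlonglongrightarrow> 0"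
      unfolding nn using smoothing_tendsto_L1[OF u[OF that] \<epsilon>] by (intro tendsto_enn2real) auto
    moreover have "(LINT z|lborel. d i k z) = enn2real (\<integral>\<^sup>+z. ennreal (d i k z) \<partial>lborel)" for k
      by (rule integral_eq_nn_integral, use dm[OF that] in simp) (simp add: d_def)
    ultimately show ?thesis by simp
  qed
  then have "(\<lambda>k. \<Sum>i<N. LINT z|lborel. d i k z) \<longlonglongrightarrow> (\<Sum>i<N. 0)"
    by (intro tendsto_sum) auto
  moreover have "(LINT z|lborel. norm (U k z)) = (\<Sum>i<N. LINT z|lborel. d i k z)" for k
  proof -
    have "norm (U k z) = U k z" for z by (simp add: U_def d_def sum_nonneg)
    then show ?thesis unfolding U_def using d_int by simp
  qed
  ultimately have "(\<lambda>k. LINT z|lborel. norm (U k z)) \<longlonglongrightarrow> 0" by simp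
  from tendsto_L1_AE_subseq[OF U_int this]
  obtain r where r: "AE z in lborel. (\<lambda>k. U (r k) z) \<longlonglongrightarrow> 0" by blast
  have "AE z in lborel. z \<in> Q\<^sub>1 \<longrightarrow> (\<forall>i<N. (\<lambda>k. smoothing (\<epsilon> (r k)) (u i) z) \<longlonglongrightarrow> u i z)"
    using r
  proof eventually_elim
    case (elim z)
    show ?case
    proof (intro impI allI)
      fix i assume z: "z \<in> Q\<^sub>1" and i: "i < N"
      have "d i k z \<le> U k z" for k
        unfolding U_def using i by (intro member_le_sum) (auto simp: d_def)
      then have "(\<lambda>k. d i (r k) z) \<longlonglongrightarrow> 0"
        by (intro tendsto_sandwich[OF _ _ tendsto_const elim]) (auto simp: d_def)
      then have "(\<lambda>k. \<bar>smoothing (\<epsilon> (r k)) (u i) z - u i z\<bar>) \<longlonglongrightarrow> 0" using z by (simp add: d_def)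
      then show "(\<lambda>k. smoothing (\<epsilon> (r k)) (u i) z) \<longlonglongrightarrow> u i z"
        by (simp add: tendsto_rabs_zero_iff LIM_zero_iff)
    qed
  qed
  then show ?thesis by blast
qed

end

section \<open>Vector-valued solutions\<close>

lemma tnorm_nonneg: "0 \<le> tnorm N v"
  by (simp add: tnorm_def)

lemma tnorm_triangle: "tnorm N (\<lambda>i. v i + w i) \<le> tnorm N v + tnorm N w"
  unfolding tnorm_def
  by (rule order_trans[OF L2_set_mono L2_set_triangle_ineq]) (auto intro: norm_triangle_ineq)

lemma tnorm_scaleR: "tnorm N (\<lambda>i. c *\<^sub>R v i) = \<bar>c\<bar> * tnorm N v"
  by (simp add: tnorm_def L2_set_def power_mult_distrib sum_distrib_left[symmetric] real_sqrt_mult)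

lemma tnorm_measurable [measurable (raw)]:
  fixes v :: "'a \<Rightarrow> nat \<Rightarrow> 'b::{real_normed_vector, second_countable_topology}"
  assumes "\<And>i. i < N \<Longrightarrow> (\<lambda>x. v x i) \<in> borel_measurable M"
  shows "(\<lambda>x. tnorm N (v x)) \<in> borel_measurable M"
  unfolding tnorm_def L2_set_def using assms by measurable

text \<open>
  Duality is what transfers scalar bounds to vectors without a loss that depends on \<open>N\<close>.
\<close>

lemma tnorm_dual:
  fixes v :: "nat \<Rightarrow> real"
  obtains w where "tnorm N w \<le> 1" "tnorm N v = (\<Sum>i<N. w i * v i)"
proof (cases "tnorm N v = 0")
  case True
  then show ?thesis by (intro that[of "\<lambda>i. 0"]) (auto simp: tnorm_def L2_set_def)
next
  case False
  define w where "w i = (1 / tnorm N v) *\<^sub>R v i" for i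
  have "tnorm N w = 1" unfolding w_def tnorm_scaleR using False tnorm_nonneg[of N v] by simp
  moreover have "(\<Sum>i<N. w i * v i) = (\<Sum>i<N. (v i)\<^sup>2) / tnorm N v"
    by (simp add: w_def sum_divide_distrib power2_eq_square)
  moreover have "(\<Sum>i<N. (v i)\<^sup>2) = (tnorm N v)\<^sup>2"
    by (simp add: tnorm_def L2_set_def sum_nonneg)
  ultimately show ?thesis using False by (intro that[of w]) (auto simp: power2_eq_square)
qed

lemma norm_weighted_sum_le_tnorm:
  fixes v :: "nat \<Rightarrow> 'b::real_normed_vector"
  shows "norm (\<Sum>i<N. w i *\<^sub>R v i) \<le> tnorm N w * tnorm N v"
proof -
  have "norm (\<Sum>i<N. w i *\<^sub>R v i) \<le> (\<Sum>i<N. \<bar>norm (w i)\<bar> * \<bar>norm (v i)\<bar>)"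
    by (rule order_trans[OF norm_sum]) simp
  also have "\<dots> \<le> tnorm N w * tnorm N v" unfolding tnorm_def by (rule L2_set_mult_ineq)
  finally show ?thesis .
qed

lemma tnorm_integral_le:
  fixes f :: "nat \<Rightarrow> 'a \<Rightarrow> real"
  assumes "\<And>i. i < N \<Longrightarrow> integrable M (f i)"
  shows "ennreal (tnorm N (\<lambda>i. LINT x|M. f i x)) \<le> (\<integral>\<^sup>+x. ennreal (tnorm N (\<lambda>i. f i x)) \<partial>M)"
proof -
  obtain w where w: "tnorm N w \<le> 1" "tnorm N (\<lambda>i. LINT x|M. f i x) = (\<Sum>i<N. w i * (LINT x|M. f i x))"
    by (rule tnorm_dual)
  have "tnorm N (\<lambda>i. LINT x|M. f i x) = (LINT x|M. (\<Sum>i<N. w i * f i x))"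
    using w assms by simp
  then have "ennreal (tnorm N (\<lambda>i. LINT x|M. f i x)) \<le> ennreal \<bar>LINT x|M. (\<Sum>i<N. w i * f i x)\<bar>"
    by (simp add: ennreal_leI)
  also have "\<dots> \<le> (\<integral>\<^sup>+x. ennreal \<bar>\<Sum>i<N. w i * f i x\<bar> \<partial>M)" by (rule ennreal_abs_integral_le)
  also have "\<dots> \<le> (\<integral>\<^sup>+x. ennreal (tnorm N (\<lambda>i. f i x)) \<partial>M)"
  proof (intro nn_integral_mono ennreal_leI)
    fix x
    have "\<bar>\<Sum>i<N. w i * f i x\<bar> \<le> tnorm N w * tnorm N (\<lambda>i. f i x)"
      using norm_weighted_sum_le_tnorm[of w "\<lambda>i. f i x" N] by simp
    also have "\<dots> \<le> tnorm N (\<lambda>i. f i x)" using w(1) tnorm_nonneg[of N "\<lambda>i. f i x"] by (simp add: mult_le_cancel_right1 not_less mult_left_le_one_le tnorm_nonneg)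
    finally show "\<bar>\<Sum>i<N. w i * f i x\<bar> \<le> tnorm N (\<lambda>i. f i x)" .
  qed
  finally show ?thesis .
qed

lemma integrable_inner_test_grad:
  assumes "test_function S \<psi>" "integrable lborel G"
  shows "integrable lborel (\<lambda>y. G y \<bullet> grad_x \<psi> y)"
  unfolding inner_vec_def grad_x_def
  using integrable_mult_test_function(2)[OF assms(1) integrable_vec_nth[OF assms(2)]] by simp

lemma weak_flux_sum:
  fixes u :: "nat \<Rightarrow> (real ^ 'n::finite) \<times> real \<Rightarrow> real"
  assumes wf: "\<And>i. i < N \<Longrightarrow> weak_flux Q\<^sub>1 (u i) (g i) (G i)"
  shows "weak_flux Q\<^sub>1 (\<lambda>y. \<Sum>i<N. w i * u i y) (\<lambda>y. \<Sum>i<N. w i *\<^sub>R g i y) (\<lambda>y. \<Sum>i<N. w i *\<^sub>R G i y)"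
  unfolding weak_flux_def
proof (intro conjI allI impI)
  have u: "integrable lborel (u i)" and g: "integrable lborel (g i)" and G: "integrable lborel (G i)" if "i < N" for i
    using wf[OF that] by (auto simp: weak_flux_def)
  show "integrable lborel (\<lambda>y. \<Sum>i<N. w i * u i y)" "integrable lborel (\<lambda>y. \<Sum>i<N. w i *\<^sub>R g i y)"
    "integrable lborel (\<lambda>y. \<Sum>i<N. w i *\<^sub>R G i y)"
    using u g G by auto
  fix \<psi> :: "(real ^ 'n) \<times> real \<Rightarrow> real" assume \<psi>: "test_function Q\<^sub>1 \<psi>"
  note int = integrable_mult_test_function[OF \<psi>]
  show "(LINT y|lborel. (\<Sum>i<N. w i * u i y) * deriv_t \<psi> y) = (LINT y|lborel. (\<Sum>i<N. w i *\<^sub>R G i y) \<bullet> grad_x \<psi> y)"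
  proof -
    have "(LINT y|lborel. (\<Sum>i<N. w i * u i y) * deriv_t \<psi> y) = (LINT y|lborel. (\<Sum>i<N. w i * (u i y * deriv_t \<psi> y)))"
      by (simp add: sum_distrib_right mult.assoc)
    also have "\<dots> = (\<Sum>i<N. w i * (LINT y|lborel. u i y * deriv_t \<psi> y))"
      using int(2)[OF u] by (simp add: deriv_t_def)
    also have "\<dots> = (\<Sum>i<N. w i * (LINT y|lborel. G i y \<bullet> grad_x \<psi> y))"
      using wf \<psi> by (intro sum.cong) (auto simp: weak_flux_def)
    also have "\<dots> = (LINT y|lborel. (\<Sum>i<N. w i * (G i y \<bullet> grad_x \<psi> y)))"
      using integrable_inner_test_grad[OF \<psi> G] by simp
    finally show ?thesis by (simp add: inner_sum_left)
  qed
  fix j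
  show "(LINT y|lborel. (\<Sum>i<N. w i * u i y) * grad_x \<psi> y $ j) = - (LINT y|lborel. (\<Sum>i<N. w i *\<^sub>R g i y) $ j * \<psi> y)"
  proof -
    have "(LINT y|lborel. (\<Sum>i<N. w i * u i y) * grad_x \<psi> y $ j) = (LINT y|lborel. (\<Sum>i<N. w i * (u i y * grad_x \<psi> y $ j)))"
      by (simp add: sum_distrib_right mult.assoc)
    also have "\<dots> = (\<Sum>i<N. w i * (LINT y|lborel. u i y * grad_x \<psi> y $ j))"
      using int(2)[OF u] by (simp add: grad_x_def)
    also have "\<dots> = (\<Sum>i<N. w i * (- (LINT y|lborel. g i y $ j * \<psi> y)))"
      using wf \<psi> by (intro sum.cong) (auto simp: weak_flux_def)
    also have "\<dots> = - (LINT y|lborel. (\<Sum>i<N. w i * (g i y $ j * \<psi> y)))"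
      using int(1)[OF integrable_vec_nth[OF g]] by (simp add: sum_negf)
    finally show ?thesis by (simp add: sum_distrib_right mult.assoc)
  qed
qed

context unit_bump
begin

abbreviation riesz :: "(real ^ 'n) \<times> real \<Rightarrow> (real ^ 'n) \<times> real \<Rightarrow> real" where
  "riesz z y \<equiv> pdist z y powr (- (real D - 1))"

text \<open>
  The scalar estimate for the combination \<open>\<Sum>\<^sub>i w\<^sub>i u\<^sub>i\<close>, where \<open>w\<close> realises the norm of the vector on
  the left-hand side.
\<close>

lemma vector_potential_estimate_smoothed:
  assumes wf: "\<And>i. i < N \<Longrightarrow> weak_flux Q\<^sub>1 (u i) (g i) (G i)" and z: "z \<in> Q\<^sub>1" and \<epsilon>: "0 < \<epsilon>" "\<epsilon> \<le> 1"
  shows "ennreal (tnorm N (\<lambda>i. smoothing \<epsilon> (u i) z - (LINT y|lborel. u i y * \<phi> y)))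
     \<le> ennreal (4 * M) * (\<integral>\<^sup>+y. ennreal (riesz z y * (tnorm N (\<lambda>i. g i y) + tnorm N (\<lambda>i. G i y))) \<partial>lborel)"
proof -
  have u: "integrable lborel (u i)" if "i < N" for i
    using wf[OF that] by (auto simp: weak_flux_def)
  have u\<phi>: "integrable lborel (\<lambda>y. u i y * \<phi> y)" if "i < N" for i
    by (rule integrable_mult_bounded[OF u[OF that] _ \<phi>_abs_le]) simp
  note uk = integrable_mult_kernel[OF u \<epsilon>(1)]
  define v where "v i = smoothing \<epsilon> (u i) z - (LINT y|lborel. u i y * \<phi> y)" for i
  obtain w where w: "tnorm N w \<le> 1" "tnorm N v = (\<Sum>i<N. w i * v i)"
    by (rule tnorm_dual)
  define u' where "u' y = (\<Sum>i<N. w i * u i y)" for y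
  define g' where "g' y = (\<Sum>i<N. w i *\<^sub>R g i y)" for y
  define G' where "G' y = (\<Sum>i<N. w i *\<^sub>R G i y)" for y
  have wf': "weak_flux Q\<^sub>1 u' g' G'"
    unfolding u'_def g'_def G'_def by (rule weak_flux_sum[OF wf])
  have "(\<Sum>i<N. w i * v i) = (LINT y|lborel. u' y * kernel z \<epsilon> y) - (LINT y|lborel. u' y * \<phi> y)"
  proof -
    have "(LINT y|lborel. u' y * kernel z \<epsilon> y) = (\<Sum>i<N. w i * smoothing \<epsilon> (u i) z)"
      unfolding u'_def smoothing_def sum_distrib_right mult.assoc using uk by simp
    moreover have "(LINT y|lborel. u' y * \<phi> y) = (\<Sum>i<N. w i * (LINT y|lborel. u i y * \<phi> y))"
      unfolding u'_def sum_distrib_right mult.assoc using u\<phi> by simp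
    ultimately show ?thesis by (simp add: v_def right_diff_distrib sum_subtractf)
  qed
  then have "ennreal (tnorm N v) \<le> ennreal \<bar>(LINT y|lborel. u' y * kernel z \<epsilon> y) - (LINT y|lborel. u' y * \<phi> y)\<bar>"
    using w by (intro ennreal_leI) simp
  also have "\<dots> \<le> ennreal (4 * M) * (\<integral>\<^sup>+y. ennreal (riesz z y * (norm (g' y) + norm (G' y))) \<partial>lborel)"
    by (rule potential_estimate_smoothed[OF wf' z \<epsilon>])
  also have "\<dots> \<le> ennreal (4 * M) * (\<integral>\<^sup>+y. ennreal (riesz z y * (tnorm N (\<lambda>i. g i y) + tnorm N (\<lambda>i. G i y))) \<partial>lborel)"
  proof (intro mult_left_mono nn_integral_mono ennreal_leI add_mono)
    fix y
    have *: "norm (\<Sum>i<N. w i *\<^sub>R f i) \<le> tnorm N f" for f :: "nat \<Rightarrow> real ^ 'n"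
      using norm_weighted_sum_le_tnorm[of w f N] mult_right_mono[OF w(1) tnorm_nonneg[of N f]] by simp
    show "norm (g' y) \<le> tnorm N (\<lambda>i. g i y)" "norm (G' y) \<le> tnorm N (\<lambda>i. G i y)"
      unfolding g'_def G'_def by (rule *)+
  qed auto
  finally show ?thesis by (simp add: v_def[abs_def])
qed

lemma vector_potential_estimate:
  assumes wf: "\<And>i. i < N \<Longrightarrow> weak_flux Q\<^sub>1 (u i) (g i) (G i)"
  shows "AE z in lborel. z \<in> Q\<^sub>1 \<longrightarrow> ennreal (tnorm N (\<lambda>i. u i z - (LINT y|lborel. u i y * \<phi> y)))
     \<le> ennreal (4 * M) * (\<integral>\<^sup>+y. ennreal (riesz z y * (tnorm N (\<lambda>i. g i y) + tnorm N (\<lambda>i. G i y))) \<partial>lborel)"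
proof -
  have u: "integrable lborel (u i)" if "i < N" for i
    using wf[OF that] by (auto simp: weak_flux_def)
  define \<epsilon> where "\<epsilon> k = inverse (real (Suc k))" for k
  have \<epsilon>: "0 < \<epsilon> k" "\<epsilon> k \<le> 1" for k by (auto simp: \<epsilon>_def field_simps)
  have \<epsilon>0: "\<epsilon> \<longlonglongrightarrow> 0" unfolding \<epsilon>_def by (rule LIMSEQ_inverse_real_of_nat)
  from smoothing_tendsto_AE_subseq[where N=N and u=u and \<epsilon>=\<epsilon>, OF u \<epsilon> \<epsilon>0]
  obtain r where "AE z in lborel. z \<in> Q\<^sub>1 \<longrightarrow> (\<forall>i<N. (\<lambda>k. smoothing (\<epsilon> (r k)) (u i) z) \<longlonglongrightarrow> u i z)"
    by blast
  then show ?thesis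
  proof eventually_elim
    case (elim z)
    show ?case
    proof
      assume z: "z \<in> Q\<^sub>1"
      have "(\<lambda>k. tnorm N (\<lambda>i. smoothing (\<epsilon> (r k)) (u i) z - (LINT y|lborel. u i y * \<phi> y)))
        \<longlonglongrightarrow> tnorm N (\<lambda>i. u i z - (LINT y|lborel. u i y * \<phi> y))"
        unfolding tnorm_def L2_set_def using elim z by (intro tendsto_intros) auto
      then have lim: "(\<lambda>k. ennreal (tnorm N (\<lambda>i. smoothing (\<epsilon> (r k)) (u i) z - (LINT y|lborel. u i y * \<phi> y))))
        \<longlonglongrightarrow> ennreal (tnorm N (\<lambda>i. u i z - (LINT y|lborel. u i y * \<phi> y)))"
        by (rule tendsto_ennrealI)
      show "ennreal (tnorm N (\<lambda>i. u i z - (LINT y|lborel. u i y * \<phi> y)))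
         \<le> ennreal (4 * M) * (\<integral>\<^sup>+y. ennreal (riesz z y * (tnorm N (\<lambda>i. g i y) + tnorm N (\<lambda>i. G i y))) \<partial>lborel)"
        by (rule LIMSEQ_le_const2[OF lim], intro exI allI impI)
          (rule vector_potential_estimate_smoothed[OF wf z \<epsilon>])
    qed
  qed
qed

end

text \<open>
  Mean values over the unit cylinder are integrals with respect to this probability measure.
\<close>

definition P\<^sub>1 :: "((real ^ 'n::finite) \<times> real) measure" where
  "P\<^sub>1 = uniform_measure lborel Q\<^sub>1"

lemma emeasure_Q1_not: "emeasure lborel (Q\<^sub>1 :: ((real ^ 'n::finite) \<times> real) set) \<noteq> 0"
  "emeasure lborel (Q\<^sub>1 :: ((real ^ 'n::finite) \<times> real) set) \<noteq> \<infinity>"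
  using unit_ball_vol_pos[of "CARD('n)"] by (auto simp: emeasure_Q1 ennreal_eq_0_iff not_le)

lemma prob_space_P1: "prob_space P\<^sub>1"
  unfolding P\<^sub>1_def using emeasure_Q1_not by (intro prob_space_uniform_measure) auto

lemma sets_P1 [measurable_cong, simp]: "sets P\<^sub>1 = sets borel"
  by (simp add: P\<^sub>1_def)

lemma space_P1 [simp]: "space P\<^sub>1 = UNIV"
  by (simp add: P\<^sub>1_def)

lemma nn_integral_P1:
  "f \<in> borel_measurable borel \<Longrightarrow> (\<integral>\<^sup>+y. f y \<partial>P\<^sub>1) = (\<integral>\<^sup>+y. f y * indicator Q\<^sub>1 y \<partial>lborel) / ennreal (2 * unit_ball_vol CARD('n))"
  for f :: "(real ^ 'n::finite) \<times> real \<Rightarrow> ennreal"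
  unfolding P\<^sub>1_def by (subst nn_integral_uniform_measure) (auto simp: emeasure_Q1)

lemma AE_P1: "(AE y in P\<^sub>1. P y) \<longleftrightarrow> (AE y in lborel. y \<in> Q\<^sub>1 \<longrightarrow> P y)"
  unfolding P\<^sub>1_def using emeasure_Q1_not by (intro AE_uniform_measure) (auto simp: less_top)

lemma AE_P1_Q1: "AE y in P\<^sub>1. y \<in> Q\<^sub>1"
  by (simp add: AE_P1)

lemma nn_integral_lborel_eq_P1:
  fixes f :: "(real ^ 'n::finite) \<times> real \<Rightarrow> ennreal"
  assumes [measurable]: "f \<in> borel_measurable borel" and "\<And>y. y \<notin> Q\<^sub>1 \<Longrightarrow> f y = 0"
  shows "(\<integral>\<^sup>+y. f y \<partial>lborel) = ennreal (2 * unit_ball_vol CARD('n)) * (\<integral>\<^sup>+y. f y \<partial>P\<^sub>1)"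
proof -
  have "(\<integral>\<^sup>+y. f y * indicator Q\<^sub>1 y \<partial>lborel) = (\<integral>\<^sup>+y. f y \<partial>lborel)"
    using assms(2) by (intro nn_integral_cong) (auto simp: indicator_def)
  moreover have "ennreal (2 * unit_ball_vol CARD('n)) \<noteq> 0"
    using unit_ball_vol_pos[of "CARD('n)"] by (simp add: ennreal_eq_0_iff not_le)
  ultimately show ?thesis
    by (subst nn_integral_P1)
      (simp_all add: ennreal_times_divide ennreal_mult_divide_eq mult.commute[of "ennreal (2 * unit_ball_vol CARD('n))"])
qed

lemma integrable_P1:
  fixes f :: "(real ^ 'n::finite) \<times> real \<Rightarrow> real"
  assumes "integrable lborel f"
  shows "integrable P\<^sub>1 f"
proof (rule integrableI_bounded)
  have [measurable]: "f \<in> borel_measurable borel" using assms by (auto dest!: borel_measurable_integrable)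
  then show "f \<in> borel_measurable P\<^sub>1" by simp
  have "(\<integral>\<^sup>+y. ennreal (norm (f y)) * indicator Q\<^sub>1 y \<partial>lborel) \<le> (\<integral>\<^sup>+y. ennreal (norm (f y)) \<partial>lborel)"
    by (intro nn_integral_mono) (auto simp: indicator_def)
  also have "\<dots> < \<infinity>" using assms by (simp add: integrable_iff_bounded)
  finally show "(\<integral>\<^sup>+y. ennreal (norm (f y)) \<partial>P\<^sub>1) < \<infinity>"
    using unit_ball_vol_pos[of "CARD('n)"] by (subst nn_integral_P1) (auto simp: divide_ennreal_def ennreal_mult_less_top inverse_ennreal)
qed

lemma nn_integral_pdist_powr_P1:
  fixes z :: "(real ^ 'n::finite) \<times> real"
  assumes z: "z \<in> Q\<^sub>1" and a: "0 < a" "a < real CARD('n) + 2"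
  shows "(\<integral>\<^sup>+y. ennreal (pdist z y powr (- a)) \<partial>P\<^sub>1)
     \<le> ennreal (1 + a * 2 ^ (CARD('n) + 1) / (real CARD('n) + 2 - a))"
proof -
  define \<omega> where "\<omega> = unit_ball_vol CARD('n)"
  have \<omega>: "0 < \<omega>" using unit_ball_vol_pos[of "CARD('n)"] by (simp add: \<omega>_def)
  have "(\<integral>\<^sup>+y. ennreal (pdist z y powr (- a)) \<partial>P\<^sub>1) \<le> ennreal (\<omega> * (2 + a * 2 ^ (CARD('n) + 2) / (real CARD('n) + 2 - a))) / ennreal (2 * \<omega>)"
    unfolding \<omega>_def by (subst nn_integral_P1, simp, intro divide_right_mono_ennreal nn_integral_pdist_powr z a)
  also have "\<dots> = ennreal (\<omega> * (2 + a * 2 ^ (CARD('n) + 2) / (real CARD('n) + 2 - a)) / (2 * \<omega>))"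
    using \<omega> a by (intro divide_ennreal) auto
  also have "\<omega> * (2 + a * 2 ^ (CARD('n) + 2) / (real CARD('n) + 2 - a)) / (2 * \<omega>) = 1 + a * 2 ^ (CARD('n) + 1) / (real CARD('n) + 2 - a)"
    using \<omega> by (simp add: field_simps)
  finally show ?thesis .
qed

section \<open>Deviation from the mean and moments of the potential\<close>

abbreviation riesz_kernel :: "(real ^ 'n::finite) \<times> real \<Rightarrow> (real ^ 'n) \<times> real \<Rightarrow> real" where
  "riesz_kernel z y \<equiv> pdist z y powr (- (real CARD('n) + 1))"

lemma pdist_measurable_P1 [measurable]:
  "(\<lambda>(z, y). pdist z y) \<in> borel_measurable (P\<^sub>1 \<Otimes>\<^sub>M P\<^sub>1)"
  unfolding pdist_def by measurable

text \<open>
  The potential estimate with the mean value in the place of the weighted average.  The second integral on the right-hand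
  side is the price for this change.  The first argument carries the dimension in its type.
\<close>

definition deviation_constant :: "'n::finite itself \<Rightarrow> real \<Rightarrow> bool" where
  "deviation_constant n C \<longleftrightarrow> (\<forall>N (u :: nat \<Rightarrow> (real ^ 'n) \<times> real \<Rightarrow> real) g G.
     (\<forall>i<N. weak_flux Q\<^sub>1 (u i) (g i) (G i)) \<and> (\<forall>i<N. \<forall>y. y \<notin> Q\<^sub>1 \<longrightarrow> g i y = 0 \<and> G i y = 0) \<longrightarrow>
     (AE z in P\<^sub>1. ennreal (tnorm N (\<lambda>i. u i z - (LINT y|P\<^sub>1. u i y)))
        \<le> ennreal C * ((\<integral>\<^sup>+y. ennreal (riesz_kernel z y * (tnorm N (\<lambda>i. g i y) + tnorm N (\<lambda>i. G i y))) \<partial>P\<^sub>1)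
            + (\<integral>\<^sup>+y. ennreal (tnorm N (\<lambda>i. g i y) + tnorm N (\<lambda>i. G i y)) \<partial>P\<^sub>1))))"

text \<open>
  The difference between the mean value \<open>m\<close> and the weighted average \<open>c\<close> is at most the mean of
  \<open>|u - c|\<close>, hence at most the mean of the potential; the kernel is integrable in its first argument.
\<close>

lemma ex_deviation_constant: "\<exists>C>0. deviation_constant TYPE('n::finite) C"
proof -
  obtain \<phi> :: "(real ^ 'n) \<times> real \<Rightarrow> real" and M where ub: "unit_bump \<phi> M" using ex_unit_bump by blast
  interpret unit_bump \<phi> M "CARD('n) + 2" by (rule ub)
  interpret P: prob_space "P\<^sub>1 :: ((real ^ 'n) \<times> real) measure" by (rule prob_space_P1)
  interpret PP: pair_sigma_finite "P\<^sub>1 :: ((real ^ 'n) \<times> real) measure" "P\<^sub>1 :: ((real ^ 'n) \<times> real) measure" by standard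
  define C1 where "C1 = 4 * M * (2 * unit_ball_vol CARD('n))"
  define B1 where "B1 = 1 + (real CARD('n) + 1) * 2 ^ (CARD('n) + 1)"
  have C1: "0 \<le> C1" using M_nonneg by (simp add: C1_def)
  have B1: "0 \<le> B1" by (simp add: B1_def)
  have C: "0 < C1 * (1 + B1) + 1" using C1 B1 by (simp add: add_nonneg_pos)
  show ?thesis
    unfolding deviation_constant_def
  proof (rule exI[of _ "C1 * (1 + B1) + 1"], intro conjI C allI impI, elim conjE)
    fix N and u :: "nat \<Rightarrow> (real ^ 'n) \<times> real \<Rightarrow> real" and g G
    assume wf: "\<forall>i<N. weak_flux Q\<^sub>1 (u i) (g i) (G i)" and out: "\<forall>i<N. \<forall>y. y \<notin> Q\<^sub>1 \<longrightarrow> g i y = 0 \<and> G i y = 0"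
    have int: "integrable lborel (u i)" "integrable lborel (g i)" "integrable lborel (G i)" if "i < N" for i
      using wf that by (auto simp: weak_flux_def)
    define h where "h y = tnorm N (\<lambda>i. g i y) + tnorm N (\<lambda>i. G i y)" for y
    have h0: "0 \<le> h y" for y by (simp add: h_def tnorm_nonneg)
    have [measurable]: "u i \<in> borel_measurable borel" "g i \<in> borel_measurable borel" "G i \<in> borel_measurable borel" if "i < N" for i
      using int[OF that] by (auto dest!: borel_measurable_integrable)
    have h_meas [measurable]: "h \<in> borel_measurable borel"
      unfolding h_def by (intro borel_measurable_add tnorm_measurable) measurable
    have h_out: "h y = 0" if "y \<notin> Q\<^sub>1" for y
    proof -
      have "\<forall>i<N. g i y = 0 \<and> G i y = 0" using out that by blast
      then show ?thesis by (simp add: h_def tnorm_def L2_set_def)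
    qed
    define V where "V z = (\<integral>\<^sup>+y. ennreal (riesz_kernel z y * h y) \<partial>P\<^sub>1)" for z
    have V_meas [measurable]: "V \<in> borel_measurable borel"
    proof -
      have "V \<in> borel_measurable P\<^sub>1" unfolding V_def by measurable
      then show ?thesis by simp
    qed
    define c where "c i = (LINT y|lborel. u i y * \<phi> y)" for i
    define m where "m i = (LINT y|P\<^sub>1. u i y)" for i
    have dev_c: "AE z in P\<^sub>1. ennreal (tnorm N (\<lambda>i. u i z - c i)) \<le> ennreal C1 * V z"
    proof -
      have lborel: "(\<integral>\<^sup>+y. ennreal (riesz_kernel z y * h y) \<partial>lborel) = ennreal (2 * unit_ball_vol CARD('n)) * V z" for z
        unfolding V_def by (rule nn_integral_lborel_eq_P1) (auto simp: h_out)
      have "ennreal (4 * M) * (\<integral>\<^sup>+y. ennreal (riesz_kernel z y * h y) \<partial>lborel) = ennreal C1 * V z" for z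
      proof -
        have "ennreal C1 = ennreal (4 * M) * ennreal (2 * unit_ball_vol CARD('n))"
          unfolding C1_def using M_nonneg by (intro ennreal_mult) auto
        then show ?thesis by (simp only: lborel mult.assoc)
      qed
      then show ?thesis
        using vector_potential_estimate[of N u g G] wf
        by (simp add: AE_P1 c_def h_def add.commute)
    qed
    have "ennreal (tnorm N (\<lambda>i. m i - c i)) = ennreal (tnorm N (\<lambda>i. LINT z|P\<^sub>1. u i z - c i))"
    proof -
      have "m i - c i = (LINT z|P\<^sub>1. u i z - c i)" if "i < N" for i
        using integrable_P1[OF int(1)[OF that]] by (simp add: m_def P.prob_space[unfolded space_P1])
      then have "tnorm N (\<lambda>i. m i - c i) = tnorm N (\<lambda>i. LINT z|P\<^sub>1. u i z - c i)"
        unfolding tnorm_def by (intro L2_set_cong) auto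
      then show ?thesis by simp
    qed
    also have "\<dots> \<le> (\<integral>\<^sup>+z. ennreal (tnorm N (\<lambda>i. u i z - c i)) \<partial>P\<^sub>1)"
      by (intro tnorm_integral_le Bochner_Integration.integrable_diff integrable_P1 int(1) P.integrable_const)
    also have "\<dots> \<le> (\<integral>\<^sup>+z. ennreal C1 * V z \<partial>P\<^sub>1)" by (rule nn_integral_mono_AE[OF dev_c])
    also have "\<dots> = ennreal C1 * (\<integral>\<^sup>+z. V z \<partial>P\<^sub>1)" by (rule nn_integral_cmult) simp
    also have "(\<integral>\<^sup>+z. V z \<partial>P\<^sub>1) = (\<integral>\<^sup>+y. \<integral>\<^sup>+z. ennreal (riesz_kernel z y * h y) \<partial>P\<^sub>1 \<partial>P\<^sub>1)"
      unfolding V_def by (rule PP.Fubini'[symmetric]) measurable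
    also have "\<dots> = (\<integral>\<^sup>+y. ennreal (h y) * (\<integral>\<^sup>+z. ennreal (pdist y z powr (- (real CARD('n) + 1))) \<partial>P\<^sub>1) \<partial>P\<^sub>1)"
      by (intro nn_integral_cong, subst nn_integral_cmult[symmetric], simp)
        (simp add: ennreal_mult' pdist_commute mult.commute h0)
    also have "\<dots> \<le> (\<integral>\<^sup>+y. ennreal (h y) * ennreal B1 \<partial>P\<^sub>1)"
    proof (rule nn_integral_mono_AE)
      show "AE y in P\<^sub>1. ennreal (h y) * (\<integral>\<^sup>+z. ennreal (pdist y z powr (- (real CARD('n) + 1))) \<partial>P\<^sub>1) \<le> ennreal (h y) * ennreal B1"
        using AE_P1_Q1
      proof eventually_elim
        case (elim y)
        then show ?case
          using nn_integral_pdist_powr_P1[OF elim, of "real CARD('n) + 1"]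
          by (intro mult_left_mono) (auto simp: B1_def)
      qed
    qed
    also have "\<dots> = ennreal B1 * (\<integral>\<^sup>+y. ennreal (h y) \<partial>P\<^sub>1)"
      by (subst nn_integral_multc) (auto simp: mult.commute)
    finally have mc: "ennreal (tnorm N (\<lambda>i. m i - c i)) \<le> ennreal C1 * (ennreal B1 * (\<integral>\<^sup>+y. ennreal (h y) \<partial>P\<^sub>1))"
      by (simp add: mult_left_mono)
    have "AE z in P\<^sub>1. ennreal (tnorm N (\<lambda>i. u i z - m i)) \<le> ennreal (C1 * (1 + B1) + 1) * (V z + (\<integral>\<^sup>+y. ennreal (h y) \<partial>P\<^sub>1))"
      using dev_c
    proof eventually_elim
      case (elim z)
      have "tnorm N (\<lambda>i. u i z - m i) \<le> tnorm N (\<lambda>i. u i z - c i) + tnorm N (\<lambda>i. m i - c i)"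
        using tnorm_triangle[of N "\<lambda>i. u i z - c i" "\<lambda>i. c i - m i"] 
        by (simp add: tnorm_def L2_set_def power2_commute[of "c _" "m _"])
      then have "ennreal (tnorm N (\<lambda>i. u i z - m i)) \<le> ennreal (tnorm N (\<lambda>i. u i z - c i)) + ennreal (tnorm N (\<lambda>i. m i - c i))"
        by (simp add: tnorm_nonneg flip: ennreal_plus)
      also have "\<dots> \<le> ennreal C1 * V z + ennreal C1 * (ennreal B1 * (\<integral>\<^sup>+y. ennreal (h y) \<partial>P\<^sub>1))"
        by (intro add_mono elim mc)
      also have "\<dots> = ennreal C1 * V z + ennreal (C1 * B1) * (\<integral>\<^sup>+y. ennreal (h y) \<partial>P\<^sub>1)"
        using C1 B1 by (simp add: ennreal_mult mult.assoc)
      also have "\<dots> \<le> ennreal (C1 * (1 + B1) + 1) * V z + ennreal (C1 * (1 + B1) + 1) * (\<integral>\<^sup>+y. ennreal (h y) \<partial>P\<^sub>1)"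
        using C1 B1 by (intro add_mono mult_right_mono ennreal_leI) (auto simp: algebra_simps)
      finally show ?case by (simp add: distrib_left)
    qed
    then show "AE z in P\<^sub>1. ennreal (tnorm N (\<lambda>i. u i z - (LINT y|P\<^sub>1. u i y)))
        \<le> ennreal (C1 * (1 + B1) + 1) * ((\<integral>\<^sup>+y. ennreal (riesz_kernel z y * (tnorm N (\<lambda>i. g i y) + tnorm N (\<lambda>i. G i y))) \<partial>P\<^sub>1)
            + (\<integral>\<^sup>+y. ennreal (tnorm N (\<lambda>i. g i y) + tnorm N (\<lambda>i. G i y)) \<partial>P\<^sub>1))"
      by (simp add: V_def m_def h_def)
  qed
qed

lemma nn_integral_le_of_powr:
  fixes h :: "'a \<Rightarrow> real"
  assumes "prob_space M" and [measurable]: "h \<in> borel_measurable M" and h: "\<And>y. 0 \<le> h y"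
    and q: "1 \<le> q" and H: "0 < H" and data: "(\<integral>\<^sup>+y. ennreal (h y powr q) \<partial>M) \<le> ennreal (H powr q)"
  shows "(\<integral>\<^sup>+y. ennreal (h y) \<partial>M) \<le> ennreal H"
proof -
  interpret prob_space M by fact
  define a where "a = 1 / q"
  have a: "0 \<le> a" "a \<le> 1" using q by (auto simp: a_def)
  have pw: "h y \<le> a * H / H powr q * h y powr q + (1 - a) * H" for y
  proof (cases "h y = 0")
    case True
    then show ?thesis using a H by simp
  next
    case False
    then have hy: "0 < h y" using h[of y] by simp
    have "(h y powr q / H powr q) powr a * 1 powr (1 - a) * 1 powr 0 \<le> a * (h y powr q / H powr q) + (1 - a) * 1 + 0 * 1"
      using a hy H by (intro weighted_arith_geo_mean3) auto
    moreover have "(h y powr q / H powr q) powr a = h y / H"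
      using hy H q by (simp add: powr_divide powr_powr a_def)
    ultimately have "h y / H \<le> a * (h y powr q / H powr q) + (1 - a)" by simp
    then have "h y / H * H \<le> (a * (h y powr q / H powr q) + (1 - a)) * H"
      using H by (intro mult_right_mono) auto
    then show ?thesis using H by (simp add: algebra_simps)
  qed
  have "(\<integral>\<^sup>+y. ennreal (h y) \<partial>M) \<le> (\<integral>\<^sup>+y. ennreal (a * H / H powr q) * ennreal (h y powr q) + ennreal ((1 - a) * H) \<partial>M)"
    using pw a H by (intro nn_integral_mono) (simp flip: ennreal_mult ennreal_plus add: ennreal_leI)
  also have "\<dots> = ennreal (a * H / H powr q) * (\<integral>\<^sup>+y. ennreal (h y powr q) \<partial>M) + ennreal ((1 - a) * H)"
    by (simp add: nn_integral_add nn_integral_cmult emeasure_space_1)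
  also have "\<dots> \<le> ennreal (a * H / H powr q) * ennreal (H powr q) + ennreal ((1 - a) * H)"
    by (intro add_mono mult_left_mono data) auto
  also have "\<dots> = ennreal (a * H / H powr q * H powr q + (1 - a) * H)"
    using a H by (simp flip: ennreal_mult ennreal_plus)
  also have "a * H / H powr q * H powr q + (1 - a) * H = H"
    using H by (simp add: algebra_simps)
  finally show ?thesis .
qed

definition potential :: "((real ^ 'n::finite) \<times> real \<Rightarrow> real) \<Rightarrow> (real ^ 'n) \<times> real \<Rightarrow> real" where
  "potential h z = enn2real (\<integral>\<^sup>+y. ennreal (riesz_kernel z y * h y) \<partial>P\<^sub>1)"

lemma riesz_powr: "(x powr (- c - 1)) powr r = x powr (- ((c + 1) * r :: real))"
proof -
  have "(- c - 1) * r = - ((c + 1) * r)" by (simp add: algebra_simps)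
  then show ?thesis by (simp only: powr_powr)
qed

context
  fixes h :: "(real ^ 'n::finite) \<times> real \<Rightarrow> real" and q H :: real
  assumes h_meas [measurable]: "h \<in> borel_measurable borel" and h_nonneg: "\<And>y. 0 \<le> h y"
    and q: "1 \<le> q" and H: "0 < H" and data: "(\<integral>\<^sup>+y. ennreal (h y powr q) \<partial>P\<^sub>1) \<le> ennreal (H powr q)"
begin

text \<open>
  Young's inequality with the exponent \<open>1/r = 1 + 1/p - 1/q\<close>.  The power \<open>r\<close> of the Riesz kernel is
  \<open>d\<^sup>-\<^sup>a\<close> with \<open>a = (D - 1) r\<close>, so everything depends on \<open>a < D\<close>.
\<close>

lemma potential_moment:
  assumes p: "q \<le> p" and r: "r * (1 + 1 / p - 1 / q) = 1" and a: "a = (real CARD('n) + 1) * r" "a < real CARD('n) + 2"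
    and B: "B = 1 + a * 2 ^ (CARD('n) + 1) / (real CARD('n) + 2 - a)"
  shows "AE z in P\<^sub>1. (\<integral>\<^sup>+y. ennreal (riesz_kernel z y * h y) \<partial>P\<^sub>1) < \<infinity>"
    "(\<integral>\<^sup>+z. ennreal (potential h z powr p) \<partial>P\<^sub>1) \<le> ennreal (B powr (p / r) * H powr p)"
proof -
  interpret P: prob_space "P\<^sub>1 :: ((real ^ 'n) \<times> real) measure" by (rule prob_space_P1)
  have "1 / q \<le> 1" using q by simp
  moreover have "0 < 1 / p" using p q by simp
  ultimately have "0 < 1 + 1 / p - 1 / q" by linarith
  then have "0 < r" using r by (metis zero_less_mult_pos2 zero_less_one)
  then have a0: "0 < a" by (simp add: a)
  have B0: "0 < B" unfolding B using a a0 by (intro add_pos_nonneg divide_nonneg_nonneg) auto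
  \<comment> \<open>Young's inequality asks for a bound at every point, and the kernel is integrated over the cylinder only for points inside it.\<close>
  define K :: "(real ^ 'n) \<times> real \<Rightarrow> (real ^ 'n) \<times> real \<Rightarrow> real"
    where "K z y = (if z \<in> Q\<^sub>1 \<and> y \<in> Q\<^sub>1 then riesz_kernel z y else 0)" for z y
  have K_meas: "(\<lambda>(z, y). K z y) \<in> borel_measurable (P\<^sub>1 \<Otimes>\<^sub>M P\<^sub>1)"
    unfolding K_def by measurable
  have K_sym: "K z y = K y z" for z y by (simp add: K_def pdist_commute)
  have kernel: "(\<integral>\<^sup>+y. ennreal (K z y powr r) \<partial>P\<^sub>1) \<le> ennreal B" for z
  proof (cases "z \<in> Q\<^sub>1")
    case True
    have "(\<integral>\<^sup>+y. ennreal (K z y powr r) \<partial>P\<^sub>1) \<le> (\<integral>\<^sup>+y. ennreal (pdist z y powr (- a)) \<partial>P\<^sub>1)"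
      using True by (intro nn_integral_mono ennreal_leI) (auto simp: K_def riesz_powr a)
    also have "\<dots> \<le> ennreal B"
      unfolding B by (rule nn_integral_pdist_powr_P1[OF True a0 a(2)])
    finally show ?thesis .
  qed (simp add: K_def)
  have eq: "(\<integral>\<^sup>+y. ennreal (K z y * h y) \<partial>P\<^sub>1) = (\<integral>\<^sup>+y. ennreal (riesz_kernel z y * h y) \<partial>P\<^sub>1)" if "z \<in> Q\<^sub>1" for z
    using AE_P1_Q1 by (intro nn_integral_cong_AE, eventually_elim) (use that in \<open>auto simp: K_def\<close>)
  have kernel2: "(\<integral>\<^sup>+z. ennreal (K z y powr r) \<partial>P\<^sub>1) \<le> ennreal B" for y
    using kernel[of y] by (simp add: K_sym[of _ y])
  note Y = Young_kernel_inequality[where M="P\<^sub>1" and K=K and h=h and p=p and q=q and r=r and B=B and H=H,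
      OF P.sigma_finite_measure_axioms K_meas _ _ _ B0 H q p r kernel kernel2 data]
  have "AE z in P\<^sub>1. (\<integral>\<^sup>+y. ennreal (K z y * h y) \<partial>P\<^sub>1) < \<infinity>"
    by (rule Y(1)) (auto simp: K_def h_nonneg)
  then show "AE z in P\<^sub>1. (\<integral>\<^sup>+y. ennreal (riesz_kernel z y * h y) \<partial>P\<^sub>1) < \<infinity>"
    using AE_P1_Q1 by eventually_elim (simp only: eq)
  have "(\<integral>\<^sup>+z. ennreal (potential h z powr p) \<partial>P\<^sub>1) = (\<integral>\<^sup>+z. ennreal (enn2real (\<integral>\<^sup>+y. ennreal (K z y * h y) \<partial>P\<^sub>1) powr p) \<partial>P\<^sub>1)"
    using AE_P1_Q1 by (intro nn_integral_cong_AE, eventually_elim) (auto simp: potential_def eq)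
  also have "\<dots> \<le> ennreal (B powr (p / r) * H powr p)"
    by (rule Y(2)) (auto simp: K_def h_nonneg)
  finally show "(\<integral>\<^sup>+z. ennreal (potential h z powr p) \<partial>P\<^sub>1) \<le> ennreal (B powr (p / r) * H powr p)" .
qed

text \<open>
  Here \<open>r\<close> is the dual exponent of \<open>q\<close>, and \<open>(D - 1) r < D\<close> holds precisely because \<open>q > D\<close>.
\<close>

lemma potential_bounded:
  assumes qD: "real CARD('n) + 2 < q" and r: "r * (1 - 1 / q) = 1" and a: "a = (real CARD('n) + 1) * r"
    and B: "B = 1 + a * 2 ^ (CARD('n) + 1) / (real CARD('n) + 2 - a)" and z: "z \<in> Q\<^sub>1"
  shows "(\<integral>\<^sup>+y. ennreal (riesz_kernel z y * h y) \<partial>P\<^sub>1) \<le> ennreal (B powr (1 - 1 / q) * H)"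
proof -
  have "1 / q < 1" using q qD by simp
  then have r_eq: "r = q / (q - 1)" using r q qD by (simp add: field_simps)
  have a0: "0 < a" using q qD by (simp add: a r_eq)
  have aD: "a < real CARD('n) + 2" using qD by (simp add: a r_eq field_simps)
  have B0: "0 < B" unfolding B using aD a0 by (intro add_pos_nonneg divide_nonneg_nonneg) auto
  have "(\<integral>\<^sup>+y. ennreal (riesz_kernel z y * h y) \<partial>P\<^sub>1) \<le> ennreal (1 powr 0 * B powr (1 - 1 / q) * H powr (1 - 0 * q))"
  proof (rule Young_kernel_pointwise[where r=r])
    show "(\<integral>\<^sup>+y. ennreal (riesz_kernel z y powr r) \<partial>P\<^sub>1) \<le> ennreal B"
      using nn_integral_pdist_powr_P1[OF z a0 aD] by (simp add: riesz_powr a B)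
  qed (use h_nonneg B0 H q r data in \<open>auto simp: pdist_measurable\<close>)
  then show ?thesis using H by simp
qed

end

section \<open>The three estimates on the unit cylinder\<close>

text \<open>
  The situation on the unit cylinder after scaling: \<open>f\<close> plays the role of the deviation, \<open>h\<close> that of
  \<open>|\<nabla>u| + |G|\<close>, and \<open>H\<close> is a bound for the \<open>L\<^sup>q\<close> mean of \<open>h\<close>.  It is positive, and a vanishing mean is
  approached from above.
\<close>

definition potential_dominated :: "real \<Rightarrow> real \<Rightarrow> ((real ^ 'n::finite) \<times> real \<Rightarrow> real) \<Rightarrow> ((real ^ 'n) \<times> real \<Rightarrow> real) \<Rightarrow> real \<Rightarrow> bool" where
  "potential_dominated C q f h H \<longleftrightarrow> f \<in> borel_measurable borel \<and> (\<forall>z. 0 \<le> f z) \<and>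
     h \<in> borel_measurable borel \<and> (\<forall>y. 0 \<le> h y) \<and> 0 < H \<and>
     (\<integral>\<^sup>+y. ennreal (h y powr q) \<partial>P\<^sub>1) \<le> ennreal (H powr q) \<and>
     (AE z in P\<^sub>1. ennreal (f z) \<le> ennreal C * ((\<integral>\<^sup>+y. ennreal (riesz_kernel z y * h y) \<partial>P\<^sub>1) + (\<integral>\<^sup>+y. ennreal (h y) \<partial>P\<^sub>1)))"

lemma potential_dominated_pointwise:
  assumes pd: "potential_dominated C q f h H" and q: "1 \<le> q" and C: "0 < C"
    and fin: "AE z in P\<^sub>1. (\<integral>\<^sup>+y. ennreal (riesz_kernel z y * h y) \<partial>P\<^sub>1) < \<infinity>"
  shows "AE z in P\<^sub>1. f z \<le> C * (potential h z + H)"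
proof -
  have H: "0 < H" and mean: "(\<integral>\<^sup>+y. ennreal (h y) \<partial>P\<^sub>1) \<le> ennreal H"
    using pd q nn_integral_le_of_powr[OF prob_space_P1, of h q H] by (auto simp: potential_dominated_def)
  have dom: "AE z in P\<^sub>1. ennreal (f z) \<le> ennreal C * ((\<integral>\<^sup>+y. ennreal (riesz_kernel z y * h y) \<partial>P\<^sub>1) + (\<integral>\<^sup>+y. ennreal (h y) \<partial>P\<^sub>1))"
    using pd by (simp add: potential_dominated_def)
  show ?thesis
    using dom fin
  proof eventually_elim
    case (elim z)
    have V: "(\<integral>\<^sup>+y. ennreal (riesz_kernel z y * h y) \<partial>P\<^sub>1) = ennreal (potential h z)"
      using elim(2) by (simp add: potential_def less_top)
    have P0: "0 \<le> potential h z" by (simp add: potential_def)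
    have "ennreal (f z) \<le> ennreal C * (ennreal (potential h z) + ennreal H)"
      using elim(1) mean unfolding V by (meson add_left_mono mult_left_mono order_trans zero_le)
    also have "\<dots> = ennreal (C * (potential h z + H))"
      using C H P0 by (simp flip: ennreal_mult ennreal_plus)
    finally show ?case using C H P0 by (subst (asm) ennreal_le_iff) auto
  qed
qed

lemma powr_add_le: "(x + y) powr p \<le> 2 powr p * (x powr p + y powr p)"
  if "0 \<le> x" "0 \<le> y" "0 \<le> p" for x y p :: real
proof -
  have "(x + y) powr p \<le> (2 * max x y) powr p" using that by (intro powr_mono2) auto
  also have "\<dots> = 2 powr p * (max x y) powr p" using that by (simp add: powr_mult)
  also have "\<dots> \<le> 2 powr p * (x powr p + y powr p)"
    by (intro mult_left_mono) (auto simp: max_def)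
  finally show ?thesis .
qed

lemma potential_measurable [measurable]:
  fixes h :: "(real ^ 'n::finite) \<times> real \<Rightarrow> real"
  assumes [measurable]: "h \<in> borel_measurable borel"
  shows "potential h \<in> borel_measurable borel"
proof -
  interpret P: prob_space "P\<^sub>1 :: ((real ^ 'n) \<times> real) measure" by (rule prob_space_P1)
  have "(\<lambda>z. enn2real (\<integral>\<^sup>+y. ennreal (riesz_kernel z y * h y) \<partial>P\<^sub>1)) \<in> borel_measurable (P\<^sub>1 :: ((real ^ 'n) \<times> real) measure)"
    by measurable
  then show ?thesis by (simp add: potential_def[abs_def])
qed

text \<open>
  The restriction on \<open>p\<close> says \<open>1/q - 1/p < 1/D\<close>, which is equivalent to \<open>(D - 1) r < D\<close> for the exponent \<open>r\<close>
  of Young's inequality.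
\<close>

lemma unit_subcritical:
  fixes C q p :: real
  assumes C: "0 < C" and q: "1 \<le> q" "q < real CARD('n::finite) + 2" "q \<le> p"
    and p: "p < q * (real CARD('n) + 2) / (real CARD('n) + 2 - q)"
  shows "\<exists>c>0. \<forall>f h H. potential_dominated C q (f :: (real ^ 'n) \<times> real \<Rightarrow> real) h H \<longrightarrow>
      (\<integral>\<^sup>+z. ennreal (f z powr p) \<partial>P\<^sub>1) \<le> ennreal ((c * H) powr p)"
proof -
  define D where "D = real CARD('n) + 2"
  have p0: "0 < p" using q by simp
  have D: "2 < D" by (simp add: D_def)
  have sub: "1 / q - 1 / p < 1 / D"
  proof -
    have "p * (D - q) < q * D" using p q D by (simp add: D_def pos_less_divide_eq)
    then have "p * D - q * D < p * q" by (simp add: algebra_simps)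
    then show ?thesis using q p0 D by (simp add: field_simps)
  qed
  define \<theta> where "\<theta> = 1 + 1 / p - 1 / q"
  have "1 / D < 1" using D by simp
  moreover have "(D - 1) / D = 1 - 1 / D" using D by (simp add: diff_divide_distrib)
  ultimately have \<theta>: "0 < \<theta>" "(D - 1) / D < \<theta>" using sub unfolding \<theta>_def by linarith+
  define r where "r = 1 / \<theta>"
  have r: "r * (1 + 1 / p - 1 / q) = 1" "0 < r" using \<theta> by (auto simp: r_def \<theta>_def[symmetric])
  define a where "a = (real CARD('n) + 1) * r"
  have aD: "a < real CARD('n) + 2"
  proof -
    have "(D - 1) < \<theta> * D" using \<theta> D by (simp add: pos_divide_less_eq)
    then have "(D - 1) * r < D" using \<theta> by (simp add: r_def pos_divide_less_eq mult.commute)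
    then show ?thesis by (simp add: a_def D_def add.commute)
  qed
  define B where "B = 1 + a * 2 ^ (CARD('n) + 1) / (real CARD('n) + 2 - a)"
  define E where "E = B powr (p / r) + 1"
  have E: "0 < E" by (simp add: E_def add_nonneg_pos)
  define c where "c = 2 * C * E powr (1 / p)"
  have c: "0 < c" using C E by (simp add: c_def)
  show ?thesis
  proof (intro exI[of _ c] conjI c allI impI)
    fix f h :: "(real ^ 'n) \<times> real \<Rightarrow> real" and H
    assume pd: "potential_dominated C q f h H"
    have m [measurable]: "f \<in> borel_measurable borel" "h \<in> borel_measurable borel"
      and f0: "\<And>z. 0 \<le> f z" and h0: "\<And>y. 0 \<le> h y" and H: "0 < H"
      and data: "(\<integral>\<^sup>+y. ennreal (h y powr q) \<partial>P\<^sub>1) \<le> ennreal (H powr q)"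
      using pd by (auto simp: potential_dominated_def)
    interpret P: prob_space "P\<^sub>1 :: ((real ^ 'n) \<times> real) measure" by (rule prob_space_P1)
    note pm = potential_moment[OF m(2) h0 q(1) H data q(3) r(1) a_def aD B_def]
    have pot0: "0 \<le> potential h z" for z by (simp add: potential_def)
    have "(\<integral>\<^sup>+z. ennreal (f z powr p) \<partial>P\<^sub>1)
       \<le> (\<integral>\<^sup>+z. ennreal ((2 * C) powr p) * (ennreal (potential h z powr p) + ennreal (H powr p)) \<partial>P\<^sub>1)"
    proof (rule nn_integral_mono_AE)
      show "AE z in P\<^sub>1. ennreal (f z powr p) \<le> ennreal ((2 * C) powr p) * (ennreal (potential h z powr p) + ennreal (H powr p))"
        using potential_dominated_pointwise[OF pd q(1) C pm(1)]
      proof eventually_elim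
        case (elim z)
        have "f z powr p \<le> (C * (potential h z + H)) powr p" using elim f0 p0 by (intro powr_mono2) auto
        also have "\<dots> = C powr p * (potential h z + H) powr p" using C H pot0 by (simp add: powr_mult)
        also have "\<dots> \<le> C powr p * (2 powr p * (potential h z powr p + H powr p))"
          using pot0 H p0 by (intro mult_left_mono powr_add_le) auto
        also have "\<dots> = (2 * C) powr p * (potential h z powr p + H powr p)"
          using C by (simp add: powr_mult)
        finally show ?case by (simp add: ennreal_leI flip: ennreal_mult ennreal_plus)
      qed
    qed
    also have "\<dots> = ennreal ((2 * C) powr p) * ((\<integral>\<^sup>+z. ennreal (potential h z powr p) \<partial>P\<^sub>1) + ennreal (H powr p))"
      by (subst nn_integral_cmult, simp, subst nn_integral_add) (auto simp: P.emeasure_space_1[unfolded space_P1])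
    also have "\<dots> \<le> ennreal ((2 * C) powr p) * (ennreal (B powr (p / r) * H powr p) + ennreal (H powr p))"
      by (intro mult_left_mono add_mono pm(2)) auto
    also have "\<dots> = ennreal ((2 * C) powr p * (E * H powr p))"
      by (simp add: E_def algebra_simps flip: ennreal_mult ennreal_plus)
    also have "(2 * C) powr p * (E * H powr p) = (c * H) powr p"
      using C E H p0 by (simp add: c_def powr_mult powr_powr)
    finally show "(\<integral>\<^sup>+z. ennreal (f z powr p) \<partial>P\<^sub>1) \<le> ennreal ((c * H) powr p)" .
  qed
qed

text \<open>
  For \<open>q = D\<close> one has \<open>D - a = D r / p\<close>, so the constant in Young's inequality is of order \<open>p\<close> and enters to
  the power \<open>p/r = p (D - 1)/D + 1\<close>, as required for the exponential moment.  The constant \<open>c\<close> is so large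
  that the mean part of the bound contributes at most a factor \<open>e\<close>.
\<close>

lemma unit_critical:
  fixes C :: real
  assumes C: "0 < C"
  shows "\<exists>c>0. \<forall>f h H. potential_dominated C (real CARD('n) + 2) (f :: (real ^ 'n::finite) \<times> real \<Rightarrow> real) h H \<longrightarrow>
      (\<integral>\<^sup>+z. ennreal (exp ((f z / (c * H)) powr ((real CARD('n) + 2) / (real CARD('n) + 1)))) \<partial>P\<^sub>1) \<le> ennreal c"
proof -
  define D where "D = real CARD('n) + 2"
  have D: "2 < D" by (simp add: D_def)
  define \<gamma> where "\<gamma> = D / (D - 1)"
  have \<gamma>: "1 \<le> \<gamma>" "0 < \<gamma>" "\<gamma> \<le> 2" using D by (auto simp: \<gamma>_def field_simps)
  define A :: real where "A = 2 ^ (CARD('n) + 2)"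
  have A: "1 \<le> A" unfolding A_def by (rule one_le_power) simp
  define \<eta> where "\<eta> = 1 / (8 * exp 1 * A)"
  have "1 * 1 \<le> (8 * exp 1) * A" using A exp_ge_add_one_self[of 1] by (intro mult_mono) auto
  then have \<eta>: "0 < \<eta>" "\<eta> \<le> 1" using A by (auto simp: \<eta>_def)
  define E where "E = exp 1 * (1 + (A * D) powr D) + 4 * A"
  have E: "0 < E" using A by (simp add: E_def add_nonneg_pos)
  \<comment> \<open>The first entry makes \<open>2 C / c \<le> \<eta> \<le> 1\<close>, the second one absorbs the final bound.\<close>
  define c where "c = max (4 * C / \<eta>) (exp 1 * E)"
  have c: "0 < c" using E by (simp add: c_def less_max_iff_disj)
  have c4: "4 * C / c \<le> \<eta>" 
  proof -
    have "4 * C / \<eta> \<le> c" by (simp add: c_def)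
    then show ?thesis using c \<eta> by (simp add: field_simps)
  qed
  show ?thesis
  proof (intro exI[of _ c] conjI c allI impI)
    fix f h :: "(real ^ 'n) \<times> real \<Rightarrow> real" and H
    assume pd: "potential_dominated C (real CARD('n) + 2) f h H"
    have m [measurable]: "f \<in> borel_measurable borel" "h \<in> borel_measurable borel"
      and f0: "\<And>z. 0 \<le> f z" and h0: "\<And>y. 0 \<le> h y" and H: "0 < H"
      and data: "(\<integral>\<^sup>+y. ennreal (h y powr D) \<partial>P\<^sub>1) \<le> ennreal (H powr D)"
      using pd by (auto simp: potential_dominated_def D_def)
    have pd': "potential_dominated C D f h H" using pd by (simp add: D_def)
    have pot0: "0 \<le> potential h z" for z by (simp add: potential_def)
    have D1: "1 \<le> D" using D by simp
    have moment: "(AE z in P\<^sub>1. (\<integral>\<^sup>+y. ennreal (riesz_kernel z y * h y) \<partial>P\<^sub>1) < \<infinity>) \<and>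
       (\<integral>\<^sup>+z. ennreal (potential h z powr p) \<partial>P\<^sub>1) \<le> ennreal ((A * p) powr (p * (D - 1) / D + 1) * H powr p)"
      if p: "D \<le> p" for p
    proof -
      have p0: "0 < p" "1 \<le> p" using p D by auto
      define \<theta> where "\<theta> = 1 + 1 / p - 1 / D"
      have \<theta>_eq: "\<theta> = (p * (D - 1) + D) / (p * D)" using p0 D by (simp add: \<theta>_def field_simps)
      have \<theta>: "0 < \<theta>" unfolding \<theta>_eq using p0 D by (intro divide_pos_pos add_pos_pos mult_pos_pos) auto
      define r where "r = 1 / \<theta>"
      have r: "r * (1 + 1 / p - 1 / D) = 1" "0 < r" using \<theta> by (auto simp: r_def \<theta>_def[symmetric])
      define a where "a = (real CARD('n) + 1) * r"
      \<comment> \<open>This identity is the source of the growth rate of the moments.\<close>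
      have Da: "real CARD('n) + 2 - a = D * r / p"
      proof -
        have "D * r * (1 + 1 / p - 1 / D) = D" using r by (simp add: mult.assoc)
        then have "D * r + D * r / p - r = D" using D by (simp add: algebra_simps)
        then show ?thesis by (simp add: a_def D_def algebra_simps)
      qed
      have aD: "a < real CARD('n) + 2"
        using Da r D p0 by (smt (verit) divide_pos_pos mult_pos_pos)
      define B where "B = 1 + a * 2 ^ (CARD('n) + 1) / (real CARD('n) + 2 - a)"
      have "B = 1 + (D - 1) / D * (2 ^ (CARD('n) + 1) * p)"
      proof -
        have aD1: "a = (D - 1) * r" by (simp add: a_def D_def)
        show ?thesis unfolding B_def Da unfolding aD1 using r(2) D p0 by (simp add: field_simps)
      qed
      also have "\<dots> \<le> 1 + 1 * (2 ^ (CARD('n) + 1) * p)"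
        using D p0 by (intro add_left_mono mult_right_mono) auto
      also have "\<dots> \<le> 2 ^ (CARD('n) + 1) * p + 2 ^ (CARD('n) + 1) * p"
      proof -
        have "1 * 1 \<le> 2 ^ (CARD('n) + 1) * p" by (intro mult_mono one_le_power) (use p0 in auto)
        then show ?thesis by linarith
      qed
      also have "\<dots> = A * p" by (simp add: A_def)
      finally have B: "B \<le> A * p" .
      have "0 \<le> a" using r by (simp add: a_def)
      then have B0: "0 \<le> B" unfolding B_def using aD by (intro add_nonneg_nonneg divide_nonneg_nonneg) auto
      have pr: "p / r = p * (D - 1) / D + 1" using p0 D by (simp add: r_def \<theta>_def field_simps)
      note pm = potential_moment[OF m(2) h0 D1 H data p r(1) a_def aD B_def]
      have "B powr (p / r) \<le> (A * p) powr (p * (D - 1) / D + 1)"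
        unfolding pr using B B0 p0 D by (intro powr_mono2) auto
      then have "ennreal (B powr (p / r) * H powr p) \<le> ennreal ((A * p) powr (p * (D - 1) / D + 1) * H powr p)"
        by (intro ennreal_leI mult_right_mono) auto
      then show ?thesis using pm by (auto intro: order_trans)
    qed
    have exp_mom: "(\<integral>\<^sup>+z. ennreal (exp (\<eta> * (potential h z / H) powr (D / (D - 1)))) \<partial>P\<^sub>1) \<le> ennreal E"
      unfolding E_def
    proof (rule exponential_moment[OF prob_space_P1])
      show "(\<integral>\<^sup>+z. ennreal ((potential h z / H) powr p) \<partial>P\<^sub>1) \<le> ennreal ((A * p) powr (p * (D - 1) / D + 1))" if "D \<le> p" for p
      proof -
        have "(\<integral>\<^sup>+z. ennreal ((potential h z / H) powr p) \<partial>P\<^sub>1) = (\<integral>\<^sup>+z. ennreal (1 / H powr p) * ennreal (potential h z powr p) \<partial>P\<^sub>1)"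
          using H pot0 by (simp add: powr_divide flip: ennreal_mult)
        also have "\<dots> = ennreal (1 / H powr p) * (\<integral>\<^sup>+z. ennreal (potential h z powr p) \<partial>P\<^sub>1)"
          by (rule nn_integral_cmult) simp
        also have "\<dots> \<le> ennreal (1 / H powr p) * ennreal ((A * p) powr (p * (D - 1) / D + 1) * H powr p)"
          using moment[OF that] by (intro mult_left_mono) auto
        also have "\<dots> = ennreal ((A * p) powr (p * (D - 1) / D + 1))"
          using H by (simp flip: ennreal_mult)
        finally show ?thesis .
      qed
    qed (use D A H pot0 in \<open>auto simp: \<eta>_def\<close>)
    have pw: "AE z in P\<^sub>1. exp ((f z / (c * H)) powr \<gamma>) \<le> exp 1 * exp (\<eta> * (potential h z / H) powr \<gamma>)"
      using potential_dominated_pointwise[OF pd' D1 C conjunct1[OF moment[OF order_refl]]]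
    proof eventually_elim
      case (elim z)
      define X where "X = potential h z / H"
      have X: "0 \<le> X" using pot0 H by (simp add: X_def)
      have "C * (potential h z + H) = C * H * (X + 1)" using H by (simp add: X_def field_simps)
      then have "f z \<le> C * H * (X + 1)" using elim by linarith
      then have "f z / (c * H) \<le> C * H * (X + 1) / (c * H)" using c H by (intro divide_right_mono) auto
      also have "\<dots> = C / c * (X + 1)" using H by simp
      finally have "(f z / (c * H)) powr \<gamma> \<le> (C / c * (X + 1)) powr \<gamma>"
        using f0 c H \<gamma> by (intro powr_mono2) auto
      also have "\<dots> = (C / c) powr \<gamma> * (X + 1) powr \<gamma>" by (rule powr_mult)
      also have "\<dots> \<le> (C / c) powr \<gamma> * (2 powr \<gamma> * (X powr \<gamma> + 1 powr \<gamma>))"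
        using X \<gamma> by (intro mult_left_mono powr_add_le) auto
      also have "\<dots> = (C / c * 2) powr \<gamma> * (X powr \<gamma> + 1)" by (subst powr_mult) simp
      also have "\<dots> \<le> \<eta> * (X powr \<gamma> + 1)"
      proof (intro mult_right_mono)
        have "0 < C / c * 2" "C / c * 2 \<le> \<eta>" using c4 C c by (auto simp: field_simps)
        then have "(C / c * 2) powr \<gamma> \<le> (C / c * 2) powr 1" using \<eta> \<gamma> by (intro powr_mono') auto
        then show "(C / c * 2) powr \<gamma> \<le> \<eta>" using \<open>C / c * 2 \<le> \<eta>\<close> \<open>0 < C / c * 2\<close> by simp
      qed auto
      also have "\<dots> \<le> 1 + \<eta> * X powr \<gamma>" using \<eta> by (simp add: algebra_simps)
      finally show ?case by (simp add: X_def flip: exp_add)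
    qed
    have "(\<integral>\<^sup>+z. ennreal (exp ((f z / (c * H)) powr \<gamma>)) \<partial>P\<^sub>1) \<le> (\<integral>\<^sup>+z. ennreal (exp 1) * ennreal (exp (\<eta> * (potential h z / H) powr \<gamma>)) \<partial>P\<^sub>1)"
      by (rule nn_integral_mono_AE) (use pw in eventually_elim, simp add: ennreal_leI flip: ennreal_mult)
    also have "\<dots> = ennreal (exp 1) * (\<integral>\<^sup>+z. ennreal (exp (\<eta> * (potential h z / H) powr \<gamma>)) \<partial>P\<^sub>1)"
      by (rule nn_integral_cmult) simp
    also have "\<dots> \<le> ennreal (exp 1) * ennreal E"
      using exp_mom by (intro mult_left_mono) (auto simp: \<gamma>_def)
    also have "\<dots> = ennreal (exp 1 * E)" using E by (simp add: ennreal_mult)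
    also have "\<dots> \<le> ennreal c" by (intro ennreal_leI) (simp add: c_def)
    finally have "(\<integral>\<^sup>+z. ennreal (exp ((f z / (c * H)) powr \<gamma>)) \<partial>P\<^sub>1) \<le> ennreal c" .
    moreover have "\<gamma> = (real CARD('n) + 2) / (real CARD('n) + 1)" by (simp add: \<gamma>_def D_def add.commute)
    ultimately show "(\<integral>\<^sup>+z. ennreal (exp ((f z / (c * H)) powr ((real CARD('n) + 2) / (real CARD('n) + 1)))) \<partial>P\<^sub>1) \<le> ennreal c"
      by (simp only:)
  qed
qed

lemma unit_supercritical:
  fixes C q :: real
  assumes C: "0 < C" and q: "real CARD('n::finite) + 2 < q"
  shows "\<exists>c>0. \<forall>f h H. potential_dominated C q (f :: (real ^ 'n) \<times> real \<Rightarrow> real) h H \<longrightarrow>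
      (AE z in P\<^sub>1. f z \<le> c * H)"
proof -
  have q1: "1 \<le> q" "1 < q" using q by auto
  define r where "r = 1 / (1 - 1 / q)"
  have "1 / q < 1" using q1 by simp
  then have r: "r * (1 - 1 / q) = 1" using q1 by (simp add: r_def)
  define B where "B = 1 + (real CARD('n) + 1) * r * 2 ^ (CARD('n) + 1) / (real CARD('n) + 2 - (real CARD('n) + 1) * r)"
  define c where "c = C * (B powr (1 - 1 / q) + 1)"
  have c: "0 < c" unfolding c_def using C by (intro mult_pos_pos add_nonneg_pos) auto
  show ?thesis
  proof (intro exI[of _ c] conjI c allI impI)
    fix f h :: "(real ^ 'n) \<times> real \<Rightarrow> real" and H
    assume pd: "potential_dominated C q f h H"
    have m [measurable]: "f \<in> borel_measurable borel" "h \<in> borel_measurable borel"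
      and h0: "\<And>y. 0 \<le> h y" and H: "0 < H"
      and data: "(\<integral>\<^sup>+y. ennreal (h y powr q) \<partial>P\<^sub>1) \<le> ennreal (H powr q)"
      using pd by (auto simp: potential_dominated_def)
    have bdd: "(\<integral>\<^sup>+y. ennreal (riesz_kernel z y * h y) \<partial>P\<^sub>1) \<le> ennreal (B powr (1 - 1 / q) * H)" if "z \<in> Q\<^sub>1" for z
      by (rule potential_bounded[OF m(2) h0 q1(1) H data q r refl _ that]) (simp add: B_def)
    have fin: "AE z in P\<^sub>1. (\<integral>\<^sup>+y. ennreal (riesz_kernel z y * h y) \<partial>P\<^sub>1) < \<infinity>"
      using AE_P1_Q1 by eventually_elim (rule le_less_trans[OF bdd], auto)
    show "AE z in P\<^sub>1. f z \<le> c * H"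
      using potential_dominated_pointwise[OF pd q1(1) C fin] AE_P1_Q1
    proof eventually_elim
      case (elim z)
      have "potential h z \<le> B powr (1 - 1 / q) * H"
        unfolding potential_def using bdd[OF elim(2)] H by (intro enn2real_leI) auto
      then have "C * (potential h z + H) \<le> C * (B powr (1 - 1 / q) * H + H)"
        using C by (intro mult_left_mono add_right_mono) auto
      then show ?case using elim(1) by (simp add: c_def algebra_simps)
    qed
  qed
qed

section \<open>Parabolic scaling\<close>

lemma measurable_vec_component [measurable (raw)]:
  fixes f :: "'a \<Rightarrow> real ^ 'n::finite"
  assumes "f \<in> borel_measurable M"
  shows "(\<lambda>x. f x $ j) \<in> borel_measurable M"
  using assms by (rule measurable_compose) (intro borel_measurable_continuous_onI continuous_intros)

text \<open>
  The parabolic change of variables from the unit cylinder to the cylinder with centre \<open>z0\<close> and radius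
  \<open>\<rho>\<close>.
\<close>

definition cyl_map :: "(real ^ 'n::finite) \<times> real \<Rightarrow> real \<Rightarrow> (real ^ 'n) \<times> real \<Rightarrow> (real ^ 'n) \<times> real" where
  "cyl_map z0 \<rho> w = (fst z0 + \<rho> *\<^sub>R fst w, snd z0 + \<rho>\<^sup>2 * snd w)"

definition cyl_inv :: "(real ^ 'n::finite) \<times> real \<Rightarrow> real \<Rightarrow> (real ^ 'n) \<times> real \<Rightarrow> (real ^ 'n) \<times> real" where
  "cyl_inv z0 \<rho> z = ((1 / \<rho>) *\<^sub>R (fst z - fst z0), (1 / \<rho>\<^sup>2) * (snd z - snd z0))"

lemma cyl_inv_map: "0 < \<rho> \<Longrightarrow> cyl_inv z0 \<rho> (cyl_map z0 \<rho> w) = w"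
  by (simp add: cyl_inv_def cyl_map_def)

lemma cyl_map_inv: "0 < \<rho> \<Longrightarrow> cyl_map z0 \<rho> (cyl_inv z0 \<rho> w) = w"
  by (simp add: cyl_inv_def cyl_map_def)

text \<open>
  The inverse changes of variables are of the same form, so results for one family cover both.
\<close>

lemma cyl_map_eq_inv:
  "0 < \<rho> \<Longrightarrow> cyl_map z0 \<rho> = cyl_inv (- (1 / \<rho>) *\<^sub>R fst z0, - (1 / \<rho>\<^sup>2) * snd z0) (1 / \<rho>)"
  by (auto simp: fun_eq_iff cyl_inv_def cyl_map_def power_divide algebra_simps)

lemma cyl_map_in_cylinder:
  assumes "0 < \<rho>"
  shows "cyl_map (x0, t0) \<rho> w \<in> parabolic_cylinder x0 t0 \<rho> \<longleftrightarrow> w \<in> Q\<^sub>1"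
proof -
  have "norm (\<rho> *\<^sub>R fst w) < \<rho> \<longleftrightarrow> norm (fst w) < 1" using assms by simp
  moreover have "- \<rho>\<^sup>2 < \<rho>\<^sup>2 * snd w \<longleftrightarrow> -1 < snd w" "\<rho>\<^sup>2 * snd w < \<rho>\<^sup>2 \<longleftrightarrow> snd w < 1"
    using assms mult_less_cancel_left_pos[of "\<rho>\<^sup>2" "-1" "snd w"] mult_less_cancel_left_pos[of "\<rho>\<^sup>2" "snd w" 1]
    by auto
  ultimately show ?thesis
    by (auto simp: cyl_map_def parabolic_cylinder_def mem_Times_iff dist_norm norm_minus_commute)
qed

lemma cyl_inv_in_Q1:
  "0 < \<rho> \<Longrightarrow> cyl_inv (x0, t0) \<rho> z \<in> Q\<^sub>1 \<longleftrightarrow> z \<in> parabolic_cylinder x0 t0 \<rho>"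
  using cyl_map_in_cylinder[of \<rho> x0 t0 "cyl_inv (x0, t0) \<rho> z"] by (simp add: cyl_map_inv)

lemma cyl_measurable [measurable]:
  "cyl_map z0 \<rho> \<in> borel_measurable borel" "cyl_inv z0 \<rho> \<in> borel_measurable borel"
  unfolding cyl_map_def cyl_inv_def by measurable

lemma nn_integral_cyl_inv:
  fixes f :: "(real ^ 'n::finite) \<times> real \<Rightarrow> ennreal"
  assumes [measurable]: "f \<in> borel_measurable borel" and \<rho>: "0 < \<rho>"
  shows "(\<integral>\<^sup>+z. f (cyl_inv z0 \<rho> z) \<partial>lborel) = ennreal (\<rho> ^ (CARD('n) + 2)) * (\<integral>\<^sup>+z. f z \<partial>lborel)"
proof -
  have "(\<integral>\<^sup>+z. f (cyl_inv z0 \<rho> z) \<partial>lborel) = (\<integral>\<^sup>+z. f (zoom 0 \<rho> (- z0 + 1 *\<^sub>R z)) \<partial>lborel)"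
    by (simp add: cyl_inv_def zoom_def)
  also have "\<dots> = (\<integral>\<^sup>+z. f (zoom 0 \<rho> z) \<partial>lborel)"
    using nn_integral_lborel_affine[of "\<lambda>z. f (zoom 0 \<rho> z)" 1 "- z0"] by simp
  finally show ?thesis using nn_integral_zoom[OF assms(1) \<rho>] by simp
qed

lemma distr_cyl_inv:
  fixes z0 :: "(real ^ 'n::finite) \<times> real"
  assumes \<rho>: "0 < \<rho>"
  shows "distr lborel borel (cyl_inv z0 \<rho>) = density lborel (\<lambda>_. ennreal (\<rho> ^ (CARD('n) + 2)))"
proof (rule measure_eqI)
  fix A assume "A \<in> sets (distr lborel borel (cyl_inv z0 \<rho>))"
  then have [measurable]: "A \<in> sets borel" by simp
  have "emeasure (distr lborel borel (cyl_inv z0 \<rho>)) A = (\<integral>\<^sup>+z. indicator A z \<partial>distr lborel borel (cyl_inv z0 \<rho>))"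
    by simp
  also have "\<dots> = (\<integral>\<^sup>+z. indicator A (cyl_inv z0 \<rho> z) \<partial>lborel)"
    by (rule nn_integral_distr) auto
  also have "\<dots> = ennreal (\<rho> ^ (CARD('n) + 2)) * emeasure lborel A"
    by (subst nn_integral_cyl_inv[OF _ \<rho>]) auto
  also have "\<dots> = emeasure (density lborel (\<lambda>_. ennreal (\<rho> ^ (CARD('n) + 2)))) A"
    by (subst emeasure_density) (auto simp: nn_integral_cmult)
  finally show "emeasure (distr lborel borel (cyl_inv z0 \<rho>)) A = emeasure (density lborel (\<lambda>_. ennreal (\<rho> ^ (CARD('n) + 2)))) A" .
qed simp

lemma AE_cyl_inv:
  fixes z0 :: "(real ^ 'n::finite) \<times> real"
  assumes \<rho>: "0 < \<rho>" and "AE w in lborel. P w"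
  shows "AE z in lborel. P (cyl_inv z0 \<rho> z)"
proof -
  have "AE w in distr lborel borel (cyl_inv z0 \<rho>). P w"
    unfolding distr_cyl_inv[OF \<rho>] using assms(2) by (subst AE_density) auto
  from AE_distrD[OF _ this] show ?thesis by simp
qed

lemma AE_cyl_map:
  fixes z0 :: "(real ^ 'n::finite) \<times> real"
  assumes \<rho>: "0 < \<rho>" and "AE w in lborel. P w"
  shows "AE z in lborel. P (cyl_map z0 \<rho> z)"
  unfolding cyl_map_eq_inv[OF \<rho>] using assms by (intro AE_cyl_inv) auto

lemma integrable_scaleR_iff:
  fixes f :: "'a \<Rightarrow> 'b::{banach, second_countable_topology}"
  assumes "c \<noteq> 0"
  shows "integrable M (\<lambda>x. c *\<^sub>R f x) \<longleftrightarrow> integrable M f"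
  using assms integrable_scaleR_right[of "1 / c" M "\<lambda>x. c *\<^sub>R f x"] by auto

lemma integrable_cyl_inv_iff:
  fixes f :: "(real ^ 'n::finite) \<times> real \<Rightarrow> 'b::{banach, second_countable_topology}"
  assumes [measurable]: "f \<in> borel_measurable borel" and \<rho>: "0 < \<rho>"
  shows "integrable lborel (\<lambda>z. f (cyl_inv z0 \<rho> z)) \<longleftrightarrow> integrable lborel f"
proof -
  have "integrable lborel (\<lambda>z. f (cyl_inv z0 \<rho> z)) \<longleftrightarrow> integrable (distr lborel borel (cyl_inv z0 \<rho>)) f"
    by (subst integrable_distr_eq) auto
  also have "\<dots> \<longleftrightarrow> integrable lborel f"
    unfolding distr_cyl_inv[OF \<rho>] using \<rho> by (subst integrable_density) (simp_all add: integrable_scaleR_iff del: power_Suc power_add power_add_numeral)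
  finally show ?thesis .
qed

lemma integral_cyl_inv:
  fixes f :: "(real ^ 'n::finite) \<times> real \<Rightarrow> real"
  assumes [measurable]: "f \<in> borel_measurable borel" and \<rho>: "0 < \<rho>"
  shows "(LINT z|lborel. f (cyl_inv z0 \<rho> z)) = \<rho> ^ (CARD('n) + 2) * (LINT z|lborel. f z)"
proof -
  have "(LINT z|lborel. f (cyl_inv z0 \<rho> z)) = (LINT z|distr lborel borel (cyl_inv z0 \<rho>). f z)"
    by (subst integral_distr) auto
  also have "\<dots> = \<rho> ^ (CARD('n) + 2) * (LINT z|lborel. f z)"
    unfolding distr_cyl_inv[OF \<rho>] using \<rho> by (subst integral_density) auto
  finally show ?thesis .
qed

lemma integral_cyl_map:
  fixes f :: "(real ^ 'n::finite) \<times> real \<Rightarrow> real"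
  assumes [measurable]: "f \<in> borel_measurable borel" and \<rho>: "0 < \<rho>"
  shows "(LINT z|lborel. f z) = \<rho> ^ (CARD('n) + 2) * (LINT w|lborel. f (cyl_map z0 \<rho> w))"
  using integral_cyl_inv[of "\<lambda>w. f (cyl_map z0 \<rho> w)" \<rho> z0] \<rho> by (simp add: cyl_map_inv)

lemma integrable_cyl_map:
  fixes f :: "(real ^ 'n::finite) \<times> real \<Rightarrow> 'b::{banach, second_countable_topology}"
  assumes f: "integrable lborel f" and \<rho>: "0 < \<rho>"
  shows "integrable lborel (\<lambda>w. f (cyl_map z0 \<rho> w))"
proof -
  have [measurable]: "f \<in> borel_measurable borel" using f by (auto dest!: borel_measurable_integrable)
  show ?thesis
    using integrable_cyl_inv_iff[of "\<lambda>w. f (cyl_map z0 \<rho> w)" \<rho> z0] \<rho> f by (simp add: cyl_map_inv)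
qed

lemma cyl_inv_eq_affine: "cyl_inv z0 \<rho> z = - zoom_linear \<rho> z0 + zoom_linear \<rho> z"
  by (simp add: cyl_inv_def zoom_linear_def prod_eq_iff scaleR_right_diff_distrib right_diff_distrib diff_divide_distrib)

lemma cyl_inv_has_derivative: "(cyl_inv z0 \<rho> has_derivative zoom_linear \<rho>) (at z)"
proof -
  have "((\<lambda>z. (- zoom_linear \<rho> z0) + zoom_linear \<rho> z) has_derivative zoom_linear \<rho>) (at z)"
    by (rule has_derivative_eq_rhs, rule has_derivative_add[OF has_derivative_const
          bounded_linear_imp_has_derivative[OF bounded_linear_zoom_linear]]) simp
  then show ?thesis by (simp only: cyl_inv_eq_affine[abs_def])
qed

lemma test_function_cyl_inv:
  assumes \<psi>: "test_function Q\<^sub>1 \<psi>" and \<rho>: "0 < \<rho>"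
  shows "test_function (parabolic_cylinder x0 t0 \<rho>) (\<lambda>z. \<psi> (cyl_inv (x0, t0) \<rho> z))"
  unfolding test_function_def compactly_inside_def
proof (intro conjI allI)
  show "C_k k (\<lambda>z. \<psi> (cyl_inv (x0, t0) \<rho> z))" for k
    unfolding cyl_inv_eq_affine using \<psi> by (intro C_k_compose_affine bounded_linear_zoom_linear) (auto simp: test_function_def)
  define K where "K = closure {z. \<psi> z \<noteq> 0}"
  have K: "compact K" "K \<subseteq> Q\<^sub>1"
    using \<psi> by (auto simp: test_function_def compactly_inside_def K_def)
  have "compact (cyl_map (x0, t0) \<rho> ` K)"
    unfolding cyl_map_def using K(1) by (intro compact_continuous_image continuous_intros)
  moreover have sub: "{z. \<psi> (cyl_inv (x0, t0) \<rho> z) \<noteq> 0} \<subseteq> cyl_map (x0, t0) \<rho> ` K"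
  proof
    fix z assume "z \<in> {z. \<psi> (cyl_inv (x0, t0) \<rho> z) \<noteq> 0}"
    then have "cyl_inv (x0, t0) \<rho> z \<in> {z. \<psi> z \<noteq> 0}" by simp
    then have "cyl_inv (x0, t0) \<rho> z \<in> K" unfolding K_def by (rule subsetD[OF closure_subset])
    then have "cyl_map (x0, t0) \<rho> (cyl_inv (x0, t0) \<rho> z) \<in> cyl_map (x0, t0) \<rho> ` K" by (rule imageI)
    then show "z \<in> cyl_map (x0, t0) \<rho> ` K" using \<rho> by (simp add: cyl_map_inv)
  qed
  ultimately have cl: "closure {z. \<psi> (cyl_inv (x0, t0) \<rho> z) \<noteq> 0} \<subseteq> cyl_map (x0, t0) \<rho> ` K"
    by (intro closure_minimal compact_imp_closed)
  show "compact (closure {z. \<psi> (cyl_inv (x0, t0) \<rho> z) \<noteq> 0})"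
    using \<open>compact (cyl_map (x0, t0) \<rho> ` K)\<close> cl
    by (meson bounded_subset closed_closure compact_eq_bounded_closed)
  have "cyl_map (x0, t0) \<rho> ` K \<subseteq> parabolic_cylinder x0 t0 \<rho>"
    by (rule image_subsetI, subst cyl_map_in_cylinder[OF \<rho>], erule subsetD[OF K(2)])
  then show "closure {z. \<psi> (cyl_inv (x0, t0) \<rho> z) \<noteq> 0} \<subseteq> parabolic_cylinder x0 t0 \<rho>" using cl by blast
qed

lemma frechet_derivative_cyl_inv:
  assumes \<psi>: "test_function Q\<^sub>1 \<psi>"
  shows "frechet_derivative (\<lambda>z. \<psi> (cyl_inv z0 \<rho> z)) (at z) v = frechet_derivative \<psi> (at (cyl_inv z0 \<rho> z)) (zoom_linear \<rho> v)"
proof -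
  have "((\<lambda>z. \<psi> (cyl_inv z0 \<rho> z)) has_derivative (\<lambda>v. frechet_derivative \<psi> (at (cyl_inv z0 \<rho> z)) (zoom_linear \<rho> v))) (at z)"
    using diff_chain_at[OF cyl_inv_has_derivative test_function_has_derivative[OF \<psi>]] by (simp add: o_def)
  from frechet_derivative_at[OF this] show ?thesis by (rule fun_cong[OF sym])
qed

lemma test_function_linear: "test_function S \<psi> \<Longrightarrow> linear (frechet_derivative \<psi> (at z))"
  using test_function_has_derivative has_derivative_linear by blast

lemma grad_x_cyl_inv:
  assumes \<psi>: "test_function Q\<^sub>1 \<psi>"
  shows "grad_x (\<lambda>z. \<psi> (cyl_inv z0 \<rho> z)) z = (1 / \<rho>) *\<^sub>R grad_x \<psi> (cyl_inv z0 \<rho> z)"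
proof -
  have "frechet_derivative \<psi> (at w) (zoom_linear \<rho> (axis j 1, 0)) = (1 / \<rho>) * frechet_derivative \<psi> (at w) (axis j 1, 0)" for w j
    using linear_scale[OF test_function_linear[OF \<psi>], of w "1 / \<rho>" "(axis j 1, 0)"] by (simp add: zoom_linear_def)
  then show ?thesis by (simp add: grad_x_def frechet_derivative_cyl_inv[OF \<psi>] vec_eq_iff)
qed

lemma deriv_t_cyl_inv:
  assumes \<psi>: "test_function Q\<^sub>1 \<psi>"
  shows "deriv_t (\<lambda>z. \<psi> (cyl_inv z0 \<rho> z)) z = (1 / \<rho>\<^sup>2) * deriv_t \<psi> (cyl_inv z0 \<rho> z)"
proof -
  have "frechet_derivative \<psi> (at w) (zoom_linear \<rho> (0, 1)) = (1 / \<rho>\<^sup>2) * frechet_derivative \<psi> (at w) (0, 1)" for w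
    using linear_scale[OF test_function_linear[OF \<psi>], of w "1 / \<rho>\<^sup>2" "(0, 1)"] by (simp add: zoom_linear_def)
  then show ?thesis by (simp add: deriv_t_def frechet_derivative_cyl_inv[OF \<psi>])
qed

lemma test_function_measurable:
  assumes "test_function S \<psi>"
  shows "\<psi> \<in> borel_measurable borel" "grad_x \<psi> \<in> borel_measurable borel" "deriv_t \<psi> \<in> borel_measurable borel"
  unfolding grad_x_def[abs_def] deriv_t_def[abs_def]
  using test_function_continuous[OF assms]
  by (auto intro!: borel_measurable_continuous_onI continuous_on_vec_lambda)

text \<open>
  A test function on the unit cylinder is pulled back to the given cylinder.  Space derivatives gain
  a factor \<open>1/\<rho>\<close> and time derivatives \<open>1/\<rho>\<^sup>2\<close>, so both \<open>g\<close> and \<open>G\<close> are multiplied by \<open>\<rho>\<close>.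
\<close>

lemma weak_flux_cyl_map:
  fixes u :: "(real ^ 'n::finite) \<times> real \<Rightarrow> real"
  assumes wf: "weak_flux (parabolic_cylinder x0 t0 \<rho>) u g G" and \<rho>: "0 < \<rho>"
  shows "weak_flux Q\<^sub>1 (\<lambda>w. u (cyl_map (x0, t0) \<rho> w)) (\<lambda>w. \<rho> *\<^sub>R g (cyl_map (x0, t0) \<rho> w)) (\<lambda>w. \<rho> *\<^sub>R G (cyl_map (x0, t0) \<rho> w))"
  unfolding weak_flux_def
proof (intro conjI allI impI)
  define S where "S = cyl_map (x0, t0) \<rho>"
  define R where "R = cyl_inv (x0, t0) \<rho>"
  have RS [simp]: "R (S w) = w" for w using \<rho> by (simp add: R_def S_def cyl_inv_map)
  have [measurable]: "S \<in> borel_measurable borel" "R \<in> borel_measurable borel" by (simp_all add: S_def R_def)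
  have u: "integrable lborel u" and g: "integrable lborel g" and G: "integrable lborel G"
    using wf by (auto simp: weak_flux_def)
  have [measurable]: "u \<in> borel_measurable borel" "g \<in> borel_measurable borel" "G \<in> borel_measurable borel"
    using u g G by (auto dest!: borel_measurable_integrable)
  show "integrable lborel (\<lambda>w. u (cyl_map (x0, t0) \<rho> w))"
    "integrable lborel (\<lambda>w. \<rho> *\<^sub>R g (cyl_map (x0, t0) \<rho> w))" "integrable lborel (\<lambda>w. \<rho> *\<^sub>R G (cyl_map (x0, t0) \<rho> w))"
    using integrable_cyl_map[OF u \<rho>] integrable_cyl_map[OF g \<rho>] integrable_cyl_map[OF G \<rho>] by auto
  fix \<psi> :: "(real ^ 'n) \<times> real \<Rightarrow> real" assume \<psi>: "test_function Q\<^sub>1 \<psi>"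
  define c where "c = \<rho> ^ (CARD('n) + 2)"
  have c: "c \<noteq> 0" using \<rho> by (simp add: c_def)
  note [measurable] = test_function_measurable[OF \<psi>]
  have scale: "(LINT z|lborel. f z) = c * (LINT w|lborel. f (S w))" if "f \<in> borel_measurable borel" for f :: "(real ^ 'n) \<times> real \<Rightarrow> real"
    unfolding c_def S_def by (rule integral_cyl_map[OF that \<rho>])
  have \<psi>': "test_function (parabolic_cylinder x0 t0 \<rho>) (\<lambda>z. \<psi> (R z))"
    unfolding R_def by (rule test_function_cyl_inv[OF \<psi> \<rho>])
  have grad: "grad_x (\<lambda>z. \<psi> (R z)) z = (1 / \<rho>) *\<^sub>R grad_x \<psi> (R z)" for z
    unfolding R_def by (rule grad_x_cyl_inv[OF \<psi>])
  have dt: "deriv_t (\<lambda>z. \<psi> (R z)) z = (1 / \<rho>\<^sup>2) * deriv_t \<psi> (R z)" for z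
    unfolding R_def by (rule deriv_t_cyl_inv[OF \<psi>])
  have 1: "(LINT z|lborel. u z * grad_x (\<lambda>z. \<psi> (R z)) z $ j) = - (LINT z|lborel. g z $ j * \<psi> (R z))" for j
    using wf \<psi>' unfolding weak_flux_def by blast
  have 2: "(LINT z|lborel. u z * deriv_t (\<lambda>z. \<psi> (R z)) z) = (LINT z|lborel. G z \<bullet> grad_x (\<lambda>z. \<psi> (R z)) z)"
    using wf \<psi>' unfolding weak_flux_def by blast
  show "(LINT w|lborel. u (cyl_map (x0, t0) \<rho> w) * grad_x \<psi> w $ j) = - (LINT w|lborel. (\<rho> *\<^sub>R g (cyl_map (x0, t0) \<rho> w)) $ j * \<psi> w)" for j
  proof -
    have "c * (LINT w|lborel. (1 / \<rho>) * (u (S w) * grad_x \<psi> w $ j)) = - (c * (LINT w|lborel. g (S w) $ j * \<psi> w))"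
      using 1[of j] unfolding grad by (subst (asm) (1 2) scale) (simp_all add: mult.left_commute)
    then have "c * ((LINT w|lborel. u (S w) * grad_x \<psi> w $ j) / \<rho>) = c * (- (LINT w|lborel. g (S w) $ j * \<psi> w))"
      by simp
    then have "(LINT w|lborel. u (S w) * grad_x \<psi> w $ j) / \<rho> = - (LINT w|lborel. g (S w) $ j * \<psi> w)"
      using c by (simp only: mult_cancel_left simp_thms)
    then have "(LINT w|lborel. u (S w) * grad_x \<psi> w $ j) = - (\<rho> * (LINT w|lborel. g (S w) $ j * \<psi> w))"
      using \<rho> by (simp add: nonzero_divide_eq_eq mult.commute)
    then show ?thesis by (simp add: S_def mult.assoc)
  qed
  show "(LINT w|lborel. u (cyl_map (x0, t0) \<rho> w) * deriv_t \<psi> w) = (LINT w|lborel. (\<rho> *\<^sub>R G (cyl_map (x0, t0) \<rho> w)) \<bullet> grad_x \<psi> w)"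
  proof -
    have "c * (LINT w|lborel. (1 / \<rho>\<^sup>2) * (u (S w) * deriv_t \<psi> w)) = c * (LINT w|lborel. (1 / \<rho>) * (G (S w) \<bullet> grad_x \<psi> w))"
      using 2 unfolding grad dt by (subst (asm) (1 2) scale) (simp_all add: mult.left_commute)
    then have "c * ((LINT w|lborel. u (S w) * deriv_t \<psi> w) / \<rho>\<^sup>2) = c * ((LINT w|lborel. G (S w) \<bullet> grad_x \<psi> w) / \<rho>)"
      by simp
    then have "(LINT w|lborel. u (S w) * deriv_t \<psi> w) / \<rho>\<^sup>2 = (LINT w|lborel. G (S w) \<bullet> grad_x \<psi> w) / \<rho>"
      using c by (simp only: mult_cancel_left simp_thms)
    then have "(LINT w|lborel. u (S w) * deriv_t \<psi> w) = \<rho> * (LINT w|lborel. G (S w) \<bullet> grad_x \<psi> w)"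
      using \<rho> by (simp add: nonzero_divide_eq_eq power2_eq_square)
    then show ?thesis by (simp add: S_def)
  qed
qed

lemma P1_density: "(P\<^sub>1 :: ((real ^ 'n::finite) \<times> real) measure) = density lborel (\<lambda>z. ennreal (indicator Q\<^sub>1 z / (2 * unit_ball_vol CARD('n))))"
proof -
  have "0 < 2 * unit_ball_vol CARD('n)" using unit_ball_vol_pos[of "CARD('n)"] by simp
  then have "indicator Q\<^sub>1 z / emeasure lborel (Q\<^sub>1 :: ((real ^ 'n::finite) \<times> real) set) = ennreal (indicator Q\<^sub>1 z / (2 * unit_ball_vol CARD('n)))" for z :: "(real ^ 'n) \<times> real"
    unfolding emeasure_Q1 by (subst divide_ennreal[symmetric]) (auto simp: ennreal_indicator)
  then show ?thesis unfolding P\<^sub>1_def uniform_measure_def by simp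
qed

lemma integrable_P1_iff:
  fixes f :: "(real ^ 'n::finite) \<times> real \<Rightarrow> real"
  assumes [measurable]: "f \<in> borel_measurable borel"
  shows "integrable P\<^sub>1 f \<longleftrightarrow> integrable lborel (\<lambda>z. indicator Q\<^sub>1 z * f z)"
proof -
  have w: "0 < unit_ball_vol CARD('n)" using unit_ball_vol_pos[of "CARD('n)"] by simp
  have "integrable P\<^sub>1 f \<longleftrightarrow> integrable lborel (\<lambda>z. (1 / (2 * unit_ball_vol CARD('n))) * (indicator Q\<^sub>1 z * f z))"
    unfolding P1_density by (subst integrable_density) (auto simp: w less_imp_le)
  also have "\<dots> \<longleftrightarrow> integrable lborel (\<lambda>z. indicator Q\<^sub>1 z * f z)"
    by (subst integrable_mult_left_iff) (use less_imp_neq[OF w, symmetric] in simp)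
  finally show ?thesis .
qed

lemma integral_P1:
  fixes f :: "(real ^ 'n::finite) \<times> real \<Rightarrow> real"
  assumes [measurable]: "f \<in> borel_measurable borel"
  shows "(LINT z|P\<^sub>1. f z) = (LINT z|lborel. indicator Q\<^sub>1 z * f z) / (2 * unit_ball_vol CARD('n))"
proof -
  have w: "0 < unit_ball_vol CARD('n)" using unit_ball_vol_pos[of "CARD('n)"] by simp
  have "(LINT z|P\<^sub>1. f z) = (LINT z|lborel. (1 / (2 * unit_ball_vol CARD('n))) * (indicator Q\<^sub>1 z * f z))"
    unfolding P1_density by (subst integral_density) (auto simp: w less_imp_le)
  then show ?thesis by simp
qed

lemma parabolic_cylinder_measurable [measurable]: "parabolic_cylinder x0 t0 \<rho> \<in> sets borel"
  unfolding parabolic_cylinder_def by (intro borel_open open_Times) auto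

lemma lebesgue_on_AE_iff_lborel:
  assumes "S \<in> sets borel"
  shows "(AE z in lebesgue_on S. P z) \<longleftrightarrow> (AE z in lborel. z \<in> S \<longrightarrow> P z)"
  using assms by (subst AE_restrict_space_iff) (auto simp: AE_completion_iff)

text \<open>
  Lebesgue integrals over a Borel set can be computed from any Borel function that agrees with the integrand
  almost everywhere on the set.
\<close>

lemma borel_version_on:
  fixes f f' :: "'a::euclidean_space \<Rightarrow> real"
  assumes S: "S \<in> sets borel" and [measurable]: "f' \<in> borel_measurable borel"
    and eq: "AE z in lborel. z \<in> S \<longrightarrow> f z = f' z"
  shows "f \<in> borel_measurable (lebesgue_on S)"
    "integrable (lebesgue_on S) f \<longleftrightarrow> integrable lborel (\<lambda>z. indicator S z * f' z)"
    "(LINT z|lebesgue_on S. f z) = (LINT z|lborel. indicator S z * f' z)"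
proof -
  note [measurable] = S
  have SL: "S \<in> sets lebesgue" using S by simp
  define F where "F z = indicator S z * f' z" for z
  have F [measurable]: "F \<in> borel_measurable borel" unfolding F_def by measurable
  have FL: "F \<in> borel_measurable lebesgue" by (simp add: measurable_completion)
  have AE: "AE z in lebesgue. F z = indicator S z *\<^sub>R f z"
    using AE_completion[OF eq] by eventually_elim (auto simp: F_def indicator_def)
  have fL: "(\<lambda>z. indicator S z *\<^sub>R f z) \<in> borel_measurable lebesgue"
    by (rule borel_measurable_AE[OF FL AE])
  then show "f \<in> borel_measurable (lebesgue_on S)"
    using SL by (subst borel_measurable_restrict_space_iff) auto
  have "integrable (lebesgue_on S) f \<longleftrightarrow> integrable lebesgue (\<lambda>z. indicator S z *\<^sub>R f z)"
    using SL by (intro integrable_restrict_space) auto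
  also have "\<dots> \<longleftrightarrow> integrable lebesgue F"
    using AE FL fL by (intro integrable_cong_AE) auto
  also have "\<dots> \<longleftrightarrow> integrable lborel F" by (rule integrable_completion) simp
  finally show "integrable (lebesgue_on S) f \<longleftrightarrow> integrable lborel (\<lambda>z. indicator S z * f' z)"
    by (simp add: F_def[abs_def])
  have "(LINT z|lebesgue_on S. f z) = (LINT z|lebesgue. indicator S z *\<^sub>R f z)"
    using SL by (intro integral_restrict_space) auto
  also have "\<dots> = (LINT z|lebesgue. F z)"
    using AE FL fL by (intro integral_cong_AE) auto
  also have "\<dots> = (LINT z|lborel. F z)" by (rule integral_completion) simp
  finally show "(LINT z|lebesgue_on S. f z) = (LINT z|lborel. indicator S z * f' z)"
    by (simp add: F_def[abs_def])
qed

lemma measure_parabolic_cylinder: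
  fixes x0 :: "real ^ 'n::finite"
  assumes \<rho>: "0 < \<rho>"
  shows "measure lebesgue (parabolic_cylinder x0 t0 \<rho>) = \<rho> ^ (CARD('n) + 2) * (2 * unit_ball_vol CARD('n))"
proof -
  have "indicator (parabolic_cylinder x0 t0 \<rho>) z = (indicator Q\<^sub>1 (cyl_inv (x0, t0) \<rho> z) :: ennreal)" for z
    using cyl_inv_in_Q1[OF \<rho>, of x0 t0 z] by (simp add: indicator_def)
  then have "(\<integral>\<^sup>+z. indicator (parabolic_cylinder x0 t0 \<rho>) z \<partial>lborel) = (\<integral>\<^sup>+z. indicator Q\<^sub>1 (cyl_inv (x0, t0) \<rho> z) \<partial>lborel)"
    by (intro nn_integral_cong)
  then have "emeasure lborel (parabolic_cylinder x0 t0 \<rho>) = (\<integral>\<^sup>+z. indicator Q\<^sub>1 (cyl_inv (x0, t0) \<rho> z) \<partial>lborel)"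
    by simp
  also have "\<dots> = ennreal (\<rho> ^ (CARD('n) + 2)) * ennreal (2 * unit_ball_vol CARD('n))"
    by (subst nn_integral_cyl_inv[OF _ \<rho>]) (auto simp: emeasure_Q1)
  also have "\<dots> = ennreal (\<rho> ^ (CARD('n) + 2) * (2 * unit_ball_vol CARD('n)))"
    using \<rho> by (intro ennreal_mult[symmetric]) auto
  finally show ?thesis using \<rho> by (simp add: measure_def)
qed

text \<open>
  Mean values over a cylinder, taken in the sense of Lebesgue measure, become integrals of Borel functions with respect to
  \<open>P\<^sub>1\<close>.
\<close>

lemma cylinder_transfer:
  fixes f f' :: "(real ^ 'n::finite) \<times> real \<Rightarrow> real"
  assumes \<rho>: "0 < \<rho>" and [measurable]: "f' \<in> borel_measurable borel"
    and eq: "AE w in P\<^sub>1. f (cyl_map (x0, t0) \<rho> w) = f' w"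
  shows "f \<in> borel_measurable (lebesgue_on (parabolic_cylinder x0 t0 \<rho>))"
    "integrable (lebesgue_on (parabolic_cylinder x0 t0 \<rho>)) f \<longleftrightarrow> integrable P\<^sub>1 f'"
    "mean (parabolic_cylinder x0 t0 \<rho>) f = (LINT w|P\<^sub>1. f' w)"
proof -
  define Q where "Q = parabolic_cylinder x0 t0 \<rho>"
  define R where "R = cyl_inv (x0, t0) \<rho>"
  have [measurable]: "R \<in> borel_measurable borel" by (simp add: R_def)
  have ind: "indicator Q z = (indicator Q\<^sub>1 (R z) :: real)" for z
    using cyl_inv_in_Q1[OF \<rho>, of x0 t0 z] by (simp add: indicator_def Q_def R_def)
  have "AE w in lborel. w \<in> Q\<^sub>1 \<longrightarrow> f (cyl_map (x0, t0) \<rho> w) = f' w" using eq by (simp add: AE_P1)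
  from AE_cyl_inv[OF \<rho> this, of "(x0, t0)"]
  have AE: "AE z in lborel. z \<in> Q \<longrightarrow> f z = f' (R z)"
    using \<rho> by (simp add: cyl_map_inv R_def Q_def cyl_inv_in_Q1)
  have Q: "Q \<in> sets borel" by (simp add: Q_def)
  note bv = borel_version_on[OF Q _ AE, simplified]
  show "f \<in> borel_measurable (lebesgue_on Q)" by (rule bv(1)) measurable
  have "integrable (lebesgue_on Q) f \<longleftrightarrow> integrable lborel (\<lambda>z. indicator Q\<^sub>1 (R z) * f' (R z))"
    using bv(2) by (simp add: ind)
  also have "\<dots> \<longleftrightarrow> integrable lborel (\<lambda>w. indicator Q\<^sub>1 w * f' w)"
    unfolding R_def by (rule integrable_cyl_inv_iff[OF _ \<rho>]) measurable
  finally show "integrable (lebesgue_on Q) f \<longleftrightarrow> integrable P\<^sub>1 f'" by (simp add: integrable_P1_iff)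
  have "(LINT z|lebesgue_on Q. f z) = (LINT z|lborel. indicator Q\<^sub>1 (R z) * f' (R z))"
    using bv(3) by (simp add: ind)
  also have "\<dots> = \<rho> ^ (CARD('n) + 2) * (LINT w|lborel. indicator Q\<^sub>1 w * f' w)"
    unfolding R_def by (rule integral_cyl_inv[OF _ \<rho>]) measurable
  finally have int: "(LINT z|lebesgue_on Q. f z) = \<rho> ^ (CARD('n) + 2) * (LINT w|lborel. indicator Q\<^sub>1 w * f' w)" .
  show "mean Q f = (LINT w|P\<^sub>1. f' w)"
  proof -
    have "measure lebesgue Q = \<rho> ^ (CARD('n) + 2) * (2 * unit_ball_vol CARD('n))"
      unfolding Q_def by (rule measure_parabolic_cylinder[OF \<rho>])
    then show ?thesis using \<rho> unfolding mean_def integral_P1[OF assms(2)] int by simp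
  qed
qed

section \<open>Measurability and Borel versions\<close>

lemma tendsto_fun_componentwise:
  fixes f :: "'a \<Rightarrow> 'i \<Rightarrow> 'b::topological_space"
  assumes "\<And>i. ((\<lambda>k. f k i) \<longlongrightarrow> l i) F"
  shows "(f \<longlongrightarrow> l) F"
proof -
  have "limitin (product_topology (\<lambda>i. euclidean) UNIV) f l F"
    using assms by (simp add: limitin_componentwise)
  then show ?thesis by (simp add: euclidean_product_topology)
qed

lemma tendsto_fun_component:
  fixes f :: "'a \<Rightarrow> 'i \<Rightarrow> 'b::topological_space"
  assumes "(f \<longlongrightarrow> l) F"
  shows "((\<lambda>k. f k i) \<longlongrightarrow> l i) F"
proof -
  have "limitin (product_topology (\<lambda>i. euclidean) UNIV) f l F"
    using assms by (simp add: euclidean_product_topology)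
  then show ?thesis by (simp add: limitin_componentwise)
qed

text \<open>
  For a simple function \<open>\<sigma>\<close> the composition is a countable patchwork of the measurable functions
  \<open>A(\<cdot>, v)\<close>; simple functions converging to \<open>\<xi>\<close> pass the measurability on by the continuity of
  \<open>A(z, \<cdot>)\<close> and the completeness of Lebesgue measure.
\<close>

lemma caratheodory_composition_measurable:
  fixes A :: "'a::euclidean_space \<Rightarrow> (nat \<Rightarrow> real ^ 'n::finite) \<Rightarrow> (nat \<Rightarrow> real ^ 'n)"
  assumes S: "S \<in> sets lebesgue" and A: "caratheodory N S A"
    and \<xi>: "\<And>z. z \<in> S \<Longrightarrow> \<xi> z \<in> tuples N" "\<And>i. i < N \<Longrightarrow> (\<lambda>z. \<xi> z i) \<in> borel_measurable (lebesgue_on S)"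
    and j: "j < N"
  shows "(\<lambda>z. A z (\<xi> z) j) \<in> borel_measurable (lebesgue_on S)"
proof -
  have "\<exists>s. (\<forall>k. simple_function (lebesgue_on S) (s k)) \<and> (\<forall>z\<in>space (lebesgue_on S). (\<lambda>k. s k z) \<longlonglongrightarrow> \<xi> z i)" if "i < N" for i
    using borel_measurable_implies_sequence_metric[OF \<xi>(2)[OF that], of 0] by blast
  then obtain s where s: "\<And>i k. i < N \<Longrightarrow> simple_function (lebesgue_on S) (s i k)"
    and lim: "\<And>i z. i < N \<Longrightarrow> z \<in> S \<Longrightarrow> (\<lambda>k. s i k z) \<longlonglongrightarrow> \<xi> z i"
    by (metis space_restrict_space Int_UNIV_right space_completion space_lborel UNIV_I inf_commute space_lebesgue_on)
  \<comment> \<open>Components from \<open>N\<close> on are zero, so that the values stay in the set on which \<open>A z\<close> is continuous.\<close>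
  define \<sigma> where "\<sigma> k z = (\<lambda>i. if i < N then s i k z else 0)" for k z
  have \<sigma>t: "\<sigma> k z \<in> tuples N" for k z by (simp add: \<sigma>_def tuples_def)
  have fin: "finite (\<sigma> k ` S)" for k
  proof -
    have "\<sigma> k ` S \<subseteq> {f. \<forall>i. (i \<in> {..<N} \<longrightarrow> f i \<in> (\<Union>i<N. s i k ` S)) \<and> (i \<notin> {..<N} \<longrightarrow> f i = 0)}"
      by (auto simp: \<sigma>_def) blast
    moreover have "finite (\<Union>i<N. s i k ` S)"
      using s by (auto simp: simple_function_def)
    ultimately show ?thesis
      using finite_set_of_finite_funs[of "{..<N}" "\<Union>i<N. s i k ` S" 0] finite_subset by blast
  qed
  have meas_\<sigma>: "\<sigma> k \<in> measurable (lebesgue_on S) (count_space (\<sigma> k ` S))" for k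
  proof (subst measurable_count_space_eq2[OF fin], intro conjI ballI)
    show "\<sigma> k \<in> space (lebesgue_on S) \<rightarrow> \<sigma> k ` S" by auto
    fix v assume "v \<in> \<sigma> k ` S"
    then have v: "v i = 0" if "i \<ge> N" for i using that by (auto simp: \<sigma>_def)
    have "\<sigma> k -` {v} \<inter> space (lebesgue_on S) = {z \<in> space (lebesgue_on S). \<forall>i\<in>{..<N}. s i k z = v i}"
      using v by (auto simp: \<sigma>_def fun_eq_iff)
    also have "\<dots> \<in> sets (lebesgue_on S)"
    proof (intro sets.sets_Collect_finite_All)
      fix i assume "i \<in> {..<N}"
      then have "s i k \<in> borel_measurable (lebesgue_on S)" using s by (intro borel_measurable_simple_function) auto
      then show "{z \<in> space (lebesgue_on S). s i k z = v i} \<in> sets (lebesgue_on S)" by measurable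
    qed simp
    finally show "\<sigma> k -` {v} \<inter> space (lebesgue_on S) \<in> sets (lebesgue_on S)" .
  qed
  have meas: "(\<lambda>z. A z (\<sigma> k z) j) \<in> borel_measurable (lebesgue_on S)" for k
  proof (rule measurable_compose_countable'[OF _ meas_\<sigma>, where f="\<lambda>v z. A z v j"])
    show "(\<lambda>z. A z v j) \<in> borel_measurable (lebesgue_on S)" if "v \<in> \<sigma> k ` S" for v
      using A that \<sigma>t j by (auto simp: caratheodory_def)
    show "countable (\<sigma> k ` S)" using fin by (rule countable_finite)
  qed
  have "AE z in lebesgue_on S. (\<lambda>k. A z (\<sigma> k z) j) \<longlonglongrightarrow> A z (\<xi> z) j"
  proof -
    have "AE z in lebesgue_on S. continuous_on (tuples N) (A z)" using A by (simp add: caratheodory_def)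
    moreover have "AE z in lebesgue_on S. z \<in> S" by (rule AE_I2) simp
    ultimately show ?thesis
    proof eventually_elim
      case (elim z)
      have "(\<lambda>k. \<sigma> k z) \<longlonglongrightarrow> \<xi> z"
      proof (rule tendsto_fun_componentwise)
        fix i
        show "(\<lambda>k. \<sigma> k z i) \<longlonglongrightarrow> \<xi> z i"
          using lim[of i z] elim(2) \<xi>(1)[of z] by (cases "i < N") (auto simp: \<sigma>_def tuples_def)
      qed
      then have "(\<lambda>k. A z (\<sigma> k z)) \<longlonglongrightarrow> A z (\<xi> z)"
        by (rule continuous_on_tendsto_compose[OF elim(1)]) (use \<sigma>t \<xi>(1) elim(2) in auto)
      then show ?case by (rule tendsto_fun_component)
    qed
  qed
  then obtain E where E: "E \<in> null_sets (lebesgue_on S)" "{z \<in> space (lebesgue_on S). \<not> (\<lambda>k. A z (\<sigma> k z) j) \<longlonglongrightarrow> A z (\<xi> z) j} \<subseteq> E"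
    by (auto elim!: AE_E simp: null_sets_def)
  have "(\<lambda>z. indicator (- E) z *\<^sub>R A z (\<xi> z) j) \<in> borel_measurable (lebesgue_on S)"
  proof (rule borel_measurable_LIMSEQ_metric)
    have Em: "E \<in> sets (lebesgue_on S)" using E by auto
    show "(\<lambda>z. indicator (- E) z *\<^sub>R A z (\<sigma> k z) j) \<in> borel_measurable (lebesgue_on S)" for k
    proof (intro borel_measurable_scaleR meas)
      have "(\<lambda>z. 1 - indicator E z :: real) \<in> borel_measurable (lebesgue_on S)" using Em by measurable
      moreover have "indicator (- E) z = (1 - indicator E z :: real)" for z by (simp add: indicator_def)
      ultimately show "(indicator (- E) :: 'a \<Rightarrow> real) \<in> borel_measurable (lebesgue_on S)" by presburger
    qed
    fix z assume z: "z \<in> space (lebesgue_on S)"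
    show "(\<lambda>k. indicator (- E) z *\<^sub>R A z (\<sigma> k z) j) \<longlonglongrightarrow> indicator (- E) z *\<^sub>R A z (\<xi> z) j"
    proof (cases "z \<in> E")
      case False
      then have "(\<lambda>k. A z (\<sigma> k z) j) \<longlonglongrightarrow> A z (\<xi> z) j" using E(2) z by blast
      then show ?thesis by (intro tendsto_intros)
    qed simp
  qed
  then have m: "(\<lambda>z. indicator S z *\<^sub>R (indicator (- E) z *\<^sub>R A z (\<xi> z) j)) \<in> borel_measurable lebesgue"
    using S by (subst (asm) borel_measurable_restrict_space_iff) auto
  have "AE z in lebesgue. z \<notin> E"
    using E(1) S by (intro AE_not_in) (simp add: null_sets_restrict_space)
  then have "AE z in lebesgue. indicator S z *\<^sub>R (indicator (- E) z *\<^sub>R A z (\<xi> z) j) = indicator S z *\<^sub>R A z (\<xi> z) j"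
    by eventually_elim simp
  from borel_measurable_AE[OF m this] show ?thesis
    using S by (subst borel_measurable_restrict_space_iff) auto
qed

lemma ex_borel_version:
  fixes f :: "'a::euclidean_space \<Rightarrow> real"
  assumes S: "S \<in> sets borel" and f: "f \<in> borel_measurable (lebesgue_on S)"
  shows "\<exists>f'. f' \<in> borel_measurable borel \<and> (\<forall>z. z \<notin> S \<longrightarrow> f' z = 0) \<and> (AE z in lborel. z \<in> S \<longrightarrow> f' z = f z)"
proof -
  have "(\<lambda>z. indicator S z *\<^sub>R f z) \<in> borel_measurable lebesgue"
    using f S by (subst (asm) borel_measurable_restrict_space_iff) auto
  then obtain g where g: "g \<in> borel_measurable lborel" "AE z in lborel. indicator S z *\<^sub>R f z = g z"
    using completion_ex_borel_measurable_real by blast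
  define f' where "f' z = indicator S z * g z" for z
  have "f' \<in> borel_measurable borel" unfolding f'_def using g S by simp
  moreover have "AE z in lborel. z \<in> S \<longrightarrow> f' z = f z"
    using g(2) by eventually_elim (auto simp: f'_def)
  moreover have "\<forall>z. z \<notin> S \<longrightarrow> f' z = 0" by (simp add: f'_def)
  ultimately show ?thesis by blast
qed

lemma ex_borel_version_vec:
  fixes f :: "'a::euclidean_space \<Rightarrow> real ^ 'n::finite"
  assumes S: "S \<in> sets borel" and f: "f \<in> borel_measurable (lebesgue_on S)"
  shows "\<exists>f'. f' \<in> borel_measurable borel \<and> (\<forall>z. z \<notin> S \<longrightarrow> f' z = 0) \<and> (AE z in lborel. z \<in> S \<longrightarrow> f' z = f z)"
proof -
  have "\<forall>j. \<exists>f'. f' \<in> borel_measurable borel \<and> (\<forall>z. z \<notin> S \<longrightarrow> f' z = 0) \<and> (AE z in lborel. z \<in> S \<longrightarrow> f' z = f z $ j)"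
    using ex_borel_version[OF S measurable_vec_component[OF f]] by blast
  from choice[OF this] obtain F where "\<forall>j. F j \<in> borel_measurable borel \<and> (\<forall>z. z \<notin> S \<longrightarrow> F j z = 0)
      \<and> (AE z in lborel. z \<in> S \<longrightarrow> F j z = f z $ j)" by (rule exE)
  then have F: "\<And>j. F j \<in> borel_measurable borel" "\<And>j z. z \<notin> S \<Longrightarrow> F j z = 0"
    "\<And>j. AE z in lborel. z \<in> S \<longrightarrow> F j z = f z $ j" by simp_all
  define f' where "f' z = (\<chi> j. F j z)" for z
  have "f' \<in> borel_measurable borel"
  proof -
    have "f' = (\<lambda>z. \<Sum>j\<in>UNIV. F j z *\<^sub>R axis j 1)"
      by (auto simp: f'_def fun_eq_iff vec_eq_iff axis_def if_distrib[of "\<lambda>x. _ * x"] cong: if_cong)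
    then show ?thesis using F(1) by simp
  qed
  moreover have "AE z in lborel. \<forall>j\<in>UNIV. z \<in> S \<longrightarrow> F j z = f z $ j"
    using F(3) by (subst AE_finite_all) auto
  then have "AE z in lborel. z \<in> S \<longrightarrow> f' z = f z"
    by eventually_elim (auto simp: f'_def vec_eq_iff)
  moreover have "\<forall>z. z \<notin> S \<longrightarrow> f' z = 0" using F(2) by (simp add: f'_def vec_eq_iff)
  ultimately show ?thesis by blast
qed

text \<open>Tonelli's theorem for an exceptional null set, with the time as the outer variable.\<close>

lemma AE_lborel_slices:
  fixes P :: "'a::euclidean_space \<times> 'b::euclidean_space \<Rightarrow> bool"
  assumes "AE z in lborel. P z"
  shows "AE t in lborel. AE x in lborel. P (x, t)"
proof -
  obtain E where E: "E \<in> null_sets lborel" "{z. \<not> P z} \<subseteq> E"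
    using assms by (auto elim!: AE_E simp: null_sets_def)
  then have Eb: "E \<in> sets borel" "emeasure lborel E = 0" by auto
  then have [measurable]: "E \<in> sets (lborel \<Otimes>\<^sub>M lborel)" by (simp only: lborel_prod sets_lborel)
  have "(\<integral>\<^sup>+t. \<integral>\<^sup>+x. indicator E (x, t) \<partial>lborel \<partial>lborel) = (\<integral>\<^sup>+z. indicator E z \<partial>(lborel \<Otimes>\<^sub>M lborel))"
    by (rule lborel_pair.nn_integral_snd) measurable
  also have "\<dots> = 0" using Eb by (simp add: lborel_prod)
  finally have "AE t in lborel. (\<integral>\<^sup>+x. indicator E (x, t) \<partial>lborel) = 0"
    by (subst (asm) nn_integral_0_iff_AE) measurable
  then show ?thesis
  proof eventually_elim
    case (elim t)
    then have "AE x in lborel. (indicator E (x, t) :: ennreal) = 0"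
      by (subst (asm) nn_integral_0_iff_AE) measurable
    then show ?case by eventually_elim (use E(2) in \<open>auto simp: indicator_def split: if_splits\<close>)
  qed
qed

section \<open>The weak equation on a cylinder\<close>

lemma norm_le_tnorm: "i < N \<Longrightarrow> norm (v i) \<le> tnorm N v"
  unfolding tnorm_def using member_le_L2_set[of "{..<N}" i "\<lambda>i. norm (v i)"] by simp

lemma le_one_plus_powr: "0 \<le> x \<Longrightarrow> 1 \<le> q \<Longrightarrow> x \<le> 1 + x powr q" for x q :: real
proof (cases "x \<le> 1")
  case False
  assume "1 \<le> q"
  then have "x powr 1 \<le> x powr q" using False by (intro powr_mono) auto
  then show ?thesis using False by simp
qed (use powr_ge_zero[of x q] in linarith)

lemma test_function_mono: "test_function S \<psi> \<Longrightarrow> S \<subseteq> T \<Longrightarrow> test_function T \<psi>"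
  by (auto simp: test_function_def compactly_inside_def)

lemma test_function_zero: "test_function S (\<lambda>z. 0)"
  by (auto simp: test_function_def compactly_inside_def C_k_const)

lemma test_function_slice:
  fixes \<psi> :: "(real ^ 'n::finite) \<times> real \<Rightarrow> real"
  assumes \<psi>: "test_function (B \<times> I) \<psi>"
  shows "test_function B (\<lambda>x. \<psi> (x, t))"
    "partial_x (\<lambda>x. \<psi> (x, t)) j x = grad_x \<psi> (x, t) $ j"
proof -
  have bl: "bounded_linear (\<lambda>x :: real ^ 'n. (x, 0 :: real))"
    by (intro bounded_linear_Pair bounded_linear_ident bounded_linear_zero)
  have der: "((\<lambda>x. \<psi> (x, t)) has_derivative (\<lambda>v. frechet_derivative \<psi> (at (x, t)) (v, 0))) (at x)"
  proof -
    have "((\<lambda>x. (x, t)) has_derivative (\<lambda>v. (v, 0))) (at x)"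
      by (intro has_derivative_Pair has_derivative_ident has_derivative_const)
    from diff_chain_at[OF this test_function_has_derivative[OF \<psi>]]
    show ?thesis by (simp add: o_def)
  qed
  show "partial_x (\<lambda>x. \<psi> (x, t)) j x = grad_x \<psi> (x, t) $ j"
    using frechet_derivative_at[OF der] unfolding partial_x_def grad_x_def by (simp add: fun_eq_iff)
  define K where "K = closure {z. \<psi> z \<noteq> 0}"
  have K: "compact K" "K \<subseteq> B \<times> I"
    using \<psi> by (auto simp: test_function_def compactly_inside_def K_def)
  have cK: "compact (fst ` K)" by (intro compact_continuous_image continuous_intros K)
  have "{x. \<psi> (x, t) \<noteq> 0} \<subseteq> fst ` K"
  proof
    fix x assume "x \<in> {x. \<psi> (x, t) \<noteq> 0}"
    then have "(x, t) \<in> {z. \<psi> z \<noteq> 0}" by simp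
    then have "(x, t) \<in> K" unfolding K_def by (rule subsetD[OF closure_subset])
    then show "x \<in> fst ` K" by (rule image_eqI[rotated]) simp
  qed
  then have cl: "closure {x. \<psi> (x, t) \<noteq> 0} \<subseteq> fst ` K"
    using cK by (intro closure_minimal compact_imp_closed)
  show "test_function B (\<lambda>x. \<psi> (x, t))"
    unfolding test_function_def compactly_inside_def
  proof (intro conjI allI)
    show "C_k k (\<lambda>x. \<psi> (x, t))" for k
    proof -
      have "C_k k (\<lambda>x. \<psi> ((0, t) + (x, 0)))"
        using \<psi> by (intro C_k_compose_affine[OF bl]) (simp add: test_function_def)
      then show ?thesis by simp
    qed
    show "compact (closure {x. \<psi> (x, t) \<noteq> 0})"
      using cK cl by (meson bounded_subset closed_closure compact_eq_bounded_closed)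
    show "closure {x. \<psi> (x, t) \<noteq> 0} \<subseteq> B"
    proof (rule subset_trans[OF cl], rule image_subsetI)
      fix z assume "z \<in> K"
      then have "z \<in> B \<times> I" using K(2) by (rule subsetD[rotated])
      then show "fst z \<in> B" by (rule mem_Times_iff[THEN iffD1, THEN conjunct1])
    qed
  qed
qed

lemma parabolic_cylinder_compactly_inside:
  fixes x0 :: "real ^ 'n::finite"
  assumes \<rho>: "0 < \<rho>" and sub: "parabolic_cylinder x0 t0 \<rho> \<Subset> time_cylinder \<Omega> T"
  shows "ball x0 \<rho> \<Subset> \<Omega>" "0 < t0 - \<rho>\<^sup>2" "t0 + \<rho>\<^sup>2 < T"
    "parabolic_cylinder x0 t0 \<rho> \<subseteq> time_cylinder \<Omega> T"
proof -
  have I: "{t0 - \<rho>\<^sup>2<..<t0 + \<rho>\<^sup>2} \<noteq> {}" using \<rho> by simp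
  have "closure (parabolic_cylinder x0 t0 \<rho>) = cball x0 \<rho> \<times> {t0 - \<rho>\<^sup>2..t0 + \<rho>\<^sup>2}"
    using \<rho> unfolding parabolic_cylinder_def by (simp add: closure_Times)
  then have *: "cball x0 \<rho> \<times> {t0 - \<rho>\<^sup>2..t0 + \<rho>\<^sup>2} \<subseteq> \<Omega> \<times> {0<..<T}"
    using sub by (simp add: compactly_inside_def time_cylinder_def)
  have "(x0, t0 - \<rho>\<^sup>2) \<in> cball x0 \<rho> \<times> {t0 - \<rho>\<^sup>2..t0 + \<rho>\<^sup>2}" "(x0, t0 + \<rho>\<^sup>2) \<in> cball x0 \<rho> \<times> {t0 - \<rho>\<^sup>2..t0 + \<rho>\<^sup>2}"
    using \<rho> by auto
  from this[THEN subsetD[OF *]] show "0 < t0 - \<rho>\<^sup>2" "t0 + \<rho>\<^sup>2 < T" by auto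
  have "cball x0 \<rho> \<subseteq> \<Omega>"
  proof
    fix x assume "x \<in> cball x0 \<rho>"
    then have "(x, t0) \<in> cball x0 \<rho> \<times> {t0 - \<rho>\<^sup>2..t0 + \<rho>\<^sup>2}" using \<rho> by auto
    from subsetD[OF * this] show "x \<in> \<Omega>" by auto
  qed
  then show "ball x0 \<rho> \<Subset> \<Omega>" using \<rho> by (simp add: compactly_inside_def)
  show "parabolic_cylinder x0 t0 \<rho> \<subseteq> time_cylinder \<Omega> T"
    using sub closure_subset unfolding compactly_inside_def by blast
qed

lemma integrable_lebesgue_on_bound:
  fixes f :: "'a::euclidean_space \<Rightarrow> 'b::{banach, second_countable_topology}" and g :: "'a \<Rightarrow> real"
  assumes "integrable (lebesgue_on S) g" "f \<in> borel_measurable (lebesgue_on S)"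
    "AE z in lebesgue_on S. norm (f z) \<le> g z"
  shows "integrable (lebesgue_on S) f"
  by (rule Bochner_Integration.integrable_bound[OF assms(1,2)]) (use assms(3) in eventually_elim, simp)

text \<open>
  For almost every time the slice of \<open>\<psi>\<close> is admissible in the definition of the weak gradient of \<open>u(\<cdot>, t)\<close>;
  integration over the time gives the identity on the cylinder.
\<close>

lemma weak_gradient_of_slices:
  fixes u :: "(real ^ 'n::finite) \<times> real \<Rightarrow> real" and g :: "(real ^ 'n) \<times> real \<Rightarrow> real ^ 'n"
  assumes slices: "AE t in lebesgue_on {t1<..<t2}. W1q q B (\<lambda>x. u (x, t)) (\<lambda>x. g (x, t))"
    and B: "open B"
    and u': "integrable lborel u'" "AE z in lborel. z \<in> B \<times> {t1<..<t2} \<longrightarrow> u' z = u z" "\<And>z. z \<notin> B \<times> {t1<..<t2} \<Longrightarrow> u' z = 0"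
    and g': "integrable lborel g'" "AE z in lborel. z \<in> B \<times> {t1<..<t2} \<longrightarrow> g' z = g z" "\<And>z. z \<notin> B \<times> {t1<..<t2} \<Longrightarrow> g' z = 0"
    and \<psi>: "test_function (B \<times> {t1<..<t2}) \<psi>"
  shows "(LINT z|lborel. u' z * grad_x \<psi> z $ j) = - (LINT z|lborel. g' z $ j * \<psi> z)"
proof -
  note [measurable] = test_function_measurable[OF \<psi>]
  have [measurable]: "u' \<in> borel_measurable borel" "g' \<in> borel_measurable borel"
    using u'(1) g'(1) by (auto dest!: borel_measurable_integrable)
  have Bb: "B \<in> sets borel" using B by simp
  have 1: "integrable (lborel \<Otimes>\<^sub>M lborel) (\<lambda>(x, t). u' (x, t) * grad_x \<psi> (x, t) $ j)"
    using integrable_mult_test_function(2)[OF \<psi> u'(1), of "(axis j 1, 0)"]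
    by (simp add: lborel_prod grad_x_def case_prod_unfold)
  have 2: "integrable (lborel \<Otimes>\<^sub>M lborel) (\<lambda>(x, t). g' (x, t) $ j * \<psi> (x, t))"
    using integrable_mult_test_function(1)[OF \<psi> integrable_vec_nth[OF g'(1)]]
    by (simp add: lborel_prod case_prod_unfold)
  have sl: "AE t in lborel. t \<in> {t1<..<t2} \<longrightarrow> W1q q B (\<lambda>x. u (x, t)) (\<lambda>x. g (x, t))"
    using slices by (simp add: lebesgue_on_AE_iff_lborel)
  have "AE t in lborel. (LINT x|lborel. u' (x, t) * grad_x \<psi> (x, t) $ j) = - (LINT x|lborel. g' (x, t) $ j * \<psi> (x, t))"
    using sl AE_lborel_slices[OF u'(2)] AE_lborel_slices[OF g'(2)]
  proof eventually_elim
    case (elim t)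
    show ?case
    proof (cases "t \<in> {t1<..<t2}")
      case False
      then have "u' (x, t) = 0" "g' (x, t) = 0" for x using u'(3) g'(3) by auto
      then show ?thesis by simp
    next
      case True
      have W: "(LINT x|lebesgue_on B. u (x, t) * partial_x (\<lambda>x. \<psi> (x, t)) j x) = - (LINT x|lebesgue_on B. (g (x, t) $ j) * \<psi> (x, t))"
        using elim(1) True test_function_slice(1)[OF \<psi>] by (simp add: W1q_def)
      have "(LINT x|lebesgue_on B. u (x, t) * partial_x (\<lambda>x. \<psi> (x, t)) j x) = (LINT x|lborel. indicator B x * (u' (x, t) * grad_x \<psi> (x, t) $ j))"
      proof (rule borel_version_on(3)[OF Bb])
        show "(\<lambda>x. u' (x, t) * grad_x \<psi> (x, t) $ j) \<in> borel_measurable borel" by measurable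
        show "AE x in lborel. x \<in> B \<longrightarrow> u (x, t) * partial_x (\<lambda>x. \<psi> (x, t)) j x = u' (x, t) * grad_x \<psi> (x, t) $ j"
          using elim(2) by eventually_elim (use True in \<open>auto simp: test_function_slice(2)[OF \<psi>]\<close>)
      qed
      also have "\<dots> = (LINT x|lborel. u' (x, t) * grad_x \<psi> (x, t) $ j)"
        using u'(3) by (intro Bochner_Integration.integral_cong) (auto simp: indicator_def)
      finally have 1: "(LINT x|lebesgue_on B. u (x, t) * partial_x (\<lambda>x. \<psi> (x, t)) j x) = (LINT x|lborel. u' (x, t) * grad_x \<psi> (x, t) $ j)" .
      have "(LINT x|lebesgue_on B. (g (x, t) $ j) * \<psi> (x, t)) = (LINT x|lborel. indicator B x * (g' (x, t) $ j * \<psi> (x, t)))"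
      proof (rule borel_version_on(3)[OF Bb])
        show "(\<lambda>x. g' (x, t) $ j * \<psi> (x, t)) \<in> borel_measurable borel" by measurable
        show "AE x in lborel. x \<in> B \<longrightarrow> (g (x, t) $ j) * \<psi> (x, t) = g' (x, t) $ j * \<psi> (x, t)"
          using elim(3) by eventually_elim (use True in auto)
      qed
      also have "\<dots> = (LINT x|lborel. g' (x, t) $ j * \<psi> (x, t))"
        using g'(3) by (intro Bochner_Integration.integral_cong) (auto simp: indicator_def)
      finally show ?thesis using W 1 by simp
    qed
  qed
  then have "(LINT t|lborel. LINT x|lborel. u' (x, t) * grad_x \<psi> (x, t) $ j) = (LINT t|lborel. - (LINT x|lborel. g' (x, t) $ j * \<psi> (x, t)))"
    using lborel_pair.integrable_snd[OF 1] lborel_pair.integrable_snd[OF 2]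
    by (intro integral_cong_AE) (auto dest: borel_measurable_integrable)
  also have "\<dots> = - (LINT t|lborel. LINT x|lborel. g' (x, t) $ j * \<psi> (x, t))" by simp
  finally show ?thesis
    using lborel_pair.integral_snd[OF 1] lborel_pair.integral_snd[OF 2]
    by (simp add: lborel_prod case_prod_unfold)
qed

text \<open>
  The passage from the system to Borel functions on the cylinder.  The cylinder itself is an admissible choice of
  \<open>\<Omega>' \<times> (t\<^sub>1, t\<^sub>2)\<close> in the definition of the function space, and the equation is tested with functions that have only one
  nonzero component.
\<close>

lemma solution_weak_flux:
  fixes \<Omega> :: "(real ^ 'n::finite) set"
  assumes sol: "parabolic_system_solution q \<nu> L N \<Omega> T A F u Du" and q: "1 \<le> q" and \<rho>: "0 < \<rho>"
    and Q: "Q = parabolic_cylinder x0 t0 \<rho>" and sub: "Q \<Subset> time_cylinder \<Omega> T"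
  obtains u' g' G' F' where
    "\<And>i. i < N \<Longrightarrow> weak_flux Q (u' i) (g' i) (G' i)"
    "\<And>i z. i < N \<Longrightarrow> z \<notin> Q \<Longrightarrow> g' i z = 0 \<and> G' i z = 0"
    "\<And>i. i < N \<Longrightarrow> F' i \<in> borel_measurable borel"
    "AE z in lborel. z \<in> Q \<longrightarrow> (\<forall>i<N. u' i z = u z i \<and> g' i z = Du z i \<and> F' i z = F z i)"
    "AE z in lborel. z \<in> Q \<longrightarrow> tnorm N (\<lambda>i. G' i z) \<le> L * tnorm N (\<lambda>i. g' i z) + tnorm N (\<lambda>i. F' i z)"
    "integrable (lebesgue_on Q) (\<lambda>z. (tnorm N (Du z) + tnorm N (F z)) powr q)"
proof -
  define S where "S = time_cylinder \<Omega> T"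
  define B where "B = ball x0 \<rho>"
  define t1 t2 where "t1 = t0 - \<rho>\<^sup>2" and "t2 = t0 + \<rho>\<^sup>2"
  have QB: "Q = B \<times> {t1<..<t2}" by (simp add: Q parabolic_cylinder_def B_def t1_def t2_def)
  note geo = parabolic_cylinder_compactly_inside[OF \<rho> sub[unfolded Q]]
  have QS: "Q \<subseteq> S" using geo(4) by (simp add: Q S_def)
  have L: "0 < L" and S_open: "open S" and A: "caratheodory N S A" and str: "structure_conditions \<nu> L N S A"
    and Ft: "\<And>z. z \<in> S \<Longrightarrow> F z \<in> tuples N" and Fm: "\<And>i. i < N \<Longrightarrow> (\<lambda>z. F z i) \<in> borel_measurable (lebesgue_on S)"
    and FL: "Lq_loc q S (\<lambda>z. tnorm N (F z))" and LW: "LqW1q_loc q N \<Omega> T u Du" and eqn: "satisfies_weak_equation N S A F u Du"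
    using sol by (auto simp: parabolic_system_solution_def S_def time_cylinder_def intro: open_Times)
  have Sb: "S \<in> sets borel" using S_open by simp
  have Qb: "Q \<in> sets borel" by (simp add: Q)
  have QL: "Q \<in> sets lebesgue" and SL: "S \<in> sets lebesgue" using Qb Sb by simp_all
  have Dut: "\<And>z. z \<in> S \<Longrightarrow> Du z \<in> tuples N"
    and um: "\<And>i. i < N \<Longrightarrow> (\<lambda>z. u z i) \<in> borel_measurable (lebesgue_on S)"
    and Dum: "\<And>i. i < N \<Longrightarrow> (\<lambda>z. Du z i) \<in> borel_measurable (lebesgue_on S)"
    using LW by (auto simp: LqW1q_loc_def S_def)
  have "open B \<and> B \<Subset> \<Omega> \<and> 0 < t1 \<and> t1 < t2 \<and> t2 < T"
    using geo \<rho> by (auto simp: B_def t1_def t2_def)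
  then have slices: "AE t in lebesgue_on {t1<..<t2}. \<forall>i<N. W1q q B (\<lambda>x. u (x, t) i) (\<lambda>x. Du (x, t) i)"
    and int_uDu: "integrable (lebesgue_on Q) (\<lambda>z. tnorm N (u z) powr q + tnorm N (Du z) powr q)"
    using LW unfolding LqW1q_loc_def QB by blast+
  define a where "a z i = A z (Du z) i" for z i
  have am: "(\<lambda>z. a z i) \<in> borel_measurable (lebesgue_on S)" if "i < N" for i
    unfolding a_def by (rule caratheodory_composition_measurable[OF SL A Dut Dum that])
  have toQ: "f \<in> borel_measurable (lebesgue_on S) \<Longrightarrow> f \<in> borel_measurable (lebesgue_on Q)" for f :: "_ \<Rightarrow> 'b::topological_space"
    by (rule measurable_restrict_mono[OF _ QS])
  have "finite_measure (lebesgue_on Q)"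
  proof (rule finite_measure_lebesgue_on)
    have "bounded Q" unfolding QB B_def by (intro bounded_Times) auto
    then show "Q \<in> lmeasurable" using QL by (rule bounded_set_imp_lmeasurable)
  qed
  then interpret fQ: finite_measure "lebesgue_on Q" .
  have int_F: "integrable (lebesgue_on Q) (\<lambda>z. tnorm N (F z) powr q)"
  proof -
    have "compact (closure Q)" "closure Q \<subseteq> S" using sub by (auto simp: compactly_inside_def S_def)
    then have "integrable (lebesgue_on (closure Q)) (\<lambda>z. norm (tnorm N (F z)) powr q)"
      using FL by (auto simp: Lq_loc_def Lq_def)
    then have "set_integrable lebesgue (closure Q) (\<lambda>z. tnorm N (F z) powr q)"
      by (simp add: set_integrable_def integrable_restrict_space tnorm_nonneg)
    then have "set_integrable lebesgue Q (\<lambda>z. tnorm N (F z) powr q)"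
      by (rule set_integrable_subset) (use QL closure_subset in auto)
    then show ?thesis using QL by (simp add: set_integrable_def integrable_restrict_space)
  qed
  have mDu: "(\<lambda>z. tnorm N (Du z)) \<in> borel_measurable (lebesgue_on Q)"
    and mF: "(\<lambda>z. tnorm N (F z)) \<in> borel_measurable (lebesgue_on Q)"
    by (intro tnorm_measurable toQ Dum Fm; assumption)+
  \<comment> \<open>An integrable function that dominates all components of \<open>u\<close>, \<open>\<nabla>u\<close> and \<open>F\<close>, by \<open>x \<le> 1 + x\<^sup>q\<close>.\<close>
  define b where "b z = 2 + (tnorm N (u z) powr q + tnorm N (Du z) powr q) + tnorm N (F z) powr q" for z
  have int_b: "integrable (lebesgue_on Q) b"
    unfolding b_def using int_uDu int_F by auto
  have int_pow: "integrable (lebesgue_on Q) (\<lambda>z. (tnorm N (Du z) + tnorm N (F z)) powr q)"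
  proof (rule integrable_lebesgue_on_bound[where g="\<lambda>z. 2 powr q * b z"])
    show "integrable (lebesgue_on Q) (\<lambda>z. 2 powr q * b z)" using int_b by simp
    show "(\<lambda>z. (tnorm N (Du z) + tnorm N (F z)) powr q) \<in> borel_measurable (lebesgue_on Q)"
      using mDu mF by measurable
    show "AE z in lebesgue_on Q. norm ((tnorm N (Du z) + tnorm N (F z)) powr q) \<le> 2 powr q * b z"
    proof (rule AE_I2)
      fix z
      have "(tnorm N (Du z) + tnorm N (F z)) powr q \<le> 2 powr q * (tnorm N (Du z) powr q + tnorm N (F z) powr q)"
        using q by (intro powr_add_le tnorm_nonneg) auto
      also have "\<dots> \<le> 2 powr q * b z"
        by (intro mult_left_mono) (auto simp: b_def)
      finally show "norm ((tnorm N (Du z) + tnorm N (F z)) powr q) \<le> 2 powr q * b z" by simp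
    qed
  qed
  have comp: "norm (u z i) \<le> b z" "norm (Du z i) \<le> b z" "norm (F z i) \<le> b z" if "i < N" for i z
    using norm_le_tnorm[OF that, of "u z"] norm_le_tnorm[OF that, of "Du z"] norm_le_tnorm[OF that, of "F z"]
      le_one_plus_powr[OF tnorm_nonneg q, of N "u z"] le_one_plus_powr[OF tnorm_nonneg q, of N "Du z"] le_one_plus_powr[OF tnorm_nonneg q, of N "F z"]
      powr_ge_zero[of "tnorm N (u z)" q] powr_ge_zero[of "tnorm N (Du z)" q] powr_ge_zero[of "tnorm N (F z)" q]
    unfolding b_def by linarith+
  have struct: "AE z in lebesgue_on Q. tnorm N (a z) \<le> L * tnorm N (Du z)"
  proof -
    have "AE z in lborel. z \<in> S \<longrightarrow> (\<forall>\<xi> \<in> tuples N. \<nu> * (tnorm N \<xi>)\<^sup>2 \<le> tinner N (A z \<xi>) \<xi> \<and> tnorm N (A z \<xi>) \<le> L * tnorm N \<xi>)"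
      using str unfolding structure_conditions_def lebesgue_on_AE_iff_lborel[OF Sb] .
    then have "AE z in lborel. z \<in> Q \<longrightarrow> tnorm N (a z) \<le> L * tnorm N (Du z)"
    proof eventually_elim
      case (elim z)
      then show ?case using QS Dut[of z] unfolding a_def by auto
    qed
    then show ?thesis unfolding lebesgue_on_AE_iff_lborel[OF Qb] .
  qed
  have int_u: "integrable (lebesgue_on Q) (\<lambda>z. u z i)" and int_Du: "integrable (lebesgue_on Q) (\<lambda>z. Du z i)"
    and int_Fi: "integrable (lebesgue_on Q) (\<lambda>z. F z i)" if "i < N" for i
    using comp[OF that] um[OF that] Dum[OF that] Fm[OF that]
    by (auto intro!: integrable_lebesgue_on_bound[OF int_b] toQ)
  have int_a: "integrable (lebesgue_on Q) (\<lambda>z. a z i)" if "i < N" for i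
  proof (rule integrable_lebesgue_on_bound[where g="\<lambda>z. L * b z"])
    show "integrable (lebesgue_on Q) (\<lambda>z. L * b z)" using int_b by simp
    show "AE z in lebesgue_on Q. norm (a z i) \<le> L * b z"
      using struct
    proof eventually_elim
      case (elim z)
      have "tnorm N (Du z) \<le> b z"
        using le_one_plus_powr[OF tnorm_nonneg q, of N "Du z"] powr_ge_zero[of "tnorm N (u z)" q] powr_ge_zero[of "tnorm N (F z)" q]
        unfolding b_def by linarith
      then have "L * tnorm N (Du z) \<le> L * b z" using L by simp
      then show ?case using norm_le_tnorm[OF that, of "a z"] elim by linarith
    qed
  qed (rule toQ[OF am[OF that]])
  have "\<forall>i. \<exists>f. i < N \<longrightarrow> f \<in> borel_measurable borel \<and> (\<forall>z. z \<notin> Q \<longrightarrow> f z = 0) \<and> (AE z in lborel. z \<in> Q \<longrightarrow> f z = u z i)"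
    using ex_borel_version[OF Qb toQ[OF um]] by blast
  from choice[OF this] obtain u' where X: "\<forall>i. i < N \<longrightarrow> u' i \<in> borel_measurable borel \<and> (\<forall>z. z \<notin> Q \<longrightarrow> u' i z = 0) \<and> (AE z in lborel. z \<in> Q \<longrightarrow> u' i z = u z i)"
    by (rule exE)
  from X have u': "\<And>i. i < N \<Longrightarrow> u' i \<in> borel_measurable borel" "\<And>i z. i < N \<Longrightarrow> z \<notin> Q \<Longrightarrow> u' i z = 0"
    "\<And>i. i < N \<Longrightarrow> AE z in lborel. z \<in> Q \<longrightarrow> u' i z = u z i" by blast+
  have "\<forall>i. \<exists>f. i < N \<longrightarrow> f \<in> borel_measurable borel \<and> (\<forall>z. z \<notin> Q \<longrightarrow> f z = 0) \<and> (AE z in lborel. z \<in> Q \<longrightarrow> f z = Du z i)"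
    using ex_borel_version_vec[OF Qb toQ[OF Dum]] by blast
  from choice[OF this] obtain g' where X: "\<forall>i. i < N \<longrightarrow> g' i \<in> borel_measurable borel \<and> (\<forall>z. z \<notin> Q \<longrightarrow> g' i z = 0) \<and> (AE z in lborel. z \<in> Q \<longrightarrow> g' i z = Du z i)"
    by (rule exE)
  from X have g': "\<And>i. i < N \<Longrightarrow> g' i \<in> borel_measurable borel" "\<And>i z. i < N \<Longrightarrow> z \<notin> Q \<Longrightarrow> g' i z = 0"
    "\<And>i. i < N \<Longrightarrow> AE z in lborel. z \<in> Q \<longrightarrow> g' i z = Du z i" by blast+
  have "\<forall>i. \<exists>f. i < N \<longrightarrow> f \<in> borel_measurable borel \<and> (\<forall>z. z \<notin> Q \<longrightarrow> f z = 0) \<and> (AE z in lborel. z \<in> Q \<longrightarrow> f z = F z i)"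
    using ex_borel_version_vec[OF Qb toQ[OF Fm]] by blast
  from choice[OF this] obtain F' where X: "\<forall>i. i < N \<longrightarrow> F' i \<in> borel_measurable borel \<and> (\<forall>z. z \<notin> Q \<longrightarrow> F' i z = 0) \<and> (AE z in lborel. z \<in> Q \<longrightarrow> F' i z = F z i)"
    by (rule exE)
  from X have F': "\<And>i. i < N \<Longrightarrow> F' i \<in> borel_measurable borel" "\<And>i z. i < N \<Longrightarrow> z \<notin> Q \<Longrightarrow> F' i z = 0"
    "\<And>i. i < N \<Longrightarrow> AE z in lborel. z \<in> Q \<longrightarrow> F' i z = F z i" by blast+
  have "\<forall>i. \<exists>f. i < N \<longrightarrow> f \<in> borel_measurable borel \<and> (\<forall>z. z \<notin> Q \<longrightarrow> f z = 0) \<and> (AE z in lborel. z \<in> Q \<longrightarrow> f z = a z i)"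
    using ex_borel_version_vec[OF Qb toQ[OF am]] by blast
  from choice[OF this] obtain a' where X: "\<forall>i. i < N \<longrightarrow> a' i \<in> borel_measurable borel \<and> (\<forall>z. z \<notin> Q \<longrightarrow> a' i z = 0) \<and> (AE z in lborel. z \<in> Q \<longrightarrow> a' i z = a z i)"
    by (rule exE)
  from X have a': "\<And>i. i < N \<Longrightarrow> a' i \<in> borel_measurable borel" "\<And>i z. i < N \<Longrightarrow> z \<notin> Q \<Longrightarrow> a' i z = 0"
    "\<And>i. i < N \<Longrightarrow> AE z in lborel. z \<in> Q \<longrightarrow> a' i z = a z i" by blast+
  have int': "integrable lborel f'"
    if f: "integrable (lebesgue_on Q) f" and f': "f' \<in> borel_measurable borel" "\<And>z. z \<notin> Q \<Longrightarrow> f' z = 0" "AE z in lborel. z \<in> Q \<longrightarrow> f' z = f z"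
    for f f' :: "(real ^ 'n) \<times> real \<Rightarrow> real"
  proof -
    have "AE z in lborel. z \<in> Q \<longrightarrow> f z = f' z" using f'(3) by eventually_elim simp
    then have "integrable lborel (\<lambda>z. indicator Q z * f' z)"
      using borel_version_on(2)[OF Qb f'(1)] f by blast
    moreover have "(\<lambda>z. indicator Q z * f' z) = f'" using f'(2) by (auto simp: indicator_def fun_eq_iff)
    ultimately show ?thesis by simp
  qed
  have int'_vec: "integrable lborel f'"
    if f: "integrable (lebesgue_on Q) f" and f': "f' \<in> borel_measurable borel" "\<And>z. z \<notin> Q \<Longrightarrow> f' z = 0" "AE z in lborel. z \<in> Q \<longrightarrow> f' z = f z"
    for f f' :: "(real ^ 'n) \<times> real \<Rightarrow> real ^ 'n"
  proof -
    have "integrable lborel (\<lambda>z. norm (f' z))"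
    proof (rule int')
      show "integrable (lebesgue_on Q) (\<lambda>z. norm (f z))" using f by simp
      show "AE z in lborel. z \<in> Q \<longrightarrow> norm (f' z) = norm (f z)" using f'(3) by eventually_elim simp
    qed (use f' in auto)
    then show ?thesis using f'(1) by (subst (asm) integrable_norm_iff) auto
  qed
  note iu = int'[OF int_u u'] and ig = int'_vec[OF int_Du g'] and iF = int'_vec[OF int_Fi F'] and ia = int'_vec[OF int_a a']
  define G' where "G' i z = a' i z - F' i z" for i z
  have iG: "integrable lborel (G' i)" if "i < N" for i
    unfolding G'_def using ia[OF that that] iF[OF that that] that by auto
  show ?thesis
  proof (rule that[of u' g' G' F'])
    show "g' i z = 0 \<and> G' i z = 0" if "i < N" "z \<notin> Q" for i z
      using g'(2)[OF that] a'(2)[OF that] F'(2)[OF that] by (simp add: G'_def)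
    show "F' i \<in> borel_measurable borel" if "i < N" for i by (rule F'(1)[OF that])
    have all: "AE z in lborel. \<forall>i\<in>{..<N}. z \<in> Q \<longrightarrow> u' i z = u z i \<and> g' i z = Du z i \<and> F' i z = F z i \<and> a' i z = a z i"
    proof (subst AE_finite_all, simp, intro ballI)
      fix i assume "i \<in> {..<N}"
      then have i: "i < N" by simp
      show "AE z in lborel. z \<in> Q \<longrightarrow> u' i z = u z i \<and> g' i z = Du z i \<and> F' i z = F z i \<and> a' i z = a z i"
        using u'(3)[OF i] g'(3)[OF i] F'(3)[OF i] a'(3)[OF i] by eventually_elim simp
    qed
    then show "AE z in lborel. z \<in> Q \<longrightarrow> (\<forall>i<N. u' i z = u z i \<and> g' i z = Du z i \<and> F' i z = F z i)"
      by eventually_elim auto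
    have "AE z in lborel. z \<in> Q \<longrightarrow> tnorm N (a z) \<le> L * tnorm N (Du z)"
      using struct unfolding lebesgue_on_AE_iff_lborel[OF Qb] .
    with all show "AE z in lborel. z \<in> Q \<longrightarrow> tnorm N (\<lambda>i. G' i z) \<le> L * tnorm N (\<lambda>i. g' i z) + tnorm N (\<lambda>i. F' i z)"
    proof eventually_elim
      case (elim z)
      show ?case
      proof
        assume z: "z \<in> Q"
        have "tnorm N (\<lambda>i. G' i z) \<le> tnorm N (\<lambda>i. a' i z) + tnorm N (\<lambda>i. F' i z)"
          using tnorm_triangle[of N "\<lambda>i. a' i z" "\<lambda>i. - F' i z"] by (simp add: G'_def tnorm_def)
        moreover have "tnorm N (\<lambda>i. a' i z) = tnorm N (a z)" "tnorm N (\<lambda>i. g' i z) = tnorm N (Du z)"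
          using elim(1) z by (auto simp: tnorm_def intro!: L2_set_cong)
        ultimately show "tnorm N (\<lambda>i. G' i z) \<le> L * tnorm N (\<lambda>i. g' i z) + tnorm N (\<lambda>i. F' i z)"
          using elim(2) z by simp
      qed
    qed
    show "integrable (lebesgue_on Q) (\<lambda>z. (tnorm N (Du z) + tnorm N (F z)) powr q)" by (rule int_pow)
    fix i assume i: "i < N"
    show "weak_flux Q (u' i) (g' i) (G' i)"
      unfolding weak_flux_def
    proof (intro conjI allI impI)
      show "integrable lborel (u' i)" "integrable lborel (g' i)" "integrable lborel (G' i)"
        using iu[OF i i] ig[OF i i] iG[OF i] i by auto
      fix \<psi> :: "(real ^ 'n) \<times> real \<Rightarrow> real" assume \<psi>: "test_function Q \<psi>"
      note [measurable] = test_function_measurable[OF \<psi>] u'(1)[OF i] g'(1)[OF i] F'(1)[OF i] a'(1)[OF i]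
      show "(LINT z|lborel. u' i z * grad_x \<psi> z $ j) = - (LINT z|lborel. g' i z $ j * \<psi> z)" for j
      proof (rule weak_gradient_of_slices[where u="\<lambda>z. u z i" and g="\<lambda>z. Du z i"])
        show "AE t in lebesgue_on {t1<..<t2}. W1q q B (\<lambda>x. u (x, t) i) (\<lambda>x. Du (x, t) i)"
          using slices by eventually_elim (use i in blast)
        show "open B" by (simp add: B_def)
      qed (use iu[OF i i] ig[OF i i] u' g' \<psi> i in \<open>simp_all flip: QB\<close>)
      show "(LINT z|lborel. u' i z * deriv_t \<psi> z) = (LINT z|lborel. G' i z \<bullet> grad_x \<psi> z)"
      proof -
        \<comment> \<open>Only the component \<open>i\<close> of the vector-valued test function is different from zero.\<close>
        define \<phi> where "\<phi> z = (\<lambda>k. if k = i then \<psi> z else 0)" for z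
        have \<phi>t: "\<forall>z. \<phi> z \<in> tuples N" using i by (auto simp: \<phi>_def tuples_def)
        have \<phi>k: "(\<lambda>z. \<phi> z k) = (if k = i then \<psi> else (\<lambda>z. 0))" for k by (auto simp: \<phi>_def)
        have \<phi>test: "\<forall>k<N. test_function S (\<lambda>z. \<phi> z k)"
          unfolding \<phi>k using test_function_mono[OF \<psi> QS] test_function_zero by auto
        have fd0: "frechet_derivative (\<lambda>z :: (real ^ 'n) \<times> real. 0 :: real) (at z) = (\<lambda>v. 0)" for z
          by simp
        have dtk: "deriv_t (\<lambda>w. \<phi> w k) z = (if k = i then deriv_t \<psi> z else 0)" for k z
          unfolding \<phi>k by (simp add: deriv_t_def fd0)
        have gxk: "grad_x (\<lambda>w. \<phi> w k) z = (if k = i then grad_x \<psi> z else 0)" for k z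
          unfolding \<phi>k by (simp add: grad_x_def fd0 vec_eq_iff)
        have ti: "tinner N v (\<lambda>k. deriv_t (\<lambda>w. \<phi> w k) z) = v i * deriv_t \<psi> z" for v z
        proof -
          have "tinner N v (\<lambda>k. deriv_t (\<lambda>w. \<phi> w k) z) = (\<Sum>k<N. if k = i then v i * deriv_t \<psi> z else 0)"
            unfolding tinner_def by (intro sum.cong) (auto simp: dtk)
          then show ?thesis using i by simp
        qed
        have ti2: "tinner N v (\<lambda>k. grad_x (\<lambda>w. \<phi> w k) z) = v i \<bullet> grad_x \<psi> z" for v z
        proof -
          have "tinner N v (\<lambda>k. grad_x (\<lambda>w. \<phi> w k) z) = (\<Sum>k<N. if k = i then v i \<bullet> grad_x \<psi> z else 0)"
            unfolding tinner_def by (intro sum.cong) (auto simp: gxk)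
          then show ?thesis using i by simp
        qed
        have weq: "(LINT z|lebesgue_on S. - (u z i * deriv_t \<psi> z) + a z i \<bullet> grad_x \<psi> z) = (LINT z|lebesgue_on S. F z i \<bullet> grad_x \<psi> z)"
          using eqn \<phi>t \<phi>test unfolding satisfies_weak_equation_def a_def by (auto simp only: ti ti2)
        have zero: "deriv_t \<psi> z = 0" "grad_x \<psi> z = 0" if "z \<notin> Q" for z
          using test_function_support(2)[OF \<psi> that] by (simp_all add: deriv_t_def grad_x_def vec_eq_iff)
        have "(LINT z|lebesgue_on S. - (u z i * deriv_t \<psi> z) + a z i \<bullet> grad_x \<psi> z)
            = (LINT z|lborel. indicator S z * (- (u' i z * deriv_t \<psi> z) + a' i z \<bullet> grad_x \<psi> z))"
        proof (rule borel_version_on(3)[OF Sb])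
          show "AE z in lborel. z \<in> S \<longrightarrow> - (u z i * deriv_t \<psi> z) + a z i \<bullet> grad_x \<psi> z = - (u' i z * deriv_t \<psi> z) + a' i z \<bullet> grad_x \<psi> z"
            using u'(3)[OF i] a'(3)[OF i]
          proof eventually_elim
            case (elim z)
            then show ?case using zero[of z] by (cases "z \<in> Q") auto
          qed
        qed measurable
        also have "\<dots> = (LINT z|lborel. - (u' i z * deriv_t \<psi> z) + a' i z \<bullet> grad_x \<psi> z)"
        proof (intro Bochner_Integration.integral_cong refl)
          fix z
          show "indicator S z * (- (u' i z * deriv_t \<psi> z) + a' i z \<bullet> grad_x \<psi> z) = - (u' i z * deriv_t \<psi> z) + a' i z \<bullet> grad_x \<psi> z"
          proof (cases "z \<in> Q")
            case True
            then have "z \<in> S" by (rule subsetD[OF QS])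
            then show ?thesis by simp
          qed (simp add: zero)
        qed
        also have "\<dots> = - (LINT z|lborel. u' i z * deriv_t \<psi> z) + (LINT z|lborel. a' i z \<bullet> grad_x \<psi> z)"
          using integrable_mult_test_function(2)[OF \<psi> iu[OF i i], of "(0, 1)"] integrable_inner_test_grad[OF \<psi> ia[OF i i]] i u' a'
          by (simp add: deriv_t_def)
        finally have lhs: "(LINT z|lebesgue_on S. - (u z i * deriv_t \<psi> z) + a z i \<bullet> grad_x \<psi> z)
          = - (LINT z|lborel. u' i z * deriv_t \<psi> z) + (LINT z|lborel. a' i z \<bullet> grad_x \<psi> z)" .
        have "(LINT z|lebesgue_on S. F z i \<bullet> grad_x \<psi> z) = (LINT z|lborel. indicator S z * (F' i z \<bullet> grad_x \<psi> z))"
        proof (rule borel_version_on(3)[OF Sb])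
          show "AE z in lborel. z \<in> S \<longrightarrow> F z i \<bullet> grad_x \<psi> z = F' i z \<bullet> grad_x \<psi> z"
            using F'(3)[OF i]
          proof eventually_elim
            case (elim z)
            then show ?case using zero[of z] by (cases "z \<in> Q") auto
          qed
        qed measurable
        also have "\<dots> = (LINT z|lborel. F' i z \<bullet> grad_x \<psi> z)"
        proof (intro Bochner_Integration.integral_cong refl)
          fix z
          show "indicator S z * (F' i z \<bullet> grad_x \<psi> z) = F' i z \<bullet> grad_x \<psi> z"
          proof (cases "z \<in> Q")
            case True
            then have "z \<in> S" by (rule subsetD[OF QS])
            then show ?thesis by simp
          qed (simp add: zero)
        qed
        finally have rhs: "(LINT z|lebesgue_on S. F z i \<bullet> grad_x \<psi> z) = (LINT z|lborel. F' i z \<bullet> grad_x \<psi> z)" .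
        have "(LINT z|lborel. G' i z \<bullet> grad_x \<psi> z) = (LINT z|lborel. a' i z \<bullet> grad_x \<psi> z) - (LINT z|lborel. F' i z \<bullet> grad_x \<psi> z)"
          unfolding G'_def inner_diff_left
          using integrable_inner_test_grad[OF \<psi> ia[OF i i]] integrable_inner_test_grad[OF \<psi> iF[OF i i]] i a' F' by simp
        then show ?thesis using weq lhs rhs by simp
      qed
    qed
  qed
qed

section \<open>The estimates on general cylinders\<close>

text \<open>
  On the unit cylinder \<open>|g| + |G|\<close> is at most \<open>\<rho> (1 + L) (|\<nabla>u| + |F|)\<close> at the corresponding points, by the growth
  condition on \<open>A\<close>.
\<close>

lemma solution_potential_dominated:
  fixes \<Omega> :: "(real ^ 'n::finite) set"
  assumes C: "deviation_constant TYPE('n) C"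
    and sol: "parabolic_system_solution q \<nu> L N \<Omega> T A F u Du" and q: "1 \<le> q" and \<rho>: "0 < \<rho>"
    and Q: "Q = parabolic_cylinder x0 t0 \<rho>" and sub: "Q \<Subset> time_cylinder \<Omega> T"
    and H: "0 < H" "\<rho> * (1 + L) * data_mean q N Q Du F \<le> H"
  shows "\<exists>f h. potential_dominated C q f h H \<and> (AE w in P\<^sub>1. deviation N Q u (cyl_map (x0, t0) \<rho> w) = f w)"
proof -
  obtain u' g' G' F' where wf: "\<And>i. i < N \<Longrightarrow> weak_flux Q (u' i) (g' i) (G' i)"
    and out: "\<And>i z. i < N \<Longrightarrow> z \<notin> Q \<Longrightarrow> g' i z = 0 \<and> G' i z = 0"
    and F'm: "\<And>i. i < N \<Longrightarrow> F' i \<in> borel_measurable borel"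
    and eq: "AE z in lborel. z \<in> Q \<longrightarrow> (\<forall>i<N. u' i z = u z i \<and> g' i z = Du z i \<and> F' i z = F z i)"
    and str: "AE z in lborel. z \<in> Q \<longrightarrow> tnorm N (\<lambda>i. G' i z) \<le> L * tnorm N (\<lambda>i. g' i z) + tnorm N (\<lambda>i. F' i z)"
    and int: "integrable (lebesgue_on Q) (\<lambda>z. (tnorm N (Du z) + tnorm N (F z)) powr q)"
    using solution_weak_flux[OF sol q \<rho> Q sub] by blast
  have L: "0 < L" using sol by (auto simp: parabolic_system_solution_def)
  interpret P: prob_space "P\<^sub>1 :: ((real ^ 'n) \<times> real) measure" by (rule prob_space_P1)
  define S where "S = cyl_map (x0, t0) \<rho>"
  have [measurable]: "S \<in> borel_measurable borel" by (simp add: S_def)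
  have SQ: "S w \<in> Q \<longleftrightarrow> w \<in> Q\<^sub>1" for w
    unfolding S_def Q by (rule cyl_map_in_cylinder[OF \<rho>])
  have AE_S: "AE w in P\<^sub>1. P (S w)" if "AE z in lborel. z \<in> Q \<longrightarrow> P z" for P
    using AE_cyl_map[OF \<rho> that, of "(x0, t0)"] by (simp add: AE_P1 S_def[symmetric] SQ)
  have um: "u' i \<in> borel_measurable borel" and gm: "g' i \<in> borel_measurable borel" and Gm: "G' i \<in> borel_measurable borel" if "i < N" for i
    using wf[OF that] by (auto simp: weak_flux_def dest!: borel_measurable_integrable)
  define v where "v i w = u' i (S w)" for i w
  define a where "a i w = \<rho> *\<^sub>R g' i (S w)" for i w
  define b where "b i w = \<rho> *\<^sub>R G' i (S w)" for i w
  have vm: "v i \<in> borel_measurable borel" and am: "a i \<in> borel_measurable borel" and bm: "b i \<in> borel_measurable borel" if "i < N" for i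
    using um[OF that] gm[OF that] Gm[OF that] unfolding v_def a_def b_def by measurable
  have wf1: "weak_flux Q\<^sub>1 (v i) (a i) (b i)" if "i < N" for i
    using weak_flux_cyl_map[OF wf[OF that, unfolded Q] \<rho>] by (simp add: v_def[abs_def] a_def[abs_def] b_def[abs_def] S_def)
  have out1: "a i w = 0 \<and> b i w = 0" if "i < N" "w \<notin> Q\<^sub>1" for i w
    using out[OF that(1), of "S w"] that(2) SQ[of w] by (simp add: a_def b_def)
  define m where "m i = (LINT w|P\<^sub>1. v i w)" for i
  define f where "f w = tnorm N (\<lambda>i. v i w - m i)" for w
  define h where "h w = tnorm N (\<lambda>i. a i w) + tnorm N (\<lambda>i. b i w)" for w
  define k where "k w = tnorm N (\<lambda>i. g' i (S w)) + tnorm N (\<lambda>i. F' i (S w))" for w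
  have fm [measurable]: "f \<in> borel_measurable borel"
    unfolding f_def by (intro tnorm_measurable) (use vm in simp)
  have hm [measurable]: "h \<in> borel_measurable borel"
    unfolding h_def by (intro borel_measurable_add tnorm_measurable) (use am bm in simp_all)
  have km [measurable]: "k \<in> borel_measurable borel"
    unfolding k_def
  proof (intro borel_measurable_add tnorm_measurable)
    fix i assume "i < N"
    note [measurable] = gm[OF this] F'm[OF this]
    show "(\<lambda>w. g' i (S w)) \<in> borel_measurable borel" "(\<lambda>w. F' i (S w)) \<in> borel_measurable borel" by measurable
  qed
  have f0: "0 \<le> f w" and h0: "0 \<le> h w" and k0: "0 \<le> k w" for w
    by (simp_all add: f_def h_def k_def tnorm_nonneg)
  have eqS: "AE w in P\<^sub>1. \<forall>i<N. u' i (S w) = u (S w) i \<and> g' i (S w) = Du (S w) i \<and> F' i (S w) = F (S w) i"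
    by (rule AE_S[OF eq])
  have mean: "mean Q (\<lambda>z. u z i) = m i" if "i < N" for i
    unfolding Q m_def
  proof (rule cylinder_transfer(3)[OF \<rho> vm[OF that]])
    show "AE w in P\<^sub>1. u (cyl_map (x0, t0) \<rho> w) i = v i w"
      using eqS by eventually_elim (use that in \<open>simp add: v_def S_def\<close>)
  qed
  have dev: "AE w in P\<^sub>1. deviation N Q u (cyl_map (x0, t0) \<rho> w) = f w"
    using eqS
  proof eventually_elim
    case (elim w)
    then show ?case
      unfolding deviation_def f_def tnorm_def S_def[symmetric]
      by (intro L2_set_cong) (auto simp: mean v_def)
  qed
  define dm where "dm = data_mean q N Q Du F"
  have kAE: "AE w in P\<^sub>1. (tnorm N (Du (cyl_map (x0, t0) \<rho> w)) + tnorm N (F (cyl_map (x0, t0) \<rho> w))) powr q = k w powr q"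
    using eqS
  proof eventually_elim
    case (elim w)
    then have "tnorm N (Du (S w)) = tnorm N (\<lambda>i. g' i (S w))" "tnorm N (F (S w)) = tnorm N (\<lambda>i. F' i (S w))"
      unfolding tnorm_def by (auto intro!: L2_set_cong)
    then show ?case by (simp add: k_def S_def)
  qed
  have kq: "(\<lambda>w. k w powr q) \<in> borel_measurable borel" by measurable
  have int_k: "integrable P\<^sub>1 (\<lambda>w. k w powr q)"
    using cylinder_transfer(2)[OF \<rho> kq kAE] int by (simp add: Q)
  have mean_k: "mean Q (\<lambda>z. (tnorm N (Du z) + tnorm N (F z)) powr q) = (LINT w|P\<^sub>1. k w powr q)"
    unfolding Q by (rule cylinder_transfer(3)[OF \<rho> kq kAE])
  have I0: "0 \<le> (LINT w|P\<^sub>1. k w powr q)" by (intro integral_nonneg_AE AE_I2) simp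
  have dm0: "0 \<le> dm" by (simp add: dm_def data_mean_def)
  have dmq: "dm powr q = (LINT w|P\<^sub>1. k w powr q)"
    using q I0 unfolding dm_def data_mean_def mean_k by (simp add: powr_powr)
  have nn_k: "(\<integral>\<^sup>+w. ennreal (k w powr q) \<partial>P\<^sub>1) = ennreal (dm powr q)"
    unfolding dmq by (rule nn_integral_eq_integral[OF int_k]) simp
  have hk: "AE w in P\<^sub>1. h w \<le> \<rho> * (1 + L) * k w"
    using AE_S[OF str]
  proof eventually_elim
    case (elim w)
    have "h w = \<rho> * (tnorm N (\<lambda>i. g' i (S w)) + tnorm N (\<lambda>i. G' i (S w)))"
      using \<rho> by (simp add: h_def a_def b_def tnorm_scaleR distrib_left)
    also have "\<dots> \<le> \<rho> * ((1 + L) * tnorm N (\<lambda>i. g' i (S w)) + tnorm N (\<lambda>i. F' i (S w)))"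
      using elim \<rho> by (intro mult_left_mono) (auto simp: algebra_simps)
    also have "\<dots> \<le> \<rho> * ((1 + L) * k w)"
      using \<rho> L tnorm_nonneg[of N "\<lambda>i. F' i (S w)"] by (intro mult_left_mono) (auto simp: k_def algebra_simps)
    finally show ?case by (simp add: mult.assoc)
  qed
  have "(\<integral>\<^sup>+w. ennreal (h w powr q) \<partial>P\<^sub>1) \<le> (\<integral>\<^sup>+w. ennreal ((\<rho> * (1 + L)) powr q) * ennreal (k w powr q) \<partial>P\<^sub>1)"
  proof (rule nn_integral_mono_AE)
    show "AE w in P\<^sub>1. ennreal (h w powr q) \<le> ennreal ((\<rho> * (1 + L)) powr q) * ennreal (k w powr q)"
      using hk
    proof eventually_elim
      case (elim w)
      have "h w powr q \<le> (\<rho> * (1 + L) * k w) powr q" using elim h0 q by (intro powr_mono2) auto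
      also have "\<dots> = (\<rho> * (1 + L)) powr q * k w powr q" by (rule powr_mult)
      finally show ?case by (simp add: ennreal_leI flip: ennreal_mult)
    qed
  qed
  also have "\<dots> = ennreal ((\<rho> * (1 + L)) powr q) * ennreal (dm powr q)"
    by (subst nn_integral_cmult) (auto simp: nn_k)
  also have "\<dots> = ennreal ((\<rho> * (1 + L) * dm) powr q)"
    by (simp add: powr_mult flip: ennreal_mult)
  also have "\<dots> \<le> ennreal (H powr q)"
    using H(2) \<rho> L dm0 q by (intro ennreal_leI powr_mono2) (auto simp: dm_def)
  finally have data: "(\<integral>\<^sup>+w. ennreal (h w powr q) \<partial>P\<^sub>1) \<le> ennreal (H powr q)" .
  have "AE z in P\<^sub>1. ennreal (f z) \<le> ennreal C * ((\<integral>\<^sup>+y. ennreal (riesz_kernel z y * h y) \<partial>P\<^sub>1) + (\<integral>\<^sup>+y. ennreal (h y) \<partial>P\<^sub>1))"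
    using C[unfolded deviation_constant_def, rule_format, of N v a b] wf1 out1 unfolding f_def h_def m_def by blast
  then have "potential_dominated C q f h H"
    unfolding potential_dominated_def using fm hm f0 h0 H(1) data by blast
  then show ?thesis using dev by blast
qed

text \<open>
  The bound holds for every \<open>H > \<rho> K\<close>, and \<open>H\<close> may tend to \<open>\<rho> K\<close>; this covers the case \<open>K = 0\<close>.
\<close>

lemma cylinder_subcritical:
  fixes \<Delta> :: "(real ^ 'n::finite) \<times> real \<Rightarrow> real"
  assumes est: "\<And>f h H. potential_dominated C q (f :: (real ^ 'n) \<times> real \<Rightarrow> real) h H \<Longrightarrow>
      (\<integral>\<^sup>+z. ennreal (f z powr p) \<partial>P\<^sub>1) \<le> ennreal ((c * H) powr p)"
    and dom: "\<And>H. 0 < H \<Longrightarrow> \<rho> * K \<le> H \<Longrightarrow>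
      \<exists>f h. potential_dominated C q f h H \<and> (AE w in P\<^sub>1. \<Delta> (cyl_map (x0, t0) \<rho> w) = f w)"
    and pos: "0 < c" "0 < p" "0 < \<rho>" "0 \<le> K"
  shows "integrable (lebesgue_on (parabolic_cylinder x0 t0 \<rho>)) (\<lambda>z. \<Delta> z powr p / \<rho> powr p)"
    "mean (parabolic_cylinder x0 t0 \<rho>) (\<lambda>z. \<Delta> z powr p / \<rho> powr p) powr (1 / p) \<le> c * K"
proof -
  have *: "integrable (lebesgue_on (parabolic_cylinder x0 t0 \<rho>)) (\<lambda>z. \<Delta> z powr p / \<rho> powr p) \<and>
     mean (parabolic_cylinder x0 t0 \<rho>) (\<lambda>z. \<Delta> z powr p / \<rho> powr p) powr (1 / p) \<le> c * H / \<rho>"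
    if H: "0 < H" "\<rho> * K \<le> H" for H
  proof -
    obtain f h where pd: "potential_dominated C q f h H" and eq: "AE w in P\<^sub>1. \<Delta> (cyl_map (x0, t0) \<rho> w) = f w"
      using dom[OF H] by blast
    have [measurable]: "f \<in> borel_measurable borel" using pd by (simp add: potential_dominated_def)
    have eq': "AE w in P\<^sub>1. \<Delta> (cyl_map (x0, t0) \<rho> w) powr p / \<rho> powr p = f w powr p / \<rho> powr p"
      using eq by eventually_elim simp
    have fm: "(\<lambda>w. f w powr p / \<rho> powr p) \<in> borel_measurable borel" by measurable
    have nn: "(\<integral>\<^sup>+w. ennreal (f w powr p / \<rho> powr p) \<partial>P\<^sub>1) \<le> ennreal ((c * H / \<rho>) powr p)"
    proof -
      have "(\<integral>\<^sup>+w. ennreal (f w powr p / \<rho> powr p) \<partial>P\<^sub>1) = (\<integral>\<^sup>+w. ennreal (1 / \<rho> powr p) * ennreal (f w powr p) \<partial>P\<^sub>1)"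
        by (simp flip: ennreal_mult)
      also have "\<dots> = ennreal (1 / \<rho> powr p) * (\<integral>\<^sup>+w. ennreal (f w powr p) \<partial>P\<^sub>1)"
        by (rule nn_integral_cmult) simp
      also have "\<dots> \<le> ennreal (1 / \<rho> powr p) * ennreal ((c * H) powr p)"
        by (intro mult_left_mono est[OF pd]) auto
      also have "\<dots> = ennreal ((c * H / \<rho>) powr p)"
        using pos H by (simp add: powr_divide flip: ennreal_mult)
      finally show ?thesis .
    qed
    have int: "integrable P\<^sub>1 (\<lambda>w. f w powr p / \<rho> powr p)"
      by (rule integrableI_nonneg) (use nn in \<open>auto intro: le_less_trans\<close>)
    have "(LINT w|P\<^sub>1. f w powr p / \<rho> powr p) \<le> (c * H / \<rho>) powr p"
    proof -
      have "ennreal (LINT w|P\<^sub>1. f w powr p / \<rho> powr p) \<le> ennreal ((c * H / \<rho>) powr p)"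
        using nn nn_integral_eq_integral[OF int] by simp
      then show ?thesis by (subst (asm) ennreal_le_iff) auto
    qed
    moreover have "0 \<le> (LINT w|P\<^sub>1. f w powr p / \<rho> powr p)" by (intro integral_nonneg_AE AE_I2) simp
    ultimately have "(LINT w|P\<^sub>1. f w powr p / \<rho> powr p) powr (1 / p) \<le> ((c * H / \<rho>) powr p) powr (1 / p)"
      using pos by (intro powr_mono2) auto
    also have "\<dots> = c * H / \<rho>" using pos H by (simp add: powr_powr)
    finally show ?thesis
      using cylinder_transfer(2,3)[OF pos(3) fm eq'] int by simp
  qed
  have step: "0 < \<rho> * K + e * \<rho> / c" "\<rho> * K \<le> \<rho> * K + e * \<rho> / c" if "0 < e" for e
    using pos that by (auto simp: add_nonneg_pos)
  show "integrable (lebesgue_on (parabolic_cylinder x0 t0 \<rho>)) (\<lambda>z. \<Delta> z powr p / \<rho> powr p)"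
    using *[OF step[of 1]] by simp
  show "mean (parabolic_cylinder x0 t0 \<rho>) (\<lambda>z. \<Delta> z powr p / \<rho> powr p) powr (1 / p) \<le> c * K"
  proof (rule field_le_epsilon)
    fix e :: real assume "0 < e"
    have "c * (\<rho> * K + e * \<rho> / c) / \<rho> = c * K + e" using pos by (simp add: field_simps)
    then show "mean (parabolic_cylinder x0 t0 \<rho>) (\<lambda>z. \<Delta> z powr p / \<rho> powr p) powr (1 / p) \<le> c * K + e"
      using *[OF step[OF \<open>0 < e\<close>]] by simp
  qed
qed

text \<open>
  For \<open>K = 0\<close> the quotient is \<open>0\<close> and the integrand is the constant 1, which explains \<open>1 \<le> c'\<close>.
\<close>

lemma cylinder_critical:
  fixes \<Delta> :: "(real ^ 'n::finite) \<times> real \<Rightarrow> real"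
  assumes est: "\<And>f h H. potential_dominated C q (f :: (real ^ 'n) \<times> real \<Rightarrow> real) h H \<Longrightarrow>
      (\<integral>\<^sup>+z. ennreal (exp ((f z / (c * H)) powr \<gamma>)) \<partial>P\<^sub>1) \<le> ennreal c"
    and dom: "0 < \<rho> * K \<Longrightarrow>
      \<exists>f h. potential_dominated C q f h (\<rho> * K) \<and> (AE w in P\<^sub>1. \<Delta> (cyl_map (x0, t0) \<rho> w) = f w)"
    and pos: "0 < c" "0 \<le> \<gamma>" "0 < \<rho>" "0 \<le> K" and c': "c \<le> c'" "1 \<le> c'"
  shows "integrable (lebesgue_on (parabolic_cylinder x0 t0 \<rho>)) (\<lambda>z. exp ((\<Delta> z / (c' * (\<rho> * K))) powr \<gamma>))"
    "mean (parabolic_cylinder x0 t0 \<rho>) (\<lambda>z. exp ((\<Delta> z / (c' * (\<rho> * K))) powr \<gamma>)) \<le> c'"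
proof -
  interpret P: prob_space "P\<^sub>1 :: ((real ^ 'n) \<times> real) measure" by (rule prob_space_P1)
  have "integrable (lebesgue_on (parabolic_cylinder x0 t0 \<rho>)) (\<lambda>z. exp ((\<Delta> z / (c' * (\<rho> * K))) powr \<gamma>)) \<and>
    mean (parabolic_cylinder x0 t0 \<rho>) (\<lambda>z. exp ((\<Delta> z / (c' * (\<rho> * K))) powr \<gamma>)) \<le> c'"
  proof (cases "K = 0")
    case True
    have one: "(\<lambda>w. 1 :: real) \<in> borel_measurable borel" by simp
    have "AE w in P\<^sub>1. exp ((\<Delta> (cyl_map (x0, t0) \<rho> w) / (c' * (\<rho> * K))) powr \<gamma>) = 1"
      using True by simp
    from cylinder_transfer(2,3)[OF pos(3) one this] show ?thesis
      using c' by (simp add: P.prob_space[unfolded space_P1])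
  next
    case False
    then have H: "0 < \<rho> * K" using pos by simp
    obtain f h where pd: "potential_dominated C q f h (\<rho> * K)" and eq: "AE w in P\<^sub>1. \<Delta> (cyl_map (x0, t0) \<rho> w) = f w"
      using dom[OF H] by blast
    have [measurable]: "f \<in> borel_measurable borel" and f0: "\<And>z. 0 \<le> f z" using pd by (auto simp: potential_dominated_def)
    define F where "F w = exp ((f w / (c' * (\<rho> * K))) powr \<gamma>)" for w
    have Fm [measurable]: "F \<in> borel_measurable borel" unfolding F_def by measurable
    have eq': "AE w in P\<^sub>1. exp ((\<Delta> (cyl_map (x0, t0) \<rho> w) / (c' * (\<rho> * K))) powr \<gamma>) = F w"
      using eq by eventually_elim (simp add: F_def)
    have "0 < K" using False pos by simp
    then have "F w \<le> exp ((f w / (c * (\<rho> * K))) powr \<gamma>)" for w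
      unfolding F_def exp_le_cancel_iff using f0[of w] H c' pos
      by (intro powr_mono2 divide_left_mono mult_right_mono mult_pos_pos) auto
    then have "(\<integral>\<^sup>+w. ennreal (F w) \<partial>P\<^sub>1) \<le> (\<integral>\<^sup>+w. ennreal (exp ((f w / (c * (\<rho> * K))) powr \<gamma>)) \<partial>P\<^sub>1)"
      by (intro nn_integral_mono ennreal_leI)
    also have "\<dots> \<le> ennreal c" by (rule est[OF pd])
    also have "\<dots> \<le> ennreal c'" using c' by (intro ennreal_leI)
    finally have nn: "(\<integral>\<^sup>+w. ennreal (F w) \<partial>P\<^sub>1) \<le> ennreal c'" .
    have int: "integrable P\<^sub>1 F"
      by (rule integrableI_nonneg) (use nn in \<open>auto simp: F_def intro: le_less_trans\<close>)
    have nn': "(\<integral>\<^sup>+w. ennreal (F w) \<partial>P\<^sub>1) = ennreal (LINT w|P\<^sub>1. F w)"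
      by (rule nn_integral_eq_integral[OF int]) (simp add: F_def)
    have "ennreal (LINT w|P\<^sub>1. F w) \<le> ennreal c'"
      using nn unfolding nn' .
    then have "(LINT w|P\<^sub>1. F w) \<le> c'" using c' by (subst (asm) ennreal_le_iff) auto
    then show ?thesis using cylinder_transfer(2,3)[OF pos(3) Fm eq'] int by simp
  qed
  then show "integrable (lebesgue_on (parabolic_cylinder x0 t0 \<rho>)) (\<lambda>z. exp ((\<Delta> z / (c' * (\<rho> * K))) powr \<gamma>))"
    "mean (parabolic_cylinder x0 t0 \<rho>) (\<lambda>z. exp ((\<Delta> z / (c' * (\<rho> * K))) powr \<gamma>)) \<le> c'" by blast+
qed

lemma cylinder_supercritical:
  fixes \<Delta> :: "(real ^ 'n::finite) \<times> real \<Rightarrow> real"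
  assumes est: "\<And>f h H. potential_dominated C q (f :: (real ^ 'n) \<times> real \<Rightarrow> real) h H \<Longrightarrow> (AE z in P\<^sub>1. f z \<le> c * H)"
    and dom: "\<And>H. 0 < H \<Longrightarrow> \<rho> * K \<le> H \<Longrightarrow>
      \<exists>f h. potential_dominated C q f h H \<and> (AE w in P\<^sub>1. \<Delta> (cyl_map (x0, t0) \<rho> w) = f w)"
    and pos: "0 < c" "0 < \<rho>" "0 \<le> K"
  shows "esssup (lebesgue_on (parabolic_cylinder x0 t0 \<rho>)) (\<lambda>z. ereal (\<Delta> z / \<rho>)) \<le> ereal (c * K)"
proof -
  have *: "esssup (lebesgue_on (parabolic_cylinder x0 t0 \<rho>)) (\<lambda>z. ereal (\<Delta> z / \<rho>)) \<le> ereal (c * H / \<rho>)"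
    if H: "0 < H" "\<rho> * K \<le> H" for H
  proof (rule esssup_I)
    obtain f h where pd: "potential_dominated C q f h H" and eq: "AE w in P\<^sub>1. \<Delta> (cyl_map (x0, t0) \<rho> w) = f w"
      using dom[OF H] by blast
    have fm: "f \<in> borel_measurable borel" using pd by (simp add: potential_dominated_def)
    have "\<Delta> \<in> borel_measurable (lebesgue_on (parabolic_cylinder x0 t0 \<rho>))"
      by (rule cylinder_transfer(1)[OF pos(2) fm eq])
    then show "(\<lambda>z. ereal (\<Delta> z / \<rho>)) \<in> borel_measurable (lebesgue_on (parabolic_cylinder x0 t0 \<rho>))" by measurable
    have "AE w in P\<^sub>1. \<Delta> (cyl_map (x0, t0) \<rho> w) \<le> c * H"
      using eq est[OF pd] by eventually_elim simp
    then have "AE w in lborel. w \<in> Q\<^sub>1 \<longrightarrow> \<Delta> (cyl_map (x0, t0) \<rho> w) \<le> c * H" by (simp add: AE_P1)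
    from AE_cyl_inv[OF pos(2) this, of "(x0, t0)"]
    have "AE z in lborel. z \<in> parabolic_cylinder x0 t0 \<rho> \<longrightarrow> \<Delta> z \<le> c * H"
      using pos(2) by (simp add: cyl_map_inv cyl_inv_in_Q1)
    then have "AE z in lebesgue_on (parabolic_cylinder x0 t0 \<rho>). \<Delta> z \<le> c * H"
      by (simp add: lebesgue_on_AE_iff_lborel)
    then show "AE z in lebesgue_on (parabolic_cylinder x0 t0 \<rho>). ereal (\<Delta> z / \<rho>) \<le> ereal (c * H / \<rho>)"
      by eventually_elim (use pos in \<open>simp add: divide_right_mono\<close>)
  qed
  show ?thesis
  proof (rule ereal_le_epsilon2)
    fix e :: real assume e: "0 < e"
    have "0 < \<rho> * K + e * \<rho> / c" using pos e by (intro add_nonneg_pos) auto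
    moreover have "\<rho> * K \<le> \<rho> * K + e * \<rho> / c" using pos e by simp
    moreover have "c * (\<rho> * K + e * \<rho> / c) / \<rho> = c * K + e" using pos by (simp add: field_simps)
    ultimately show "esssup (lebesgue_on (parabolic_cylinder x0 t0 \<rho>)) (\<lambda>z. ereal (\<Delta> z / \<rho>)) \<le> ereal (c * K) + ereal e"
      using *[of "\<rho> * K + e * \<rho> / c"] by simp
  qed
qed

theorem theorem4p1:
  fixes q L :: real
  assumes "1 \<le> q"
  shows
   "(q < real CARD('n::finite) + 2 \<longrightarrow>
       (\<forall>p. q \<le> p \<and> p < q * (real CARD('n) + 2) / (real CARD('n) + 2 - q) \<longrightarrow>
         (\<exists>c>0. \<forall>\<nu> N (\<Omega> :: (real ^ 'n) set) T A F u Du.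
            parabolic_system_solution q \<nu> L N \<Omega> T A F u Du \<longrightarrow>
            (\<forall>Q x0 t0 \<rho>. 0 < \<rho> \<and> Q = parabolic_cylinder x0 t0 \<rho> \<and> Q \<Subset> time_cylinder \<Omega> T \<longrightarrow>
               integrable (lebesgue_on Q) (\<lambda>z. deviation N Q u z powr p / \<rho> powr p) \<and>
               mean Q (\<lambda>z. deviation N Q u z powr p / \<rho> powr p) powr (1 / p)
                 \<le> c * data_mean q N Q Du F))))
    \<and>
    (q = real CARD('n) + 2 \<longrightarrow>
       (\<exists>c>0. \<forall>\<nu> N (\<Omega> :: (real ^ 'n) set) T A F u Du.
          parabolic_system_solution q \<nu> L N \<Omega> T A F u Du \<longrightarrow>
          (\<forall>Q x0 t0 \<rho>. 0 < \<rho> \<and> Q = parabolic_cylinder x0 t0 \<rho> \<and> Q \<Subset> time_cylinder \<Omega> T \<longrightarrow>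
             integrable (lebesgue_on Q)
               (\<lambda>z. exp ((deviation N Q u z / (c * \<rho> * data_mean (real CARD('n) + 2) N Q Du F))
                          powr ((real CARD('n) + 2) / (real CARD('n) + 1)))) \<and>
             mean Q
               (\<lambda>z. exp ((deviation N Q u z / (c * \<rho> * data_mean (real CARD('n) + 2) N Q Du F))
                          powr ((real CARD('n) + 2) / (real CARD('n) + 1)))) \<le> c)))
    \<and>
    (q > real CARD('n) + 2 \<longrightarrow>
       (\<exists>c>0. \<forall>\<nu> N (\<Omega> :: (real ^ 'n) set) T A F u Du.
          parabolic_system_solution q \<nu> L N \<Omega> T A F u Du \<longrightarrow>
          (\<forall>Q x0 t0 \<rho>. 0 < \<rho> \<and> Q = parabolic_cylinder x0 t0 \<rho> \<and> Q \<Subset> time_cylinder \<Omega> T \<longrightarrow>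
             esssup (lebesgue_on Q) (\<lambda>z. ereal (deviation N Q u z / \<rho>))
               \<le> ereal (c * data_mean q N Q Du F))))"
proof -
  obtain C where C0: "0 < C" and C: "deviation_constant TYPE('n) C"
    using ex_deviation_constant by blast
  have L_pos: "0 < L" if "parabolic_system_solution q \<nu> L N \<Omega> T A F u Du" for \<nu> N and \<Omega> :: "(real ^ 'n) set" and T A F u Du
    using that by (auto simp: parabolic_system_solution_def)
  have K0: "0 \<le> (1 + \<bar>L\<bar>) * data_mean q N Q Du F" for N and Q :: "((real ^ 'n) \<times> real) set" and Du F :: "(real ^ 'n) \<times> real \<Rightarrow> nat \<Rightarrow> real ^ 'n"
    by (simp add: data_mean_def)
  \<comment> \<open>The constants are chosen before the solution is known, hence \<open>\<bar>L\<bar>\<close>; for a solution it equals \<open>L\<close>.\<close>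
  have dom: "\<exists>f h. potential_dominated C q f h H \<and> (AE w in P\<^sub>1. deviation N (parabolic_cylinder x0 t0 \<rho>) u (cyl_map (x0, t0) \<rho> w) = f w)"
    if "parabolic_system_solution q \<nu> L N \<Omega> T A F u Du" "0 < \<rho>" "parabolic_cylinder x0 t0 \<rho> \<Subset> time_cylinder \<Omega> T"
      "0 < H" "\<rho> * ((1 + \<bar>L\<bar>) * data_mean q N (parabolic_cylinder x0 t0 \<rho>) Du F) \<le> H"
    for \<nu> N and \<Omega> :: "(real ^ 'n) set" and T A F u Du x0 t0 \<rho> H
    using solution_potential_dominated[OF C that(1) assms that(2) refl that(3,4)] that(5) L_pos[OF that(1)]
    by (simp add: mult.assoc)
  show ?thesis
  proof ((intro conjI impI allI; (elim conjE)?), goal_cases)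
    case (1 p)
    have p0: "0 < p" using 1 assms by simp
    obtain c where c: "0 < c" and est: "\<And>f h H. potential_dominated C q (f :: (real ^ 'n) \<times> real \<Rightarrow> real) h H \<Longrightarrow>
      (\<integral>\<^sup>+z. ennreal (f z powr p) \<partial>P\<^sub>1) \<le> ennreal ((c * H) powr p)"
      using unit_subcritical[OF C0 assms 1] by blast
    have c': "0 < c * (1 + \<bar>L\<bar>)" using c by (intro mult_pos_pos) auto
    show ?case
    proof (rule exI[of _ "c * (1 + \<bar>L\<bar>)"], intro conjI[OF c'] allI impI, elim conjE, hypsubst, goal_cases)
      case 1
      show ?case
        using cylinder_subcritical[OF est dom[OF 1] c p0 1(2) K0] by (simp only: mult.assoc simp_thms)
    qed
  next
    case q: 2
    define \<gamma> where "\<gamma> = (real CARD('n) + 2) / (real CARD('n) + 1)"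
    have \<gamma>: "0 \<le> \<gamma>" by (simp add: \<gamma>_def)
    obtain c where c: "0 < c" and est: "\<And>f h H. potential_dominated C q (f :: (real ^ 'n) \<times> real \<Rightarrow> real) h H \<Longrightarrow>
      (\<integral>\<^sup>+z. ennreal (exp ((f z / (c * H)) powr \<gamma>)) \<partial>P\<^sub>1) \<le> ennreal c"
      using unit_critical[OF C0, where 'n='n] unfolding q \<gamma>_def by blast
    \<comment> \<open>The constant also bounds the mean of the constant 1, which occurs when the data vanish.\<close>
    define c2 where "c2 = max c 1"
    have c2: "c \<le> c2" "1 \<le> c2" by (auto simp: c2_def)
    define c' where "c' = c2 * (1 + \<bar>L\<bar>)"
    have c'0: "0 < c'" using c2 by (auto simp: c'_def intro: mult_pos_pos)
    have c2c': "c2 \<le> c'" using c2 by (simp add: c'_def mult_left_le)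
    have eq: "c' * \<rho> * d = c2 * (\<rho> * ((1 + \<bar>L\<bar>) * d))" for \<rho> d
      by (simp add: c'_def)
    show ?case
      unfolding \<gamma>_def[symmetric] unfolding q[symmetric]
    proof (rule exI[of _ c'], intro conjI[OF c'0] allI impI, elim conjE, hypsubst, goal_cases)
      case 1
      show ?case
        unfolding eq
        by (rule conjI, rule cylinder_critical(1)[OF _ _ c \<gamma> 1(2) K0 c2], erule est,
            erule dom[OF 1 _ order_refl], rule order_trans[OF _ c2c'],
            rule cylinder_critical(2)[OF _ _ c \<gamma> 1(2) K0 c2], erule est,
            erule dom[OF 1 _ order_refl])
    qed
  next
    case q: 3
    obtain c where c: "0 < c" and est: "\<And>f h H. potential_dominated C q (f :: (real ^ 'n) \<times> real \<Rightarrow> real) h H \<Longrightarrow> (AE z in P\<^sub>1. f z \<le> c * H)"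
      using unit_supercritical[OF C0 q] by blast
    have c': "0 < c * (1 + \<bar>L\<bar>)" using c by (intro mult_pos_pos) auto
    show ?case
    proof (rule exI[of _ "c * (1 + \<bar>L\<bar>)"], intro conjI[OF c'] allI impI, elim conjE, hypsubst, goal_cases)
      case 1
      show ?case
        using cylinder_supercritical[OF est dom[OF 1] c 1(2) K0] by (simp only: mult.assoc)
    qed
  qed
qed

end
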